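(* Let $X$ be a Cantor space. For any $Q \subset \mathbb{N}$, the set $C_s(X;Per \supset Q) = \{ f \in C_s(X) : Q \subset Per(f)\}$ is a conjugacy transitive subset of $C_s(X)$. The set $C_s(X;1)$ of maps in $C_s(X)$ which admit a fixed point (which equals $C_s(X; Per \supset Q)$ whenever $1 \in Q$) has a conjugacy transitive element of residual type.
   Context: A Cantor space is a nonempty, compact, zero-dimensional, perfect metric space. $\mathbb{N}$ is the set of positive integers. $C_s(X)$ is the space of continuous surjections $X\to X$ with the sup metric; $H(X)$ is the group of homeomorphisms of $X$, acting by $f\mapsto h\circ f\circ h^{-1}$; orbits are called conjugacy classes. $Per(f)=\{n\in\mathbb{N}: f^n(x)=x \text{ for some } x\in X\}$. A closed, conjugacy invariant subset $K\subset C_s(X)$ is conjugacy transitive if it is the closure of the conjugacy class of some $f\in K$; such an $f$ is called a conjugacy transitive element of $K$. A conjugacy transitive element of $K$ is of residual type if its conjugacy class is a $G_\delta$ subset (equivalently, of $K$ or of $C_s(X)$). *)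

theory Defs
  imports "HOL-Analysis.Analysis"
begin

text \<open>The relation \<open>dim_le\<close> is the small inductive dimension; since \<open>X\<close> is also required to be
  nonempty, dimension \<open>\<le> 0\<close> says that \<open>X\<close> has a base of clopen sets.\<close>

definition cantor_space :: "'a metric \<Rightarrow> bool" where
  "cantor_space X \<longleftrightarrow>
     mspace X \<noteq> {} \<and>
     compact_space (mtopology_of X) \<and>
     mtopology_of X dim_le 0 \<and>
     mtopology_of X derived_set_of mspace X = mspace X"

text \<open>The library space \<open>cfunspace\<close> consists of the bounded continuous maps with the sup metric
  (boundedness is automatic when \<open>X\<close> is compact), each represented by the function that is
  \<open>undefined\<close> outside the carrier.  Conjugation below therefore restricts to the carrier.\<close>

definition cont_surj_space :: "'a metric \<Rightarrow> ('a \<Rightarrow> 'a) metric" where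
  "cont_surj_space X =
     submetric (cfunspace (mtopology_of X) X) {f. f ` mspace X = mspace X}"

definition conj_map :: "'a metric \<Rightarrow> ('a \<Rightarrow> 'a) \<Rightarrow> ('a \<Rightarrow> 'a) \<Rightarrow> 'a \<Rightarrow> 'a" where
  "conj_map X h f = restrict (h \<circ> f \<circ> inv_into (mspace X) h) (mspace X)"

definition conj_class :: "'a metric \<Rightarrow> ('a \<Rightarrow> 'a) \<Rightarrow> ('a \<Rightarrow> 'a) set" where
  "conj_class X f =
     {conj_map X h f | h. homeomorphic_map (mtopology_of X) (mtopology_of X) h}"

definition closed_conj_invariant :: "'a metric \<Rightarrow> ('a \<Rightarrow> 'a) set \<Rightarrow> bool" where
  "closed_conj_invariant X K \<longleftrightarrow>
     closedin (mtopology_of (cont_surj_space X)) K \<and> (\<forall>f\<in>K. conj_class X f \<subseteq> K)"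

definition conj_transitive_element :: "'a metric \<Rightarrow> ('a \<Rightarrow> 'a) set \<Rightarrow> ('a \<Rightarrow> 'a) \<Rightarrow> bool" where
  "conj_transitive_element X K f \<longleftrightarrow>
     closed_conj_invariant X K \<and> f \<in> K \<and>
     mtopology_of (cont_surj_space X) closure_of conj_class X f = K"

definition conj_transitive :: "'a metric \<Rightarrow> ('a \<Rightarrow> 'a) set \<Rightarrow> bool" where
  "conj_transitive X K \<longleftrightarrow> (\<exists>f. conj_transitive_element X K f)"

definition residual_type_element :: "'a metric \<Rightarrow> ('a \<Rightarrow> 'a) set \<Rightarrow> ('a \<Rightarrow> 'a) \<Rightarrow> bool" where
  "residual_type_element X K f \<longleftrightarrow>
     conj_transitive_element X K f \<and>
     gdelta_in (mtopology_of (cont_surj_space X)) (conj_class X f)"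

text \<open>Periods are positive, and not required to be minimal.\<close>

definition Per :: "'a metric \<Rightarrow> ('a \<Rightarrow> 'a) \<Rightarrow> nat set" where
  "Per X f = {n. n > 0 \<and> (\<exists>x\<in>mspace X. (f ^^ n) x = x)}"

definition cont_surj_Per :: "'a metric \<Rightarrow> nat set \<Rightarrow> ('a \<Rightarrow> 'a) set" where
  "cont_surj_Per X Q = {f \<in> mspace (cont_surj_space X). Q \<subseteq> Per X f}"

definition cont_surj_fix :: "'a metric \<Rightarrow> ('a \<Rightarrow> 'a) set" where
  "cont_surj_fix X = {f \<in> mspace (cont_surj_space X). \<exists>x\<in>mspace X. f x = x}"

end

theory Submission
  imports Defs
begin

text \<open>Two facts about Cantor spaces drive the proof.  All Cantor spaces are homeomorphic, and hence so
are all nonempty clopen subsets of \<open>X\<close>.  Therefore, if a map \<open>G\<close> of a compact zero-dimensional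
space \<open>Z\<close> has a map \<open>f\<close> of \<open>X\<close> as a factor, through \<open>\<pi>\<close>, then \<open>G \<times> id\<close> on the Cantor space
\<open>Z \<times> X\<close> can be carried to \<open>X\<close> by a homeomorphism that sends \<open>(z, t)\<close> into the same cell of a given
clopen partition as \<open>\<pi> z\<close>; for a fine partition the copy is uniformly close to \<open>f\<close>
(\<open>factor_transport_close\<close>).  Different copies of \<open>G \<times> id\<close> are conjugate, so one map with many
factors has a large conjugacy class.

For the first claim let \<open>G\<close> be the product of a countable dense family of maps \<open>f\<close> with
\<open>Q \<subseteq> Per f\<close>.  Each member of the family is a factor, so the class of a copy of \<open>G \<times> id\<close> is
dense, and a periodic point of the product is found coordinate by coordinate
(\<open>universal_product\<close>).

For the last claim let \<open>K\<close> be the set of maps with a fixed point, and let \<open>stab n\<close> be the group of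
homeomorphisms that preserve every cell of the \<open>n\<close>-th member of a fixed sequence of partitions.
Call \<open>f\<close> generic if its conjugacy class is dense in \<open>K\<close> and, for each \<open>n\<close>, its orbit under \<open>stab n\<close>
is dense in a neighbourhood of \<open>f\<close>.  A back-and-forth construction shows that any two generic maps
are conjugate (\<open>generic_conjugate\<close>), and genericity is conjugacy invariant; so the generic
maps, if there are any, form one conjugacy class.  They form a countable intersection of open dense
subsets of \<open>K\<close> (\<open>generic_countable_intersection\<close>), hence exist by the Baire category theorem and
form a \<open>G\<^sub>\<delta>\<close> set.

The density needed for this is the combinatorial core (\<open>amalgamating_dense\<close>).  It asks, near
every map and for every \<open>n\<close>, for an open set in which any two maps \<open>g1\<close>, \<open>g2\<close> are approximated by
two maps that are conjugate under \<open>stab n\<close>.  A common extension of \<open>g1\<close> and \<open>g2\<close> provides such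
maps, for example the space of pairs of bi-infinite orbits that stay in the same cells; what must be
shown is that every orbit of one map has a companion orbit of the other.  This holds when both maps
respect the same finite graph whose components are spirals: a cycle, a path leaving it, and a cycle
that this path enters.  A walk in a spiral has no freedom except when it leaves the first
cycle, so every walk is followed by an orbit of every surjection that respects the graph.  Any
map in \<open>K\<close> can be perturbed to respect such a graph, because forward and backward orbits must
repeat a cell.  The fixed point is kept by one additional spiral, over the cell of a fixed point, which
is the only one with loops.\<close>

section \<open>Compact zero-dimensional spaces and spaces of walks\<close>

text \<open>A countable separating family of clopen sets encodes metrizability and zero-dimensionality together.
In this form the property passes at once to closed subspaces and to countable products, and it is
what the coding of points by bits needs.\<close>

definition zero_dim_compact :: "'a topology \<Rightarrow> bool" where
  "zero_dim_compact T \<longleftrightarrow> compact_space T \<and>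
     (\<exists>\<C>. countable \<C> \<and> (\<forall>C\<in>\<C>. openin T C \<and> closedin T C) \<and>
          (\<forall>x\<in>topspace T. \<forall>y\<in>topspace T. x \<noteq> y \<longrightarrow> (\<exists>C\<in>\<C>. (x \<in> C) \<noteq> (y \<in> C))))"

lemma zero_dim_compactI:
  assumes "compact_space T" "countable \<C>"
    and "\<And>C. C \<in> \<C> \<Longrightarrow> openin T C" "\<And>C. C \<in> \<C> \<Longrightarrow> closedin T C"
    and "\<And>x y. \<lbrakk>x \<in> topspace T; y \<in> topspace T; x \<noteq> y\<rbrakk> \<Longrightarrow> \<exists>C\<in>\<C>. (x \<in> C) \<noteq> (y \<in> C)"
  shows "zero_dim_compact T"
  unfolding zero_dim_compact_def using assms by (intro conjI exI[of _ \<C>]) simp_all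

lemma zero_dim_compactE:
  assumes "zero_dim_compact T"
  obtains \<C> where "countable \<C>" "\<And>C. C\<in>\<C> \<Longrightarrow> openin T C \<and> closedin T C"
     "\<And>x y. \<lbrakk>x \<in> topspace T; y \<in> topspace T; x \<noteq> y\<rbrakk> \<Longrightarrow> \<exists>C\<in>\<C>. (x \<in> C) \<noteq> (y \<in> C)"
proof -
  have "\<exists>\<C>. countable \<C> \<and> (\<forall>C\<in>\<C>. openin T C \<and> closedin T C) \<and>
          (\<forall>x\<in>topspace T. \<forall>y\<in>topspace T. x \<noteq> y \<longrightarrow> (\<exists>C\<in>\<C>. (x \<in> C) \<noteq> (y \<in> C)))"
    using assms unfolding zero_dim_compact_def by (rule conjunct2)
  then obtain \<C> where \<C>: "countable \<C>" "\<forall>C\<in>\<C>. openin T C \<and> closedin T C"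
      "\<forall>x\<in>topspace T. \<forall>y\<in>topspace T. x \<noteq> y \<longrightarrow> (\<exists>C\<in>\<C>. (x \<in> C) \<noteq> (y \<in> C))"
    by (elim exE conjE) (rule that)
  show thesis
    by (rule that[OF \<C>(1)]) (use \<C>(2,3) in blast)+
qed

lemma zero_dim_compact_enum:
  assumes "zero_dim_compact T"
  obtains C :: "nat \<Rightarrow> 'a set" where "\<And>n. openin T (C n)" "\<And>n. closedin T (C n)"
    "\<And>x y. \<lbrakk>x \<in> topspace T; y \<in> topspace T; x \<noteq> y\<rbrakk> \<Longrightarrow> \<exists>n. (x \<in> C n) \<noteq> (y \<in> C n)"
proof -
  obtain \<C> where \<C>: "countable \<C>" "\<And>C. C\<in>\<C> \<Longrightarrow> openin T C \<and> closedin T C"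
     "\<And>x y. \<lbrakk>x \<in> topspace T; y \<in> topspace T; x \<noteq> y\<rbrakk> \<Longrightarrow> \<exists>C\<in>\<C>. (x \<in> C) \<noteq> (y \<in> C)"
    using zero_dim_compactE[OF assms] by metis
  define \<D> where "\<D> = insert {} \<C>"
  define C where "C = from_nat_into \<D>"
  have r: "range C = \<D>"
    unfolding C_def \<D>_def using \<C>(1) by (intro range_from_nat_into) auto
  have "openin T (C n) \<and> closedin T (C n)" for n
    using r \<C>(2) unfolding \<D>_def by (metis closedin_empty insert_iff openin_empty rangeI)
  moreover have "\<exists>n. (x \<in> C n) \<noteq> (y \<in> C n)" if "x \<in> topspace T" "y \<in> topspace T" "x \<noteq> y" for x y
    using r \<C>(3)[OF that] unfolding \<D>_def by (metis image_iff insertCI)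
  ultimately show thesis using that by blast
qed

lemma zero_dim_compact_imp_compact: "zero_dim_compact T \<Longrightarrow> compact_space T"
  by (simp add: zero_dim_compact_def)

lemma zero_dim_compact_imp_Hausdorff:
  assumes "zero_dim_compact T" shows "Hausdorff_space T"
  unfolding Hausdorff_space_def
proof (intro allI impI, elim conjE)
  fix x y assume xy: "x \<in> topspace T" "y \<in> topspace T" "x \<noteq> y"
  obtain C where C: "openin T C" "closedin T C" "(x \<in> C) \<noteq> (y \<in> C)"
    using zero_dim_compactE[OF assms] xy by metis
  then have "openin T (topspace T - C)" by auto
  then show "\<exists>U V. openin T U \<and> openin T V \<and> x \<in> U \<and> y \<in> V \<and> disjnt U V"
  proof (cases "x \<in> C")
    case True
    then show ?thesis using C xy \<open>openin T (topspace T - C)\<close>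
      by (intro exI[of _ C] exI[of _ "topspace T - C"]) (simp add: disjnt_def)
  next
    case False
    then show ?thesis using C xy \<open>openin T (topspace T - C)\<close>
      by (intro exI[of _ "topspace T - C"] exI[of _ C]) (auto simp add: disjnt_def)
  qed
qed

lemma zero_dim_compact_subtopology:
  assumes "zero_dim_compact T" "closedin T S"
  shows "zero_dim_compact (subtopology T S)"
proof -
  obtain \<C> where \<C>: "countable \<C>" "\<And>C. C\<in>\<C> \<Longrightarrow> openin T C \<and> closedin T C"
     "\<And>x y. \<lbrakk>x \<in> topspace T; y \<in> topspace T; x \<noteq> y\<rbrakk> \<Longrightarrow> \<exists>C\<in>\<C>. (x \<in> C) \<noteq> (y \<in> C)"
    using zero_dim_compactE[OF assms(1)] by metis
  show ?thesis
  proof (rule zero_dim_compactI[of _ "(\<lambda>C. S \<inter> C) ` \<C>"])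
    show "compact_space (subtopology T S)"
      using assms by (simp add: closedin_compact_space compact_space_subtopology zero_dim_compact_imp_compact)
    fix x y assume "x \<in> topspace (subtopology T S)" "y \<in> topspace (subtopology T S)" "x \<noteq> y"
    then show "\<exists>C\<in>(\<inter>) S ` \<C>. (x \<in> C) \<noteq> (y \<in> C)"
      using \<C>(3)[of x y] by auto
  qed (use \<C> in \<open>auto simp: openin_subtopology_Int2 closedin_subtopology_Int_closed\<close>)
qed

lemma clopen_vimage:
  assumes "continuous_map S T f" "openin T C" "closedin T C"
  shows "openin S {x \<in> topspace S. f x \<in> C}" "closedin S {x \<in> topspace S. f x \<in> C}"
  using assms by (auto simp: openin_continuous_map_preimage closedin_continuous_map_preimage)

lemma zero_dim_compact_prod:
  assumes "zero_dim_compact S" "zero_dim_compact T"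
  shows "zero_dim_compact (prod_topology S T)"
proof -
  obtain \<C> where \<C>: "countable \<C>" "\<And>C. C\<in>\<C> \<Longrightarrow> openin S C \<and> closedin S C"
     "\<And>x y. \<lbrakk>x \<in> topspace S; y \<in> topspace S; x \<noteq> y\<rbrakk> \<Longrightarrow> \<exists>C\<in>\<C>. (x \<in> C) \<noteq> (y \<in> C)"
    using zero_dim_compactE[OF assms(1)] by metis
  obtain \<D> where \<D>: "countable \<D>" "\<And>C. C\<in>\<D> \<Longrightarrow> openin T C \<and> closedin T C"
     "\<And>x y. \<lbrakk>x \<in> topspace T; y \<in> topspace T; x \<noteq> y\<rbrakk> \<Longrightarrow> \<exists>C\<in>\<D>. (x \<in> C) \<noteq> (y \<in> C)"
    using zero_dim_compactE[OF assms(2)] by metis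
  let ?\<E> = "(\<lambda>C. {p \<in> topspace (prod_topology S T). fst p \<in> C}) ` \<C> \<union>
             (\<lambda>C. {p \<in> topspace (prod_topology S T). snd p \<in> C}) ` \<D>"
  show ?thesis
  proof (rule zero_dim_compactI[of _ ?\<E>])
    show "compact_space (prod_topology S T)"
      using assms by (simp add: compact_space_prod_topology zero_dim_compact_imp_compact)
    fix p q assume pq: "p \<in> topspace (prod_topology S T)" "q \<in> topspace (prod_topology S T)" "p \<noteq> q"
    then consider "fst p \<noteq> fst q" | "snd p \<noteq> snd q" by (auto simp: prod_eq_iff)
    then show "\<exists>C\<in>?\<E>. (p \<in> C) \<noteq> (q \<in> C)"
    proof cases
      case 1
      then obtain C where "C \<in> \<C>" "(fst p \<in> C) \<noteq> (fst q \<in> C)"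
        using \<C>(3)[of "fst p" "fst q"] pq by (metis mem_Times_iff topspace_prod_topology)
      then show ?thesis using pq by (intro bexI[of _ "{p \<in> topspace (prod_topology S T). fst p \<in> C}"]) auto
    next
      case 2
      then obtain C where "C \<in> \<D>" "(snd p \<in> C) \<noteq> (snd q \<in> C)"
        using \<D>(3)[of "snd p" "snd q"] pq by (metis mem_Times_iff topspace_prod_topology)
      then show ?thesis using pq by (intro bexI[of _ "{p \<in> topspace (prod_topology S T). snd p \<in> C}"]) auto
    qed
  next
    fix C assume C: "C \<in> ?\<E>"
    show "openin (prod_topology S T) C" "closedin (prod_topology S T) C"
      using C \<C>(2) \<D>(2) by (auto simp del: topspace_prod_topology
           intro!: clopen_vimage[OF continuous_map_fst] clopen_vimage[OF continuous_map_snd])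
  qed (use \<C>(1) \<D>(1) in auto)
qed

lemma zero_dim_compact_product:
  assumes "zero_dim_compact T"
  shows "zero_dim_compact (product_topology (\<lambda>i::'i::countable. T) UNIV)"
proof -
  obtain \<C> where \<C>: "countable \<C>" "\<And>C. C\<in>\<C> \<Longrightarrow> openin T C \<and> closedin T C"
     "\<And>x y. \<lbrakk>x \<in> topspace T; y \<in> topspace T; x \<noteq> y\<rbrakk> \<Longrightarrow> \<exists>C\<in>\<C>. (x \<in> C) \<noteq> (y \<in> C)"
    using zero_dim_compactE[OF assms(1)] by metis
  let ?P = "product_topology (\<lambda>i::'i. T) UNIV"
  let ?\<E> = "(\<lambda>(i,C). {p \<in> topspace ?P. p i \<in> C}) ` (UNIV \<times> \<C>)"
  show ?thesis
  proof (rule zero_dim_compactI[of _ ?\<E>])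
    show "compact_space ?P"
      using assms by (simp add: compact_space_product_topology zero_dim_compact_imp_compact)
    fix p q assume pq: "p \<in> topspace ?P" "q \<in> topspace ?P" "p \<noteq> q"
    then obtain i where i: "p i \<noteq> q i" by (metis ext)
    have "p i \<in> topspace T" "q i \<in> topspace T" using pq by (auto simp: PiE_iff)
    then obtain C where "C \<in> \<C>" "(p i \<in> C) \<noteq> (q i \<in> C)"
      using \<C>(3) i by blast
    then show "\<exists>C\<in>?\<E>. (p \<in> C) \<noteq> (q \<in> C)" using pq
      by (intro bexI[of _ "{p \<in> topspace ?P. p i \<in> C}"]) auto
  next
    fix C assume C: "C \<in> ?\<E>"
    then obtain i D where D: "D \<in> \<C>" "C = {p \<in> topspace ?P. p i \<in> D}" by auto
    show "openin ?P C" "closedin ?P C"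
      unfolding D(2) using \<C>(2)[OF D(1)]
      by (auto simp del: topspace_product_topology intro!: clopen_vimage continuous_map_product_projection)
  qed (use \<C>(1) in auto)
qed

lemma zero_dim_compact_finite_discrete:
  assumes "finite S"
  shows "zero_dim_compact (discrete_topology S)"
  by (rule zero_dim_compactI[of _ "(\<lambda>x. {x}) ` S"])
     (use assms in \<open>auto simp: compact_space_discrete_topology countable_finite\<close>)

text \<open>Two-sided sequences, so that the shift is surjective for every relation \<open>E\<close>.\<close>

definition walks :: "'s topology \<Rightarrow> ('s \<times> 's) set \<Rightarrow> (int \<Rightarrow> 's) topology" where
  "walks S E = subtopology (product_topology (\<lambda>_. S) UNIV) {w. \<forall>n. (w n, w (n+1)) \<in> E}"

definition shift :: "(int \<Rightarrow> 's) \<Rightarrow> int \<Rightarrow> 's" where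
  "shift w = (\<lambda>n. w (n+1))"

lemma topspace_walks:
  "topspace (walks S E) = {w. (\<forall>n. w n \<in> topspace S) \<and> (\<forall>n. (w n, w (n+1)) \<in> E)}"
  by (auto simp: walks_def PiE_iff)

lemma continuous_map_walks_coordinate: "continuous_map (walks S E) S (\<lambda>w. w n)"
  unfolding walks_def
  by (intro continuous_map_from_subtopology continuous_map_product_projection) simp

lemma zero_dim_compact_walks:
  assumes "zero_dim_compact S" "closedin (prod_topology S S) E"
  shows "zero_dim_compact (walks S E)"
proof -
  let ?P = "product_topology (\<lambda>_::int. S) UNIV"
  have E: "closedin ?P {w \<in> topspace ?P. (w n, w (n+1)) \<in> E}" for n
    by (intro closedin_continuous_map_preimage[OF _ assms(2)] continuous_map_pairedI
          continuous_map_product_projection) auto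
  have "closedin ?P (\<Inter>n. {w \<in> topspace ?P. (w n, w (n+1)) \<in> E})"
    by (rule closedin_Inter) (use E in auto)
  moreover have "walks S E = subtopology ?P (\<Inter>n. {w \<in> topspace ?P. (w n, w (n+1)) \<in> E})"
    unfolding walks_def
    by (subst subtopology_restrict[symmetric], rule arg_cong[of _ _ "subtopology ?P"]) auto
  ultimately show ?thesis
    using zero_dim_compact_subtopology[OF zero_dim_compact_product[OF assms(1)]] by simp
qed

lemma continuous_map_shift: "continuous_map (walks S E) (walks S E) shift"
proof -
  have "continuous_map (walks S E) (product_topology (\<lambda>_. S) UNIV) shift"
    unfolding continuous_map_componentwise_UNIV shift_def
    by (simp add: continuous_map_walks_coordinate)
  moreover have "shift ` topspace (walks S E) \<subseteq> {w. \<forall>n. (w n, w (n+1)) \<in> E}"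
    by (auto simp: topspace_walks shift_def)
  ultimately show ?thesis
    unfolding walks_def[of S E] continuous_map_in_subtopology
    by (simp add: walks_def image_subset_iff_funcset)
qed

lemma shift_image_walks: "shift ` topspace (walks S E) = topspace (walks S E)"
proof
  show "shift ` topspace (walks S E) \<subseteq> topspace (walks S E)"
    by (auto simp: topspace_walks shift_def)
  show "topspace (walks S E) \<subseteq> shift ` topspace (walks S E)"
  proof
    fix w assume w: "w \<in> topspace (walks S E)"
    define u where "u = (\<lambda>n::int. w (n - 1))"
    have "(u n, u (n+1)) \<in> E" "u n \<in> topspace S" for n
    proof -
      have "(w (n-1), w (n-1+1)) \<in> E" using w unfolding topspace_walks by blast
      then show "(u n, u (n+1)) \<in> E" by (simp add: u_def)
      show "u n \<in> topspace S" using w by (simp add: u_def topspace_walks)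
    qed
    then have "u \<in> topspace (walks S E)" by (simp add: topspace_walks)
    moreover have "w = shift u" by (simp add: u_def shift_def)
    ultimately show "w \<in> shift ` topspace (walks S E)" by blast
  qed
qed

section \<open>Cantor spaces: uniqueness and homeomorphisms respecting labels\<close>

definition cantor_like :: "'a topology \<Rightarrow> bool" where
  "cantor_like T \<longleftrightarrow> zero_dim_compact T \<and> topspace T \<noteq> {} \<and> (\<forall>x. \<not> openin T {x})"

lemma cantor_like_subtopology:
  assumes "cantor_like T" "openin T S" "closedin T S" "S \<noteq> {}"
  shows "cantor_like (subtopology T S)"
  using assms by (auto simp: cantor_like_def zero_dim_compact_subtopology openin_open_subtopology
       dest: openin_subset)

text \<open>Multiplying by a Cantor space removes isolated points; this is how arbitrary compact zero-dimensional
systems are turned into systems on a Cantor space.\<close>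

lemma cantor_like_prod:
  assumes "zero_dim_compact Z" "topspace Z \<noteq> {}" "cantor_like T"
  shows "cantor_like (prod_topology Z T)"
  unfolding cantor_like_def
proof (intro conjI allI notI)
  fix p assume p: "openin (prod_topology Z T) {p}"
  then have "openin T (snd ` {p})"
    using open_map_snd unfolding open_map_def by blast
  then show False using assms(3) by (simp add: cantor_like_def)
qed (use assms in \<open>auto simp: cantor_like_def zero_dim_compact_prod\<close>)

lemma clopen_split:
  assumes "cantor_like T" "openin T W" "closedin T W" "W \<noteq> {}"
  obtains V where "openin T V" "closedin T V" "V \<subseteq> W" "V \<noteq> {}" "W - V \<noteq> {}"
proof -
  obtain C where C: "\<And>n::nat. openin T (C n)" "\<And>n. closedin T (C n)"
    "\<And>x y. \<lbrakk>x \<in> topspace T; y \<in> topspace T; x \<noteq> y\<rbrakk> \<Longrightarrow> \<exists>n. (x \<in> C n) \<noteq> (y \<in> C n)"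
    using assms(1) zero_dim_compact_enum[of T] unfolding cantor_like_def by metis
  obtain x where x: "x \<in> W" using assms by auto
  then have "W \<noteq> {x}" using assms unfolding cantor_like_def by metis
  then obtain y where y: "y \<in> W" "y \<noteq> x" using x by auto
  then obtain n where "(x \<in> C n) \<noteq> (y \<in> C n)"
    using C(3) x y assms(2) openin_subset by (metis subsetD)
  then have "W \<inter> C n \<noteq> {}" "W - (W \<inter> C n) \<noteq> {}" using x y by auto
  then show thesis using that[of "W \<inter> C n"] C assms by (auto simp: openin_Int closedin_Int)
qed

abbreviation cantor_cube :: "(nat \<Rightarrow> bool) topology" where
  "cantor_cube \<equiv> product_topology (\<lambda>_. discrete_topology UNIV) UNIV"

text \<open>Brouwer's characterisation.  Split the space again and again into two nonempty clopen halves, where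
at stage \<open>n\<close> a cell that is cut by \<open>C n\<close> is split along \<open>C n\<close>.  After stage \<open>n\<close> every cell lies on
one side of \<open>C n\<close>, so the cells along an infinite branch cannot contain two points; by compactness
they contain one.  Reading off the branch of a point is the homeomorphism.\<close>

lemma cantor_like_homeomorphic_cube:
  assumes T: "cantor_like T"
  shows "T homeomorphic_space cantor_cube"
proof -
  obtain C where C: "\<And>n::nat. openin T (C n)" "\<And>n. closedin T (C n)"
    "\<And>x y. \<lbrakk>x \<in> topspace T; y \<in> topspace T; x \<noteq> y\<rbrakk> \<Longrightarrow> \<exists>n. (x \<in> C n) \<noteq> (y \<in> C n)"
    using T zero_dim_compact_enum[of T] unfolding cantor_like_def by metis
  define good where "good = (\<lambda>n W V. openin T V \<and> closedin T V \<and> V \<subseteq> W \<and> V \<noteq> {} \<and> W - V \<noteq> {}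
      \<and> (V \<subseteq> C n \<or> V \<inter> C n = {}) \<and> (W - V \<subseteq> C n \<or> (W - V) \<inter> C n = {}))"
  have "\<exists>V. good n W V" if W: "openin T W" "closedin T W" "W \<noteq> {}" for n W
  proof (cases "W \<inter> C n \<noteq> {} \<and> W - C n \<noteq> {}")
    case True
    then have "good n W (W \<inter> C n)"
      using W C by (auto simp: good_def)
    then show ?thesis by blast
  next
    case False
    obtain V where "openin T V" "closedin T V" "V \<subseteq> W" "V \<noteq> {}" "W - V \<noteq> {}"
      using clopen_split[OF T W] .
    then have "good n W V" using False by (auto simp: good_def)
    then show ?thesis by blast
  qed
  moreover define sp where "sp = (\<lambda>n W. SOME V. good n W V)"
  ultimately have sp: "\<And>n W. \<lbrakk>openin T W; closedin T W; W \<noteq> {}\<rbrakk> \<Longrightarrow> good n W (sp n W)"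
    by (simp add: someI_ex)
  define U where "U = rec_list (topspace T)
        (\<lambda>b s W. if b then sp (length s) W else W - sp (length s) W)"
  have U_Nil: "U [] = topspace T"
    and U_Cons: "U (b # s) = (if b then sp (length s) (U s) else U s - sp (length s) (U s))" for b s
    by (simp_all add: U_def)
  have U: "openin T (U s) \<and> closedin T (U s) \<and> U s \<noteq> {}" for s
  proof (induction s)
    case Nil
    then show ?case using T by (simp add: U_Nil cantor_like_def)
  next
    case (Cons b s)
    then have "good (length s) (U s) (sp (length s) (U s))" using sp by blast
    then show ?case using Cons by (auto simp: U_Cons good_def)
  qed
  have good: "good (length s) (U s) (sp (length s) (U s))" for s using sp U by blast
  have decides: "U (b # s) \<subseteq> C (length s) \<or> U (b # s) \<inter> C (length s) = {}" for b s
    using good[of s] by (auto simp: U_Cons good_def)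
  have Cons_sub: "U (b # s) \<subseteq> U s" for b s
    using good[of s] by (auto simp: U_Cons good_def)
  define adr where "adr = (\<lambda>x. rec_nat [] (\<lambda>n s. (x \<in> sp n (U s)) # s))"
  have adr_0: "adr x 0 = []" and adr_Suc: "adr x (Suc n) = (x \<in> sp n (U (adr x n))) # adr x n" for x n
    by (simp_all add: adr_def)
  have len: "length (adr x n) = n" for x n by (induction n) (auto simp: adr_0 adr_Suc)
  have mem: "x \<in> U s \<longleftrightarrow> adr x (length s) = s" if "x \<in> topspace T" for x s
  proof (induction s)
    case Nil
    then show ?case using that by (simp add: U_Nil adr_0)
  next
    case (Cons b s)
    have "x \<in> U (b # s) \<longleftrightarrow> x \<in> U s \<and> (x \<in> sp (length s) (U s)) = b"
      using good[of s] by (auto simp: U_Cons good_def)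
    then show ?case using Cons by (auto simp: adr_Suc)
  qed
  have mem': "x \<in> U (adr x n)" if "x \<in> topspace T" for x n
    using mem[OF that, of "adr x n"] by (simp add: len)
  define \<phi> where "\<phi> = (\<lambda>x n. x \<in> sp n (U (adr x n)))"
  have adr_\<phi>: "adr x (Suc n) = \<phi> x n # adr x n" for x n by (simp add: adr_Suc \<phi>_def)
  have cont: "continuous_map T cantor_cube \<phi>"
    unfolding continuous_map_componentwise_UNIV
  proof
    fix n
    show "continuous_map T (discrete_topology UNIV) (\<lambda>x. \<phi> x n)"
      unfolding continuous_map_def
    proof (intro conjI allI impI)
      fix B :: "bool set"
      have "{x \<in> topspace T. \<phi> x n \<in> B} = (\<Union>s\<in>{s. length s = n}. \<Union>b\<in>B. U (b # s))" (is "?L = ?R")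
      proof
        show "?L \<subseteq> ?R"
        proof
          fix x assume x: "x \<in> ?L"
          then have "x \<in> U (\<phi> x n # adr x n)" using mem'[of x "Suc n"] by (simp add: adr_\<phi>)
          then show "x \<in> ?R" using x len by blast
        qed
        show "?R \<subseteq> ?L"
        proof
          fix x assume "x \<in> ?R"
          then obtain s b where sb: "length s = n" "b \<in> B" "x \<in> U (b # s)" by blast
          then have x: "x \<in> topspace T" using U openin_subset by blast
          then have "adr x (Suc n) = b # s" using mem[OF x, of "b # s"] sb by simp
          then show "x \<in> ?L" using x sb by (simp add: adr_\<phi>)
        qed
      qed
      also have "openin T ?R" using U by blast
      finally show "openin T {x \<in> topspace T. \<phi> x n \<in> B}" .
    qed simp
  qed
  have inj: "inj_on \<phi> (topspace T)"
  proof (rule inj_onI, rule ccontr)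
    fix x y assume xy: "x \<in> topspace T" "y \<in> topspace T" "\<phi> x = \<phi> y" "x \<noteq> y"
    have e: "adr x n = adr y n" for n
      by (induction n) (auto simp: adr_0 adr_\<phi> xy)
    obtain n where "(x \<in> C n) \<noteq> (y \<in> C n)" using C(3) xy by blast
    moreover have "x \<in> U (\<phi> x n # adr x n)" "y \<in> U (\<phi> x n # adr x n)"
      using mem'[of _ "Suc n"] xy e by (metis adr_\<phi>)+
    ultimately show False using decides[of "\<phi> x n" "adr x n"] by (auto simp: len)
  qed
  have surj: "\<phi> ` topspace T = topspace cantor_cube"
  proof -
    have "b \<in> \<phi> ` topspace T" for b :: "nat \<Rightarrow> bool"
    proof -
      define pre where "pre = rec_nat [] (\<lambda>n s. b n # s)"
      have pre: "pre 0 = []" "\<And>n. pre (Suc n) = b n # pre n" by (simp_all add: pre_def)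
      have lenp: "length (pre n) = n" for n by (induction n) (auto simp: pre)
      have "(\<Inter>n. U (pre n)) \<noteq> {}"
      proof (rule compact_space_imp_nest)
        show "compact_space T" using T by (simp add: cantor_like_def zero_dim_compact_def)
        show "decseq (\<lambda>n. U (pre n))" using Cons_sub by (intro decseq_SucI) (simp add: pre)
      qed (use U in auto)
      then obtain x where x: "\<And>n. x \<in> U (pre n)" by auto
      have xT: "x \<in> topspace T" using x[of 0] by (simp add: pre U_Nil)
      have e: "adr x n = pre n" for n using mem[OF xT, of "pre n"] x lenp by simp
      have "\<phi> x n = b n" for n
        using e[of "Suc n"] e[of n] by (simp add: adr_\<phi> pre)
      then have "\<phi> x = b" by auto
      then show ?thesis using xT by blast
    qed
    then show ?thesis by auto
  qed
  have "homeomorphic_map T cantor_cube \<phi>"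
  proof (rule continuous_imp_homeomorphic_map[OF cont _ _ surj inj])
    show "compact_space T" using T by (simp add: cantor_like_def zero_dim_compact_def)
    show "Hausdorff_space cantor_cube"
      by (intro zero_dim_compact_imp_Hausdorff zero_dim_compact_product
             zero_dim_compact_finite_discrete) simp
  qed
  then show ?thesis by (rule homeomorphic_map_imp_homeomorphic_space)
qed

lemma cantor_like_homeomorphic:
  "\<lbrakk>cantor_like S; cantor_like T\<rbrakk> \<Longrightarrow> S homeomorphic_space T"
  by (metis cantor_like_homeomorphic_cube homeomorphic_space_sym homeomorphic_space_trans)

abbreviation locally_constant :: "'a topology \<Rightarrow> ('a \<Rightarrow> 'l) \<Rightarrow> bool" where
  "locally_constant T c \<equiv> continuous_map T (discrete_topology UNIV) c"

lemma locally_constant_clopen: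
  assumes "locally_constant T c"
  shows "openin T {x \<in> topspace T. P (c x)}" "closedin T {x \<in> topspace T. P (c x)}"
  using clopen_vimage[OF assms, of "Collect P"] by auto

lemma locally_constantI:
  assumes "\<And>l. openin T {x \<in> topspace T. c x = l}"
  shows "locally_constant T c"
  unfolding continuous_map_def
proof (intro conjI allI impI)
  fix B
  have "{x \<in> topspace T. c x \<in> B} = (\<Union>l\<in>B. {x \<in> topspace T. c x = l})" by auto
  also have "openin T \<dots>" using assms by blast
  finally show "openin T {x \<in> topspace T. c x \<in> B}" .
qed simp

lemma locally_constant_finite_image:
  assumes "compact_space T" "locally_constant T c"
  shows "finite (c ` topspace T)"
  using image_compactin[of T "topspace T" "discrete_topology UNIV" c] assms
  by (simp add: compact_space_def compactin_discrete_topology)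

lemma locally_constant_comp:
  "locally_constant T c \<Longrightarrow> locally_constant T (\<lambda>x. f (c x))"
  by (rule continuous_map_compose[unfolded o_def, of _ "discrete_topology UNIV"]) auto

lemma locally_constant_Pair:
  assumes "locally_constant T c" "locally_constant T d"
  shows "locally_constant T (\<lambda>x. (c x, d x))"
proof (rule locally_constantI)
  fix l
  have "{x \<in> topspace T. (c x, d x) = l} = {x \<in> topspace T. c x = fst l} \<inter> {x \<in> topspace T. d x = snd l}"
    by auto
  then show "openin T {x \<in> topspace T. (c x, d x) = l}"
    using openin_Int[OF locally_constant_clopen(1)[OF assms(1), of "\<lambda>u. u = fst l"]
        locally_constant_clopen(1)[OF assms(2), of "\<lambda>u. u = snd l"]] by simp
qed

text \<open>For each label the set of points carrying it is a Cantor space on both sides, so there is a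
homeomorphism between them; the finitely many homeomorphisms are glued.\<close>

lemma labelled_product_homeomorphism:
  assumes Z: "zero_dim_compact Z" and T: "cantor_like T"
    and c: "locally_constant Z c" and a: "locally_constant T a"
    and ca: "c ` topspace Z = a ` topspace T"
  obtains h where "homeomorphic_map (prod_topology Z T) T h"
    "\<And>z t. \<lbrakk>z \<in> topspace Z; t \<in> topspace T\<rbrakk> \<Longrightarrow> a (h (z, t)) = c z"
proof -
  let ?ZT = "prod_topology Z T"
  define P where "P = (\<lambda>l. {p \<in> topspace ?ZT. c (fst p) = l})"
  define A where "A = (\<lambda>l. {x \<in> topspace T. a x = l})"
  have Zne: "topspace Z \<noteq> {}" using ca T by (auto simp: cantor_like_def)
  have cf: "locally_constant ?ZT (\<lambda>p. c (fst p))"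
    using continuous_map_compose[OF continuous_map_fst c] by (simp add: o_def)
  have P: "openin ?ZT (P l)" "closedin ?ZT (P l)" for l
    unfolding P_def by (rule locally_constant_clopen[OF cf])+
  have A: "openin T (A l)" "closedin T (A l)" for l
    unfolding A_def by (rule locally_constant_clopen[OF a])+
  have "\<exists>h. homeomorphic_map (subtopology ?ZT (P l)) (subtopology T (A l)) h" if l: "l \<in> a ` topspace T" for l
  proof -
    have "A l \<noteq> {}" using l by (auto simp: A_def)
    moreover obtain z where z: "z \<in> topspace Z" "c z = l"
      using l unfolding ca[symmetric] by blast
    obtain t where "t \<in> topspace T" using T unfolding cantor_like_def by blast
    then have "(z, t) \<in> P l" using z by (simp add: P_def)
    then have "P l \<noteq> {}" by blast
    ultimately show ?thesis
      using cantor_like_homeomorphic cantor_like_subtopology A P cantor_like_prod[OF Z Zne T] T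
        homeomorphic_space by metis
  qed
  then obtain hl where hl: "\<And>l. l \<in> a ` topspace T \<Longrightarrow>
      homeomorphic_map (subtopology ?ZT (P l)) (subtopology T (A l)) (hl l)" by metis
  have Psub: "P l \<subseteq> topspace ?ZT" "A l \<subseteq> topspace T" for l by (auto simp: P_def A_def)
  have bij: "bij_betw (hl l) (P l) (A l)" if "l \<in> a ` topspace T" for l
    using hl[OF that] Psub[of l] unfolding homeomorphic_eq_everything_map
    by (simp add: bij_betw_def topspace_subtopology_subset Int_absorb1)
  define h where "h = (\<lambda>p. hl (c (fst p)) p)"
  have hP: "h p = hl l p" if "p \<in> P l" for p l using that by (simp add: h_def P_def)
  have cl: "c (fst p) \<in> a ` topspace T" "p \<in> P (c (fst p))" if "p \<in> topspace ?ZT" for p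
    using that ca by (auto simp: P_def)
  have lab: "a (h p) = c (fst p)" "h p \<in> topspace T" if "p \<in> topspace ?ZT" for p
    using bij_betwE[OF bij[OF cl(1)[OF that]]] cl(2)[OF that] hP[OF cl(2)[OF that]]
    by (auto simp: A_def)
  have "continuous_map ?ZT T h"
  proof (rule pasting_lemma[of "a ` topspace T" _ P])
    show "continuous_map (subtopology ?ZT (P l)) T (hl l)" if "l \<in> a ` topspace T" for l
      using hl[OF that] homeomorphic_imp_continuous_map continuous_map_into_fulltopology by metis
    show "hl i x = hl j x" if "x \<in> topspace ?ZT \<inter> P i \<inter> P j" for i j x
      using that by (auto simp: P_def)
    show "\<exists>j. j \<in> a ` topspace T \<and> x \<in> P j \<and> h x = hl j x" if "x \<in> topspace ?ZT" for x
      using cl[OF that] h_def by blast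
  qed (use P in auto)
  moreover have "inj_on h (topspace ?ZT)"
  proof (rule inj_onI)
    fix p q assume pq: "p \<in> topspace ?ZT" "q \<in> topspace ?ZT" "h p = h q"
    then have "c (fst p) = c (fst q)" using lab by metis
    then show "p = q"
      using bij[OF cl(1)[OF pq(1)]] cl[OF pq(1)] cl[OF pq(2)] pq(3)
      unfolding bij_betw_def inj_on_def h_def by metis
  qed
  moreover have "h ` topspace ?ZT = topspace T"
  proof
    show "h ` topspace ?ZT \<subseteq> topspace T" using lab by blast
    show "topspace T \<subseteq> h ` topspace ?ZT"
    proof
      fix x assume x: "x \<in> topspace T"
      then have "x \<in> hl (a x) ` P (a x)"
        using bij[of "a x"] by (auto simp: A_def bij_betw_def)
      then show "x \<in> h ` topspace ?ZT" using hP Psub by force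
    qed
  qed
  moreover have "compact_space ?ZT" "Hausdorff_space T"
    using Z T by (auto simp: cantor_like_def zero_dim_compact_imp_Hausdorff zero_dim_compact_prod
         zero_dim_compact_imp_compact)
  ultimately have "homeomorphic_map ?ZT T h"
    by (intro continuous_imp_homeomorphic_map) auto
  then show thesis using that lab by force
qed

section \<open>Codes of points and the conjugation action\<close>

text \<open>A separating sequence of clopen sets is fixed once and for all.  The first \<open>n\<close> membership bits of a
point name its cell in the \<open>n\<close>-th of a sequence of ever finer partitions; these cells replace
distances in everything that follows.\<close>

locale coded_cantor =
  fixes T :: "'a topology" and C :: "nat \<Rightarrow> 'a set"
  assumes cantor: "cantor_like T"
    and openin_C: "openin T (C n)" and closedin_C: "closedin T (C n)"
    and C_separates: "\<lbrakk>x \<in> topspace T; y \<in> topspace T; x \<noteq> y\<rbrakk> \<Longrightarrow> \<exists>n. (x \<in> C n) \<noteq> (y \<in> C n)"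
begin

abbreviation M :: "'a set" where "M \<equiv> topspace T"

definition code :: "nat \<Rightarrow> 'a \<Rightarrow> bool list" where
  "code n x = map (\<lambda>i. x \<in> C i) [0..<n]"

lemma compact_T: "compact_space T" and Hausdorff_T: "Hausdorff_space T" and zero_dim_compact_T: "zero_dim_compact T"
  and M_nonempty: "M \<noteq> {}"
  using cantor by (auto simp: cantor_like_def zero_dim_compact_imp_Hausdorff zero_dim_compact_imp_compact)

lemma code_eq_iff: "code n x = code n y \<longleftrightarrow> (\<forall>i<n. (x \<in> C i) = (y \<in> C i))"
  by (auto simp: code_def)

lemma code_0 [simp]: "code 0 x = code 0 y" by (simp add: code_def)

lemma code_mono: "\<lbrakk>code n x = code n y; m \<le> n\<rbrakk> \<Longrightarrow> code m x = code m y"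
  by (simp add: code_eq_iff)

lemma code_separates: "\<lbrakk>x \<in> M; y \<in> M; \<And>n. code n x = code n y\<rbrakk> \<Longrightarrow> x = y"
  using C_separates[of x y] by (metis code_eq_iff lessI)

lemma locally_constant_code: "locally_constant T (code n)"
proof (induction n)
  case 0
  show ?case by (simp add: code_def)
next
  case (Suc n)
  have "locally_constant T (\<lambda>x. x \<in> C n)"
  proof (rule locally_constantI)
    fix l
    have "{x \<in> M. (x \<in> C n) = l} = (if l then C n else M - C n)"
      using openin_subset[OF openin_C[of n]] by auto
    also have "openin T \<dots>" using openin_C closedin_C by (cases l) auto
    finally show "openin T {x \<in> M. (x \<in> C n) = l}" .
  qed
  then show ?case
    using locally_constant_comp[OF locally_constant_Pair[OF Suc], of "\<lambda>x. x \<in> C n" "\<lambda>(u, b). u @ [b]"]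
    by (simp add: code_def)
qed

lemma nested_nonempty:
  assumes "\<And>n. closedin T (F n)" "\<And>n. F n \<noteq> {}" "\<And>n. F (Suc n) \<subseteq> F n"
  obtains x where "\<And>n::nat. x \<in> F n"
proof -
  have "(\<Inter>n. F n) \<noteq> {}"
    using compact_space_imp_nest[OF compact_T, of F] assms by (simp add: decseq_Suc_iff)
  then show thesis using that by blast
qed

text \<open>In the compact square, the closed sets of pairs with equal \<open>n\<close>-codes and different values of \<open>b\<close>
decrease to the empty set, because points with equal codes for all \<open>n\<close> coincide.\<close>

lemma code_refines:
  assumes b: "locally_constant T b"
  obtains n where "\<And>x y. \<lbrakk>x \<in> M; y \<in> M; code n x = code n y\<rbrakk> \<Longrightarrow> b x = b y"
proof (rule ccontr)
  assume neg: "\<not> thesis"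
  let ?TT = "prod_topology T T"
  define F where "F = (\<lambda>n. {p \<in> topspace ?TT. code n (fst p) = code n (snd p) \<and> b (fst p) \<noteq> b (snd p)})"
  have lc: "locally_constant ?TT (\<lambda>p. c (fst p))" "locally_constant ?TT (\<lambda>p. c (snd p))"
    if "locally_constant T c" for c :: "'a \<Rightarrow> 'z"
    using continuous_map_compose[OF continuous_map_fst that] continuous_map_compose[OF continuous_map_snd that]
    by (simp_all add: o_def)
  have "closedin ?TT (F n)" for n
    using locally_constant_clopen(2)[OF locally_constant_Pair[OF
      locally_constant_Pair[OF lc[OF locally_constant_code[of n]]] locally_constant_Pair[OF lc[OF b]]],
      of "\<lambda>((u,v),(w,z)). u = v \<and> w \<noteq> z"]
    unfolding F_def by simp
  moreover have "F n \<noteq> {}" for n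
  proof
    assume "F n = {}"
    have "b x = b y" if "x \<in> M" "y \<in> M" "code n x = code n y" for x y
    proof (rule ccontr)
      assume "b x \<noteq> b y"
      then have "(x, y) \<in> F n" using that by (simp add: F_def)
      then show False using \<open>F n = {}\<close> by simp
    qed
    then have thesis by (rule that[of n])
    then show False by (rule notE[OF neg])
  qed
  moreover have "decseq F"
    by (intro decseq_SucI) (auto simp: F_def intro: code_mono)
  ultimately have "(\<Inter>n. F n) \<noteq> {}"
    using compact_space_imp_nest[of ?TT F] compact_T by (simp add: compact_space_prod_topology)
  then obtain p where p: "p \<in> F n" for n by blast
  have p: "fst p \<in> M" "snd p \<in> M" "code n (fst p) = code n (snd p)" "b (fst p) \<noteq> b (snd p)" for n
    using p[of n] by (auto simp: F_def)
  have "fst p = snd p" by (rule code_separates) (rule p)+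
  then show False using p by simp
qed

lemma uniformly_continuous_code:
  assumes "continuous_map T T f"
  obtains m where "m \<ge> n"
     "\<And>x y. \<lbrakk>x \<in> M; y \<in> M; code m x = code m y\<rbrakk> \<Longrightarrow> code n (f x) = code n (f y)"
proof -
  have "locally_constant T (\<lambda>x. code n (f x))"
    using continuous_map_compose[OF assms locally_constant_code] by (simp add: o_def)
  then obtain m where m: "\<And>x y. \<lbrakk>x \<in> M; y \<in> M; code m x = code m y\<rbrakk> \<Longrightarrow> code n (f x) = code n (f y)"
    by (rule code_refines) blast
  show thesis
  proof (rule that[of "max m n"])
    show "code n (f x) = code n (f y)" if "x \<in> M" "y \<in> M" "code (max m n) x = code (max m n) y" for x y
      using m that code_mono max.cobounded1 by metis
  qed simp
qed

lemma continuous_map_codeI: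
  assumes "f \<in> M \<rightarrow> M"
    and "\<And>n. \<exists>m. \<forall>x\<in>M. \<forall>y\<in>M. code m x = code m y \<longrightarrow> code n (f x) = code n (f y)"
  shows "continuous_map T T f"
proof -
  show ?thesis
    unfolding continuous_map_def
  proof (intro conjI allI impI assms(1))
    fix U assume U: "openin T U"
    show "openin T {x \<in> M. f x \<in> U}"
      unfolding openin_subopen[of T "{x \<in> M. f x \<in> U}"]
    proof
      fix x assume x: "x \<in> {x \<in> M. f x \<in> U}"
      define F where "F = (\<lambda>n. {y \<in> M - U. code n y = code n (f x)})"
      have "\<exists>n. F n = {}"
      proof (rule ccontr)
        assume ne: "\<nexists>n. F n = {}"
        have "closedin T (F n)" for n
        proof -
          have "F n = (M - U) \<inter> {y \<in> M. code n y = code n (f x)}" by (auto simp: F_def)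
          moreover have "closedin T (M - U)" using U by blast
          ultimately show ?thesis
            using closedin_Int[OF _ locally_constant_clopen(2)[OF locally_constant_code, of "\<lambda>u. u = code n (f x)" n]]
            by simp
        qed
        then obtain y where y: "\<And>n. y \<in> F n"
          using nested_nonempty[of F] ne by (force simp: F_def intro: code_mono)
        have "y = f x"
          by (rule code_separates) (use y x assms(1) in \<open>auto simp: F_def\<close>)
        then show False using y x by (auto simp: F_def)
      qed
      then obtain n where n: "F n = {}" ..
      obtain m where m: "\<forall>x\<in>M. \<forall>y\<in>M. code m x = code m y \<longrightarrow> code n (f x) = code n (f y)"
        using assms(2) by blast
      have "{y \<in> M. code m y = code m x} \<subseteq> {x \<in> M. f x \<in> U}"
        using m n x assms(1) by (fastforce simp: F_def)
      then show "\<exists>W. openin T W \<and> x \<in> W \<and> W \<subseteq> {x \<in> M. f x \<in> U}"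
        using x locally_constant_clopen(1)[OF locally_constant_code, of "\<lambda>u. u = code m x" m]
        by (intro exI[of _ "{y \<in> M. code m y = code m x}"]) auto
    qed
  qed
qed


definition cmaps :: "('a \<Rightarrow> 'a) set" where
  "cmaps = {f \<in> extensional M. continuous_map T T f}"

definition surjs :: "('a \<Rightarrow> 'a) set" where
  "surjs = {f \<in> cmaps. f ` M = M}"

definition close :: "nat \<Rightarrow> ('a \<Rightarrow> 'a) \<Rightarrow> ('a \<Rightarrow> 'a) \<Rightarrow> bool" where
  "close n f g \<longleftrightarrow> (\<forall>x\<in>M. code n (f x) = code n (g x))"

definition homeos :: "('a \<Rightarrow> 'a) set" where
  "homeos = {h. homeomorphic_map T T h}"

text \<open>These sets form a base of neighbourhoods of the identity consisting of subgroups.  Because they are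
groups, the closure of an orbit under them is invariant, which the arguments about generic maps
rely on.\<close>

definition stab :: "nat \<Rightarrow> ('a \<Rightarrow> 'a) set" where
  "stab n = {h \<in> homeos. \<forall>x\<in>M. code n (h x) = code n x}"

definition conjugate :: "('a \<Rightarrow> 'a) \<Rightarrow> ('a \<Rightarrow> 'a) \<Rightarrow> 'a \<Rightarrow> 'a" where
  "conjugate h f = restrict (h \<circ> f \<circ> inv_into M h) M"

lemma close_refl [simp]: "close n f f" by (simp add: close_def)
lemma close_sym: "close n f g \<Longrightarrow> close n g f" by (simp add: close_def)
lemma close_trans: "\<lbrakk>close n f g; close n g h\<rbrakk> \<Longrightarrow> close n f h" by (simp add: close_def)
lemma close_mono: "\<lbrakk>close n f g; m \<le> n\<rbrakk> \<Longrightarrow> close m f g" by (auto simp: close_def intro: code_mono)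
lemma close_0 [simp]: "close 0 f g" by (simp add: close_def)

lemma cmaps_in: "\<lbrakk>f \<in> cmaps; x \<in> M\<rbrakk> \<Longrightarrow> f x \<in> M"
  by (auto simp: cmaps_def dest: continuous_map_funspace)

lemma surjs_cmaps: "f \<in> surjs \<Longrightarrow> f \<in> cmaps" by (simp add: surjs_def)
lemma surjs_in: "\<lbrakk>f \<in> surjs; x \<in> M\<rbrakk> \<Longrightarrow> f x \<in> M" by (simp add: cmaps_in surjs_def)
lemma surjs_cont: "f \<in> surjs \<Longrightarrow> continuous_map T T f" by (simp add: surjs_def cmaps_def)
lemma surjs_image: "f \<in> surjs \<Longrightarrow> f ` M = M" by (simp add: surjs_def)

lemma close_all_imp_eq:
  assumes "f \<in> cmaps" "g \<in> cmaps" "\<And>n. close n f g"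
  shows "f = g"
proof
  fix x show "f x = g x"
  proof (cases "x \<in> M")
    case True
    then show ?thesis using assms by (intro code_separates) (auto simp: close_def cmaps_in)
  next
    case False
    then show ?thesis using assms by (simp add: cmaps_def extensional_def)
  qed
qed

lemma homeos_cont: "h \<in> homeos \<Longrightarrow> continuous_map T T h"
  by (simp add: homeos_def homeomorphic_imp_continuous_map)

lemma homeos_bij: "h \<in> homeos \<Longrightarrow> bij_betw h M M"
  by (auto simp: homeos_def bij_betw_def homeomorphic_eq_everything_map)

lemma homeos_in: "\<lbrakk>h \<in> homeos; x \<in> M\<rbrakk> \<Longrightarrow> h x \<in> M"
  using homeos_bij bij_betwE by blast

lemma homeos_inv [simp]:
  assumes "h \<in> homeos" "x \<in> M"
  shows "inv_into M h (h x) = x" "h (inv_into M h x) = x" "inv_into M h x \<in> M"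
  using homeos_bij[OF assms(1)] assms(2) by (auto simp: bij_betw_def f_inv_into_f inv_into_into)

lemma homeosI: "\<lbrakk>continuous_map T T h; h ` M = M; inj_on h M\<rbrakk> \<Longrightarrow> h \<in> homeos"
  unfolding homeos_def using continuous_imp_homeomorphic_map[OF _ compact_T Hausdorff_T] by blast

lemma homeos_id: "(\<lambda>x. x) \<in> homeos"
  by (rule homeosI) auto

lemma homeos_comp: "\<lbrakk>h \<in> homeos; k \<in> homeos\<rbrakk> \<Longrightarrow> h \<circ> k \<in> homeos"
  unfolding homeos_def using homeomorphic_map_compose by blast

lemma homeos_inv_into: 
  assumes "h \<in> homeos" shows "inv_into M h \<in> homeos"
proof -
  obtain k where k: "homeomorphic_maps T T h k"
    using assms unfolding homeos_def homeomorphic_map_maps by blast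
  then have "inv_into M h x = k x" if "x \<in> M" for x
    using that assms unfolding homeomorphic_maps_def
    by (metis continuous_map_image_subset_topspace homeos_inv(1) image_subset_iff)
  then show ?thesis
    using homeomorphic_map_eq[of T T k "inv_into M h"] k homeomorphic_maps_map homeos_def by fastforce
qed

lemma stab_homeos: "h \<in> stab n \<Longrightarrow> h \<in> homeos" by (simp add: stab_def)
lemma stab_0: "stab 0 = homeos" by (simp add: stab_def)
lemma stab_comp: "\<lbrakk>h \<in> stab n; k \<in> stab n\<rbrakk> \<Longrightarrow> h \<circ> k \<in> stab n"
  by (auto simp: stab_def homeos_comp homeos_in)
lemma stab_inv:
  assumes "h \<in> stab n"
  shows "inv_into M h \<in> stab n"
proof -
  have h: "h \<in> homeos" "\<And>x. x \<in> M \<Longrightarrow> code n (h x) = code n x" using assms by (auto simp: stab_def)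
  then have "code n (inv_into M h x) = code n x" if "x \<in> M" for x
    using that h(2)[of "inv_into M h x"] by simp
  then show ?thesis using h by (simp add: stab_def homeos_inv_into)
qed


lemma conj_apply: "\<lbrakk>h \<in> homeos; x \<in> M\<rbrakk> \<Longrightarrow> conjugate h f (h x) = h (f x)"
  by (simp add: conjugate_def homeos_in)

lemma conj_apply': "\<lbrakk>h \<in> homeos; x \<in> M\<rbrakk> \<Longrightarrow> conjugate h f x = h (f (inv_into M h x))"
  by (simp add: conjugate_def)

lemma conj_eqI:
  assumes "h \<in> homeos" "g \<in> extensional M" "\<And>x. x \<in> M \<Longrightarrow> g (h x) = h (f x)"
  shows "conjugate h f = g"
proof
  fix y show "conjugate h f y = g y"
  proof (cases "y \<in> M")
    case True
    then show ?thesis using assms(1) assms(3)[of "inv_into M h y"] by (simp add: conj_apply')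
  qed (use assms(2) in \<open>simp add: conjugate_def extensional_def\<close>)
qed

lemma conj_cmaps:
  assumes "h \<in> homeos" "f \<in> cmaps"
  shows "conjugate h f \<in> cmaps"
proof -
  have "continuous_map T T (h \<circ> f \<circ> inv_into M h)"
    using assms homeos_inv_into homeos_cont by (metis (lifting) cmaps_def continuous_map_compose mem_Collect_eq)
  then have "continuous_map T T (conjugate h f)"
    by (rule continuous_map_eq) (simp add: conjugate_def)
  then show ?thesis by (simp add: cmaps_def conjugate_def)
qed

lemma conj_surjs:
  assumes "h \<in> homeos" "f \<in> surjs"
  shows "conjugate h f \<in> surjs"
proof -
  have "conjugate h f ` M = h ` f ` inv_into M h ` M"
    using assms by (auto simp: conj_apply' image_iff)
  also have "\<dots> = M"
    using homeos_bij[OF assms(1)] homeos_bij[OF homeos_inv_into[OF assms(1)]] surjs_image[OF assms(2)]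
    by (simp add: bij_betw_def)
  finally show ?thesis using conj_cmaps[OF assms(1)] assms(2) by (simp add: surjs_def)
qed

lemma conj_comp:
  assumes "h \<in> homeos" "k \<in> homeos" "f \<in> cmaps"
  shows "conjugate (h \<circ> k) f = conjugate h (conjugate k f)"
  by (rule conj_eqI)
     (use assms in \<open>auto simp: homeos_comp conj_apply homeos_in cmaps_in conjugate_def[of h]\<close>)

lemma conj_id: "f \<in> cmaps \<Longrightarrow> conjugate (\<lambda>x. x) f = f"
  by (rule conj_eqI) (auto simp: homeos_id cmaps_def)

lemma conj_inv:
  assumes "h \<in> homeos" "f \<in> cmaps"
  shows "conjugate (inv_into M h) (conjugate h f) = f"
  by (rule conj_eqI) (use assms in \<open>auto simp: homeos_inv_into conj_apply' cmaps_in cmaps_def homeos_in\<close>)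

text \<open>Conjugation by a fixed \<open>h\<close> first permutes the arguments, which does not affect uniform closeness, and
then applies the uniformly continuous map \<open>h\<close>.\<close>

lemma conj_uniform:
  assumes "h \<in> homeos"
  obtains m where "m \<ge> n" "\<And>f g. \<lbrakk>f \<in> cmaps; g \<in> cmaps; close m f g\<rbrakk> \<Longrightarrow> close n (conjugate h f) (conjugate h g)"
proof -
  obtain m where m: "m \<ge> n" "\<And>x y. \<lbrakk>x \<in> M; y \<in> M; code m x = code m y\<rbrakk> \<Longrightarrow> code n (h x) = code n (h y)"
    using uniformly_continuous_code[OF homeos_cont[OF assms]] by blast
  show thesis
  proof (rule that[OF m(1)])
    fix f g assume "f \<in> cmaps" "g \<in> cmaps" "close m f g"
    then show "close n (conjugate h f) (conjugate h g)"
      using assms m(2) by (simp add: close_def conj_apply' cmaps_in)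
  qed
qed

text \<open>Up to \<open>n\<close>-closeness a map is determined by a modulus \<open>m\<close> of continuity together with the finite
relation between the \<open>m\<close>-codes of points and the \<open>n\<close>-codes of their images; there are only countably
many such data.\<close>

lemma countable_dense:
  assumes "K \<subseteq> cmaps"
  obtains F where "countable F" "F \<subseteq> K" "\<And>f n. f \<in> K \<Longrightarrow> \<exists>g\<in>F. close n f g"
proof -
  have "\<exists>m. \<forall>x\<in>M. \<forall>y\<in>M. code m x = code m y \<longrightarrow> code n (f x) = code n (f y)" if "f \<in> K" for f n
  proof -
    have "continuous_map T T f" using that assms by (auto simp: cmaps_def)
    then show ?thesis by (rule uniformly_continuous_code[of f n]) blast
  qed
  then obtain \<mu> where \<mu>: "\<And>f n x y. \<lbrakk>f \<in> K; x \<in> M; y \<in> M; code (\<mu> f n) x = code (\<mu> f n) y\<rbrakk>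
       \<Longrightarrow> code n (f x) = code n (f y)" by metis
  define key where "key = (\<lambda>n f. (\<mu> f n, (\<lambda>x. (code (\<mu> f n) x, code n (f x))) ` M))"
  have key: "close n f g" if fg: "f \<in> K" "g \<in> K" "key n f = key n g" for n f g
    unfolding close_def
  proof
    fix x assume x: "x \<in> M"
    then have "(code (\<mu> f n) x, code n (f x)) \<in> (\<lambda>x. (code (\<mu> f n) x, code n (f x))) ` M" by blast
    also have "\<dots> = (\<lambda>x. (code (\<mu> g n) x, code n (g x))) ` M"
      using fg(3) unfolding key_def prod.inject by (rule conjunct2)
    finally have "(code (\<mu> f n) x, code n (f x)) \<in> (\<lambda>x. (code (\<mu> g n) x, code n (g x))) ` M" .
    then obtain y where "y \<in> M" "code (\<mu> f n) x = code (\<mu> g n) y" "code n (f x) = code n (g y)" by auto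
    then show "code n (f x) = code n (g x)"
      using \<mu>[OF fg(2) x] fg(3) by (simp add: key_def)
  qed
  have "finite ((\<lambda>x. (code (\<mu> f n) x, code n (f x))) ` M)" if "f \<in> K" for f n
  proof -
    have "finite (code k ` M)" for k
      by (rule locally_constant_finite_image[OF compact_T locally_constant_code])
    moreover have "code n ` f ` M \<subseteq> code n ` M" using that assms cmaps_in by auto
    ultimately have "finite (code (\<mu> f n) ` M \<times> code n ` f ` M)"
      using finite_subset by blast
    then show ?thesis by (rule rev_finite_subset) auto
  qed
  then have "key n ` K \<subseteq> UNIV \<times> Collect finite" for n by (auto simp: key_def)
  then have ck: "countable (key n ` K)" for n
    by (rule countable_subset) (intro countable_SIGMA countable_Collect_finite, simp)
  define F where "F = (\<Union>n. (\<lambda>k. SOME f. f \<in> K \<and> key n f = k) ` (key n ` K))"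
  have some: "(SOME g. g \<in> K \<and> key n g = key n f) \<in> K \<and> key n (SOME g. g \<in> K \<and> key n g = key n f) = key n f"
    if "f \<in> K" for f n
    by (rule someI[of "\<lambda>g. g \<in> K \<and> key n g = key n f" f]) (use that in simp)
  show thesis
  proof
    show "countable F" unfolding F_def by (rule countable_UN, simp, rule countable_image, rule ck)
    show "F \<subseteq> K" using some by (auto simp: F_def)
    show "\<exists>g\<in>F. close n f g" if "f \<in> K" for f n
    proof
      show "close n f (SOME g. g \<in> K \<and> key n g = key n f)"
        by (rule key) (use some[OF that, of n] that in simp_all)
      show "(SOME g. g \<in> K \<and> key n g = key n f) \<in> F"
        unfolding F_def using that by blast
    qed
  qed
qed

end

section \<open>Products of systems and a dense conjugacy class\<close>

context coded_cantor
begin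

text \<open>The map \<open>G \<times> id\<close> of \<open>Z \<times> X\<close>, carried to \<open>X\<close> by the homeomorphism \<open>h\<close>.\<close>

definition transport :: "'z topology \<Rightarrow> ('z \<times> 'a \<Rightarrow> 'a) \<Rightarrow> ('z \<Rightarrow> 'z) \<Rightarrow> 'a \<Rightarrow> 'a" where
  "transport Z h G = restrict (h \<circ> (\<lambda>(z, t). (G z, t)) \<circ> inv_into (topspace Z \<times> M) h) M"

context
  fixes Z :: "'z topology" and h :: "'z \<times> 'a \<Rightarrow> 'a"
  assumes h: "homeomorphic_map (prod_topology Z T) T h"
begin

lemma transport_bij: "bij_betw h (topspace Z \<times> M) M"
  using h by (auto simp: bij_betw_def homeomorphic_eq_everything_map)

lemma transport_in: "\<lbrakk>z \<in> topspace Z; t \<in> M\<rbrakk> \<Longrightarrow> h (z, t) \<in> M"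
  using transport_bij bij_betwE by blast

lemma transport_cases:
  assumes "x \<in> M"
  obtains z t where "z \<in> topspace Z" "t \<in> M" "x = h (z, t)"
proof -
  have "x \<in> h ` (topspace Z \<times> M)" using transport_bij assms by (simp add: bij_betw_def)
  then show thesis using that by blast
qed

lemma transport_inv: "\<lbrakk>z \<in> topspace Z; t \<in> M\<rbrakk> \<Longrightarrow> inv_into (topspace Z \<times> M) h (h (z, t)) = (z, t)"
  using transport_bij by (auto simp: bij_betw_def)

lemma transport_apply:
  "\<lbrakk>z \<in> topspace Z; t \<in> M\<rbrakk> \<Longrightarrow> transport Z h G (h (z, t)) = h (G z, t)"
  by (simp add: transport_def transport_inv transport_in)

lemma inverse_homeomorphic_map:
  "homeomorphic_map T (prod_topology Z T) (inv_into (topspace Z \<times> M) h)"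
proof -
  obtain k where k: "homeomorphic_maps (prod_topology Z T) T h k"
    using h unfolding homeomorphic_map_maps by blast
  have "k x = inv_into (topspace Z \<times> M) h x" if x: "x \<in> M" for x
  proof -
    obtain z t where "z \<in> topspace Z" "t \<in> M" "x = h (z, t)" using x by (rule transport_cases)
    then show ?thesis using k transport_inv by (simp add: homeomorphic_maps_def)
  qed
  moreover have "homeomorphic_map T (prod_topology Z T) k"
    using k homeomorphic_maps_map by blast
  ultimately show ?thesis using homeomorphic_map_eq by metis
qed

lemma transport_surjs:
  assumes G: "continuous_map Z Z G" "G ` topspace Z = topspace Z"
  shows "transport Z h G \<in> surjs"
proof -
  let ?i = "inv_into (topspace Z \<times> M) h" and ?G = "\<lambda>(z, t). (G z, t)"
  have "continuous_map (prod_topology Z T) (prod_topology Z T) ?G"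
    using continuous_map_prod_top[of Z T Z T G "\<lambda>t. t"] G by auto
  then have "continuous_map T T (h \<circ> (?G \<circ> ?i))"
    using homeomorphic_imp_continuous_map[OF inverse_homeomorphic_map] homeomorphic_imp_continuous_map[OF h]
    by (metis continuous_map_compose)
  then have "continuous_map T T (transport Z h G)"
    by (rule continuous_map_eq) (simp add: transport_def)
  moreover have "transport Z h G ` M = M"
  proof
    show "transport Z h G ` M \<subseteq> M"
      using continuous_map_image_subset_topspace calculation by blast
    show "M \<subseteq> transport Z h G ` M"
    proof
      fix x assume "x \<in> M"
      then obtain z t where zt: "z \<in> topspace Z" "t \<in> M" "x = h (z, t)" by (rule transport_cases)
      then obtain z' where "z' \<in> topspace Z" "z = G z'" using G(2) by blast
      then have "x = transport Z h G (h (z', t))" "h (z', t) \<in> M"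
        using zt by (simp_all add: transport_apply transport_in)
      then show "x \<in> transport Z h G ` M" by blast
    qed
  qed
  ultimately show ?thesis by (simp add: surjs_def cmaps_def transport_def)
qed

lemma transport_funpow:
  assumes "G ` topspace Z \<subseteq> topspace Z" "z \<in> topspace Z" "t \<in> M"
  shows "(transport Z h G ^^ n) (h (z, t)) = h ((G ^^ n) z, t) \<and> (G ^^ n) z \<in> topspace Z"
  by (induction n) (use assms in \<open>auto simp: transport_apply\<close>)

text \<open>The copy moves a point from the cell of \<open>\<pi> z\<close> to the cell of \<open>\<pi> (G z)\<close>.  As soon as some single
point \<open>x\<close> makes the same move under \<open>f\<close>, uniform continuity of \<open>f\<close> on the common starting cell
compares the copy with \<open>f\<close> everywhere in that cell.  So \<open>\<pi>\<close> has to respect the dynamics only at the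
level of cells.\<close>

lemma transport_close:
  assumes f: "f \<in> surjs" and \<pi>: "\<And>z. z \<in> topspace Z \<Longrightarrow> \<pi> z \<in> M"
    and G: "\<And>z. z \<in> topspace Z \<Longrightarrow> G z \<in> topspace Z"
    and edge: "\<And>z. z \<in> topspace Z \<Longrightarrow> \<exists>x\<in>M. code m x = code m (\<pi> z) \<and> code m (f x) = code m (\<pi> (G z))"
    and m: "m \<ge> n" "\<And>x y. \<lbrakk>x \<in> M; y \<in> M; code m x = code m y\<rbrakk> \<Longrightarrow> code n (f x) = code n (f y)"
    and lab: "\<And>z t. \<lbrakk>z \<in> topspace Z; t \<in> M\<rbrakk> \<Longrightarrow> code m (h (z, t)) = code m (\<pi> z)"
  shows "close n (transport Z h G) f"
  unfolding close_def
proof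
  fix x assume "x \<in> M"
  then obtain z t where zt: "z \<in> topspace Z" "t \<in> M" "x = h (z, t)" by (rule transport_cases)
  obtain y where y: "y \<in> M" "code m y = code m (\<pi> z)" "code m (f y) = code m (\<pi> (G z))"
    using edge zt by blast
  have "code m (transport Z h G x) = code m (f y)"
    using zt lab[of "G z" t] G y by (simp add: transport_apply)
  then have "code n (transport Z h G x) = code n (f y)" using m(1) by (rule code_mono)
  moreover have "code n (f y) = code n (f x)"
    by (rule m(2)) (use y zt lab[of z t] \<open>x \<in> M\<close> in auto)
  ultimately show "code n (transport Z h G x) = code n (f x)" by simp
qed

end

lemma transport_conj:
  assumes h: "homeomorphic_map (prod_topology Z T) T h" and k: "homeomorphic_map (prod_topology Z T) T k"
    and G: "continuous_map Z Z G"
  shows "k \<circ> inv_into (topspace Z \<times> M) h \<in> homeos"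
    "conjugate (k \<circ> inv_into (topspace Z \<times> M) h) (transport Z h G) = transport Z k G"
    "\<lbrakk>z \<in> topspace Z; t \<in> M\<rbrakk> \<Longrightarrow> (k \<circ> inv_into (topspace Z \<times> M) h) (h (z, t)) = k (z, t)"
proof -
  let ?v = "k \<circ> inv_into (topspace Z \<times> M) h"
  show v: "?v \<in> homeos"
    using homeomorphic_map_compose[OF inverse_homeomorphic_map[OF h] k] by (simp add: homeos_def)
  show e: "?v (h (z, t)) = k (z, t)" if "z \<in> topspace Z" "t \<in> M" for z t
    using that by (simp add: transport_inv[OF h])
  show "conjugate ?v (transport Z h G) = transport Z k G"
  proof (rule conj_eqI[OF v])
    fix x assume "x \<in> M"
    then obtain z t where zt: "z \<in> topspace Z" "t \<in> M" "x = h (z, t)" by (rule transport_cases[OF h])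
    moreover have "G z \<in> topspace Z" using G zt continuous_map_funspace by blast
    ultimately show "transport Z k G (?v x) = ?v (transport Z h G x)"
      using e transport_apply[OF h] transport_apply[OF k] by simp
  qed (simp add: transport_def)
qed

lemma labelled_transport:
  assumes "zero_dim_compact Z" "continuous_map Z T \<pi>" "\<pi> ` topspace Z = M"
  obtains h where "homeomorphic_map (prod_topology Z T) T h"
    "\<And>z t. \<lbrakk>z \<in> topspace Z; t \<in> M\<rbrakk> \<Longrightarrow> code m (h (z, t)) = code m (\<pi> z)"
proof -
  have "locally_constant Z (\<lambda>z. code m (\<pi> z))"
    using continuous_map_compose[OF assms(2) locally_constant_code] by (simp add: o_def)
  then show thesis
    by (rule labelled_product_homeomorphism[OF assms(1) cantor _ locally_constant_code[of m]])
       (use assms(3) that in \<open>auto simp flip: image_image\<close>)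
qed

lemma factor_transport_close:
  assumes Z: "zero_dim_compact Z" and G: "continuous_map Z Z G" 
    and \<pi>: "continuous_map Z T \<pi>" "\<pi> ` topspace Z = M" 
    and f: "f \<in> surjs" and eq: "\<And>z. z \<in> topspace Z \<Longrightarrow> \<pi> (G z) = f (\<pi> z)"
  obtains h where "homeomorphic_map (prod_topology Z T) T h" "close n (transport Z h G) f"
    "\<And>z t. \<lbrakk>z \<in> topspace Z; t \<in> M\<rbrakk> \<Longrightarrow> code n (h (z, t)) = code n (\<pi> z)"
proof -
  obtain m where m: "m \<ge> n" "\<And>x y. \<lbrakk>x \<in> M; y \<in> M; code m x = code m y\<rbrakk> \<Longrightarrow> code n (f x) = code n (f y)"
    using uniformly_continuous_code[OF surjs_cont[OF f]] by blast
  obtain h where h: "homeomorphic_map (prod_topology Z T) T h"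
    and lab: "\<And>z t. \<lbrakk>z \<in> topspace Z; t \<in> M\<rbrakk> \<Longrightarrow> code m (h (z, t)) = code m (\<pi> z)"
    using labelled_transport[OF Z \<pi>] by blast
  have in_M: "\<And>z. z \<in> topspace Z \<Longrightarrow> \<pi> z \<in> M" "\<And>z. z \<in> topspace Z \<Longrightarrow> G z \<in> topspace Z"
    using \<pi>(2) continuous_map_funspace[OF G] by auto
  have edge: "\<exists>x\<in>M. code m x = code m (\<pi> z) \<and> code m (f x) = code m (\<pi> (G z))" if "z \<in> topspace Z" for z
    using eq[OF that] in_M(1)[OF that] by metis
  have "close n (transport Z h G) f"
    by (rule transport_close[where \<pi> = \<pi>, OF h f in_M edge m lab])
  moreover have "code n (h (z, t)) = code n (\<pi> z)" if "z \<in> topspace Z" "t \<in> M" for z t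
    using code_mono[OF lab[OF that] m(1)] .
  ultimately show thesis using that h by blast
qed

definition per :: "('a \<Rightarrow> 'a) \<Rightarrow> nat set" where
  "per f = {n. \<exists>x\<in>M. (f ^^ n) x = x}"

text \<open>The product of all members of \<open>F\<close> acts on the countable power of \<open>X\<close> and has every member as a factor
through a coordinate projection.\<close>

lemma universal_product:
  assumes F: "countable F" "F \<noteq> {}" "F \<subseteq> surjs" and Q: "\<And>f. f \<in> F \<Longrightarrow> Q \<subseteq> per f"
  obtains g where "g \<in> surjs" "Q \<subseteq> per g" "\<And>f n. f \<in> F \<Longrightarrow> \<exists>h\<in>homeos. close n (conjugate h g) f"
proof -
  obtain fs :: "nat \<Rightarrow> 'a \<Rightarrow> 'a" where fs: "range fs = F"
    using F by (metis range_from_nat_into)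
  then have fsS: "fs i \<in> surjs" for i using F(3) by blast
  let ?Z = "product_topology (\<lambda>_::nat. T) UNIV"
  define G where "G = (\<lambda>z i. fs i (z i))"
  have Z: "zero_dim_compact ?Z" using zero_dim_compact_T by (rule zero_dim_compact_product)
  have topZ: "z \<in> topspace ?Z \<longleftrightarrow> (\<forall>i. z i \<in> M)" for z by (auto simp: PiE_iff)
  have Gc: "continuous_map ?Z ?Z G"
    unfolding continuous_map_componentwise_UNIV
  proof
    fix i
    have "continuous_map ?Z T (fs i \<circ> (\<lambda>z. z i))"
      by (intro continuous_map_compose[of _ T] surjs_cont fsS continuous_map_product_projection) simp
    then show "continuous_map ?Z T (\<lambda>z. G z i)" by (simp add: G_def o_def)
  qed
  have Gs: "G ` topspace ?Z = topspace ?Z"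
  proof
    show "G ` topspace ?Z \<subseteq> topspace ?Z" using continuous_map_image_subset_topspace[OF Gc] .
    show "topspace ?Z \<subseteq> G ` topspace ?Z"
    proof
      fix z assume "z \<in> topspace ?Z"
      then have "\<forall>i. \<exists>y\<in>M. z i = fs i y" using surjs_image[OF fsS] topZ by (metis imageE)
      then obtain y where y: "\<And>i. y i \<in> M" "\<And>i. z i = fs i (y i)" by metis
      then have "z = G y" by (auto simp: G_def)
      then show "z \<in> G ` topspace ?Z" using y topZ by blast
    qed
  qed
  have close_h: "\<exists>h. homeomorphic_map (prod_topology ?Z T) T h \<and> close n (transport ?Z h G) (fs i)" for n i
  proof -
    have "(\<lambda>z. z i) ` topspace ?Z = M"
    proof
      show "M \<subseteq> (\<lambda>z. z i) ` topspace ?Z"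
      proof
        fix x assume "x \<in> M"
        then show "x \<in> (\<lambda>z. z i) ` topspace ?Z"
          by (intro image_eqI[of _ _ "\<lambda>_. x"]) (auto simp: topZ)
      qed
    qed (use topZ in auto)
    then show ?thesis
      by (rule factor_transport_close[OF Z Gc continuous_map_product_projection[OF UNIV_I] _ fsS])
         (auto simp: G_def)
  qed
  then obtain h0 where h0: "homeomorphic_map (prod_topology ?Z T) T h0" by blast
  define g where "g = transport ?Z h0 G"
  show thesis
  proof
    show "g \<in> surjs" unfolding g_def by (rule transport_surjs[OF h0 Gc Gs])
    show "Q \<subseteq> per g"
    proof
      fix q assume "q \<in> Q"
      then have "\<forall>i. \<exists>x\<in>M. (fs i ^^ q) x = x" using Q fs by (auto simp: per_def)
      then obtain z where z: "\<And>i. z i \<in> M" "\<And>i. (fs i ^^ q) (z i) = z i" by metis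
      have "(G ^^ n) z i = (fs i ^^ n) (z i)" for n i
        by (induction n) (auto simp: G_def)
      then have Gz: "(G ^^ q) z = z" using z by auto
      obtain t where t: "t \<in> M" using M_nonempty by blast
      have "z \<in> topspace ?Z" using z topZ by blast
      then show "q \<in> per g"
        using transport_funpow[OF h0 _ _ t, of G z q] Gs Gz transport_in[OF h0 _ t]
        unfolding per_def g_def by auto
    qed
    show "\<exists>h\<in>homeos. close n (conjugate h g) f" if "f \<in> F" for f n
    proof -
      obtain i where i: "f = fs i" using \<open>f \<in> F\<close> fs by blast
      obtain h where h: "homeomorphic_map (prod_topology ?Z T) T h" "close n (transport ?Z h G) (fs i)"
        using close_h by blast
      then show ?thesis
        using transport_conj(1,2)[OF h0 h(1) Gc] i unfolding g_def by metis
    qed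
  qed
qed

definition surjs_per :: "nat set \<Rightarrow> ('a \<Rightarrow> 'a) set" where
  "surjs_per Q = {f \<in> surjs. Q \<subseteq> per f}"

lemma surjs_per_nonempty: "surjs_per Q \<noteq> {}"
proof -
  have "restrict (\<lambda>x. x) M \<in> surjs"
  proof -
    have "continuous_map T T (restrict (\<lambda>x. x) M)"
      by (rule continuous_map_eq[of _ _ "\<lambda>x. x"]) auto
    then show ?thesis by (simp add: surjs_def cmaps_def)
  qed
  moreover have "q \<in> per (restrict (\<lambda>x. x) M)" for q
  proof -
    obtain t where t: "t \<in> M" using M_nonempty by blast
    then have "(restrict (\<lambda>x. x) M ^^ q) t = t" by (induction q) auto
    then show ?thesis using t by (auto simp: per_def)
  qed
  ultimately show ?thesis unfolding surjs_per_def by blast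
qed

lemma surjs_per_dense_class:
  obtains g where "g \<in> surjs_per Q" "\<And>f n. f \<in> surjs_per Q \<Longrightarrow> \<exists>h\<in>homeos. close n (conjugate h g) f"
proof -
  obtain F where F: "countable F" "F \<subseteq> surjs_per Q" "\<And>f n. f \<in> surjs_per Q \<Longrightarrow> \<exists>g\<in>F. close n f g"
    using countable_dense[of "surjs_per Q"] surjs_cmaps unfolding surjs_per_def
    by (metis (mono_tags, lifting) mem_Collect_eq subsetI)
  have "F \<noteq> {}" using F(3) surjs_per_nonempty by blast
  then obtain g where g: "g \<in> surjs" "Q \<subseteq> per g" "\<And>f n. f \<in> F \<Longrightarrow> \<exists>h\<in>homeos. close n (conjugate h g) f"
    using universal_product[OF F(1), of Q] F(2) unfolding surjs_per_def by blast
  show thesis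
  proof
    show "g \<in> surjs_per Q" using g by (simp add: surjs_per_def)
    fix f n assume "f \<in> surjs_per Q"
    then obtain f' where f': "f' \<in> F" "close n f f'" using F(3) by blast
    then obtain h where "h \<in> homeos" "close n (conjugate h g) f'" using g(3) by blast
    then show "\<exists>h\<in>homeos. close n (conjugate h g) f" using f' close_trans close_sym by metis
  qed
qed

lemma conj_funpow:
  assumes "h \<in> homeos" "f \<in> cmaps" "x \<in> M"
  shows "(conjugate h f ^^ n) (h x) = h ((f ^^ n) x) \<and> (f ^^ n) x \<in> M"
  by (induction n) (use assms in \<open>auto simp: conj_apply cmaps_in\<close>)

lemma per_conj:
  assumes "h \<in> homeos" "f \<in> cmaps"
  shows "per f \<subseteq> per (conjugate h f)"
proof
  fix n assume "n \<in> per f"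
  then obtain x where "x \<in> M" "(f ^^ n) x = x" by (auto simp: per_def)
  then have "h x \<in> M" "(conjugate h f ^^ n) (h x) = h x"
    using conj_funpow[OF assms] homeos_in[OF assms(1)] by auto
  then show "n \<in> per (conjugate h f)" by (auto simp: per_def)
qed

lemma conj_surjs_per: "\<lbrakk>h \<in> homeos; f \<in> surjs_per Q\<rbrakk> \<Longrightarrow> conjugate h f \<in> surjs_per Q"
  using per_conj[of h f] conj_surjs[of h f] surjs_cmaps[of f] unfolding surjs_per_def by blast

lemma funpow_in: "\<lbrakk>f \<in> cmaps; x \<in> M\<rbrakk> \<Longrightarrow> (f ^^ n) x \<in> M"
  by (induction n) (auto simp: cmaps_in)

lemma funpow_cont: "f \<in> cmaps \<Longrightarrow> continuous_map T T (f ^^ n)"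
proof (induction n)
  case 0
  then show ?case by (simp add: id_def)
next
  case (Suc n)
  then show ?case using continuous_map_compose[of T T "f ^^ n" T f] by (simp add: cmaps_def o_def)
qed

lemma funpow_close:
  assumes f: "f \<in> cmaps"
  shows "\<exists>m. \<forall>g\<in>cmaps. close m f g \<longrightarrow> (\<forall>x\<in>M. code n ((f ^^ q) x) = code n ((g ^^ q) x))"
proof (induction q arbitrary: n)
  case (Suc q)
  obtain l where l: "l \<ge> n" "\<And>x y. \<lbrakk>x \<in> M; y \<in> M; code l x = code l y\<rbrakk> \<Longrightarrow> code n (f x) = code n (f y)"
    using uniformly_continuous_code f unfolding cmaps_def by blast
  obtain m where m: "\<And>g x. \<lbrakk>g \<in> cmaps; close m f g; x \<in> M\<rbrakk> \<Longrightarrow> code l ((f ^^ q) x) = code l ((g ^^ q) x)"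
    using Suc by blast
  show ?case
  proof (intro exI[of _ "max m n"] ballI impI)
    fix g x assume g: "g \<in> cmaps" "close (max m n) f g" "x \<in> M"
    then have "close m f g" "close n f g" using close_mono by auto
    then have "code n (f ((f ^^ q) x)) = code n (f ((g ^^ q) x))"
      by (intro l(2) m funpow_in f g)
    then show "code n ((f ^^ Suc q) x) = code n ((g ^^ Suc q) x)"
      using \<open>close n f g\<close> funpow_in[OF g(1,3)] by (simp add: close_def)
  qed
qed simp

text \<open>Periodic points of maps converging to \<open>f\<close> accumulate, by compactness, at periodic points of \<open>f\<close>
with the same period.\<close>

lemma surjs_per_closed:
  assumes f: "f \<in> surjs" and lim: "\<And>n. \<exists>g\<in>surjs_per Q. close n f g"
  shows "f \<in> surjs_per Q"
proof -
  have "\<exists>x\<in>M. (f ^^ q) x = x" if q: "q \<in> Q" for q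
  proof -
    define F where "F = (\<lambda>n. {x \<in> M. code n ((f ^^ q) x) = code n x})"
    have "closedin T (F n)" for n
    proof -
      have "locally_constant T (\<lambda>x. (code n ((f ^^ q) x), code n x))"
        using continuous_map_compose[OF funpow_cont[OF surjs_cmaps[OF f], of q] locally_constant_code]
        by (intro locally_constant_Pair locally_constant_code) (simp add: o_def)
      then show ?thesis
        using locally_constant_clopen(2)[of T _ "\<lambda>(u, v). u = v"] by (fastforce simp: F_def)
    qed
    moreover have "F n \<noteq> {}" for n
    proof -
      obtain m where m: "\<forall>g\<in>cmaps. close m f g \<longrightarrow> (\<forall>x\<in>M. code n ((f ^^ q) x) = code n ((g ^^ q) x))"
        using funpow_close[OF surjs_cmaps[OF f]] by blast
      obtain g where g: "g \<in> surjs" "q \<in> per g" "close m f g"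
        using lim q unfolding surjs_per_def by blast
      then obtain x where "x \<in> M" "(g ^^ q) x = x" by (auto simp: per_def)
      then have "x \<in> F n" using m g surjs_cmaps unfolding F_def by force
      then show ?thesis by blast
    qed
    moreover have "F (Suc n) \<subseteq> F n" for n by (auto simp: F_def intro: code_mono)
    ultimately obtain x where x: "\<And>n. x \<in> F n" by (rule nested_nonempty) blast+
    then have "x \<in> M" "\<And>n. code n ((f ^^ q) x) = code n x" by (auto simp: F_def)
    then show ?thesis using code_separates funpow_in[OF surjs_cmaps[OF f]] by blast
  qed
  then show ?thesis using f by (auto simp: surjs_per_def per_def)
qed

end

section \<open>Spiral graphs and their walks\<close>

lemma walk_through:
  assumes "\<And>v. v \<in> V \<Longrightarrow> \<exists>u\<in>V. (v, u) \<in> E" "\<And>v. v \<in> V \<Longrightarrow> \<exists>u\<in>V. (u, v) \<in> E" "v \<in> V"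
  obtains w :: "int \<Rightarrow> 'v" where "w 0 = v" "\<And>n. w n \<in> V" "\<And>n. (w n, w (n + 1)) \<in> E"
proof -
  obtain nxt prv where nxt: "\<And>v. v \<in> V \<Longrightarrow> nxt v \<in> V \<and> (v, nxt v) \<in> E"
    and prv: "\<And>v. v \<in> V \<Longrightarrow> prv v \<in> V \<and> (prv v, v) \<in> E"
    using assms by metis
  have inV: "(nxt ^^ n) v \<in> V" "(prv ^^ n) v \<in> V" for n
    by (induction n) (use nxt prv assms(3) in auto)
  define w where "w = (\<lambda>n::int. if n \<ge> 0 then (nxt ^^ nat n) v else (prv ^^ nat (- n)) v)"
  have "(w n, w (n + 1)) \<in> E" for n
  proof (cases "n \<ge> 0")
    case True
    then have "nat (n + 1) = Suc (nat n)" by simp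
    then show ?thesis using True nxt inV by (simp add: w_def)
  next
    case False
    then have "nat (- n) = Suc (nat (- (n + 1)))" by simp
    moreover have "w (n + 1) = (prv ^^ nat (- (n + 1))) v"
      using False by (cases "n + 1 = 0") (auto simp: w_def)
    ultimately show ?thesis using False prv inV by (simp add: w_def)
  qed
  moreover have "w n \<in> V" for n using inV by (simp add: w_def)
  moreover have "w 0 = v" by (simp add: w_def)
  ultimately show thesis using that by blast
qed

text \<open>The spiral \<open>(z, r, s, m)\<close> has the vertices \<open>0, \<dots>, m\<close>, the path edges between successive ones, and two
edges back, \<open>r \<rightarrow> 0\<close> and \<open>m \<rightarrow> s\<close>.  It consists of the cycle \<open>0, \<dots>, r\<close>, the path from \<open>r\<close> to \<open>s\<close>, and
the cycle \<open>s, \<dots>, m\<close>.  The point \<open>z\<close> is the starting point of the orbit segment that the spiral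
is meant to follow; it plays the role of a name.\<close>

type_synonym 'a spiral = "'a \<times> nat \<times> nat \<times> nat"

definition spiral_edge :: "'a spiral \<Rightarrow> nat \<Rightarrow> nat \<Rightarrow> bool" where
  "spiral_edge = (\<lambda>(z, r, s, m) i j. i \<le> m \<and> (j = Suc i \<and> j \<le> m \<or> i = r \<and> j = 0 \<or> i = m \<and> j = s))"

text \<open>The gap between \<open>r\<close> and \<open>s\<close> leaves a vertex outside both cycles, so that the vertex \<open>r + 1\<close> can be
entered from \<open>r\<close> only.\<close>

definition proper_spiral :: "'a spiral \<Rightarrow> bool" where
  "proper_spiral = (\<lambda>(z, r, s, m). r + 1 < s \<and> s \<le> m)"

definition exit_vertex :: "'a spiral \<Rightarrow> nat" where
  "exit_vertex = (\<lambda>(z, r, s, m). r)"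

definition spiral_verts :: "'a spiral set \<Rightarrow> ('a spiral \<times> nat) set" where
  "spiral_verts \<C> = {((z, r, s, m), i). (z, r, s, m) \<in> \<C> \<and> i \<le> m}"

definition spiral_edges :: "'a spiral set \<Rightarrow> (('a spiral \<times> nat) \<times> ('a spiral \<times> nat)) set" where
  "spiral_edges \<C> = {((k, i), (k', j)). k \<in> \<C> \<and> k' = k \<and> spiral_edge k i j}"

lemma finite_spiral_verts: "finite \<C> \<Longrightarrow> finite (spiral_verts \<C>)"
proof -
  assume "finite \<C>"
  then have "finite (Sigma \<C> (\<lambda>(z, r, s, m). {..m}))" by (rule finite_SigmaI) auto
  then show ?thesis by (rule rev_finite_subset) (auto simp: spiral_verts_def)
qed

text \<open>Branching forward happens only at the exit vertex \<open>r\<close>, and branching backward only at \<open>s\<close>.  So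
walks are determined forward beyond the exit, and backward up to the vertex after the exit.\<close>

lemma spiral_succ_unique:
  assumes "proper_spiral (fst p)" "(p, q) \<in> spiral_edges \<C>" "(p, q') \<in> spiral_edges \<C>" "exit_vertex (fst p) < snd p"
  shows "q' = q" "fst q = fst p" "exit_vertex (fst q) < snd q"
  using assms by (auto simp: spiral_edges_def spiral_edge_def proper_spiral_def exit_vertex_def split: prod.splits)

lemma spiral_pred_unique:
  assumes "proper_spiral (fst p)" "(q, p) \<in> spiral_edges \<C>" "(q', p) \<in> spiral_edges \<C>" "snd p \<le> Suc (exit_vertex (fst p))"
  shows "q' = q" "fst q = fst p" "snd q \<le> Suc (exit_vertex (fst q))"
  using assms by (auto simp: spiral_edges_def spiral_edge_def proper_spiral_def exit_vertex_def split: prod.splits)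

lemma spiral_crossing:
  assumes "proper_spiral (fst p)" "(p, q) \<in> spiral_edges \<C>" "snd p \<le> exit_vertex (fst p)" "exit_vertex (fst q) < snd q"
  shows "snd q = Suc (exit_vertex (fst q))"
  using assms by (auto simp: spiral_edges_def spiral_edge_def proper_spiral_def exit_vertex_def split: prod.splits)

text \<open>A finite walk either stays in the first cycle, or starts beyond it, or crosses the edge after the
exit.  In these cases the last time, the first time and the time of crossing serve as \<open>t\<close>.\<close>

lemma spiral_walk_pivot:
  assumes pr: "\<And>k. k \<in> \<C> \<Longrightarrow> proper_spiral k"
    and w: "\<And>i. i < L \<Longrightarrow> (w i, w (Suc i)) \<in> spiral_edges \<C>"
  obtains t where "t \<le> L" "t = 0 \<or> snd (w t) \<le> Suc (exit_vertex (fst (w t)))" "t = L \<or> exit_vertex (fst (w t)) < snd (w t)"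
proof (cases "snd (w L) \<le> exit_vertex (fst (w L))")
  case True
  then show thesis using that[of L] by simp
next
  case False
  define t where "t = (LEAST t. exit_vertex (fst (w t)) < snd (w t))"
  have t: "exit_vertex (fst (w t)) < snd (w t)" "t \<le> L"
    using False unfolding t_def
    by (auto intro: LeastI[of "\<lambda>t. exit_vertex (fst (w t)) < snd (w t)" L] Least_le)
  have "snd (w t) \<le> Suc (exit_vertex (fst (w t)))" if "t \<noteq> 0"
  proof -
    obtain t' where t': "t = Suc t'" using \<open>t \<noteq> 0\<close> not0_implies_Suc by blast
    then have "\<not> exit_vertex (fst (w t')) < snd (w t')"
      using not_less_Least[of t' "\<lambda>t. exit_vertex (fst (w t)) < snd (w t)"] t_def by simp
    moreover have e: "(w t', w t) \<in> spiral_edges \<C>" using w[of t'] t t' by simp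
    moreover have "proper_spiral (fst (w t'))" using e pr by (auto simp: spiral_edges_def)
    ultimately show ?thesis using spiral_crossing[of "w t'" "w t"] t by simp
  qed
  then have "t = 0 \<or> snd (w t) \<le> Suc (exit_vertex (fst (w t)))" by blast
  then show thesis by (rule that[OF t(2)]) (simp add: t(1))
qed

text \<open>From time \<open>t\<close> the walk is forced in both directions: backward as long as the vertices do not
lie beyond \<open>r + 1\<close>, and forward beyond \<open>r\<close>.\<close>

lemma spiral_walk_unique:
  assumes pr: "\<And>k. k \<in> \<C> \<Longrightarrow> proper_spiral k"
    and w: "\<And>i. i < L \<Longrightarrow> (w i, w (Suc i)) \<in> spiral_edges \<C>"
    and u: "\<And>i. i < L \<Longrightarrow> (u i, u (Suc i)) \<in> spiral_edges \<C>"
    and t: "t \<le> L" "t = 0 \<or> snd (w t) \<le> Suc (exit_vertex (fst (w t)))" "t = L \<or> exit_vertex (fst (w t)) < snd (w t)"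
    and eq: "u t = w t" and i: "i \<le> L"
  shows "u i = w i"
proof (cases "i \<le> t")
  case True
  have *: "u (t - d) = w (t - d) \<and> snd (w (t - d)) \<le> Suc (exit_vertex (fst (w (t - d))))" if "d \<le> t" "0 < t" for d
    using that
  proof (induction d)
    case 0
    then show ?case using eq t by auto
  next
    case (Suc d)
    then have d: "t - d = Suc (t - Suc d)" "t - Suc d < L" using t by auto
    have e: "(w (t - Suc d), w (t - d)) \<in> spiral_edges \<C>" "(u (t - Suc d), w (t - d)) \<in> spiral_edges \<C>"
      using w[OF d(2)] u[OF d(2)] Suc by (simp_all flip: d(1))
    have "proper_spiral (fst (w (t - d)))" using e pr by (auto simp: spiral_edges_def)
    then show ?case using spiral_pred_unique[OF _ e] Suc by auto
  qed
  show ?thesis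
  proof (cases "t = 0")
    case False
    have "t - (t - i) = i" "t - i \<le> t" "0 < t" using True False by auto
    then show ?thesis using *[of "t - i"] by metis
  qed (use True eq in simp)
next
  case False
  have "u (t + d) = w (t + d) \<and> exit_vertex (fst (w (t + d))) < snd (w (t + d))" if "t + d \<le> L" "t < L" for d
    using that
  proof (induction d)
    case 0
    then show ?case using eq t by auto
  next
    case (Suc d)
    then have d: "t + d < L" by auto
    have e: "(w (t + d), w (t + Suc d)) \<in> spiral_edges \<C>" "(w (t + d), u (t + Suc d)) \<in> spiral_edges \<C>"
      using w[OF d] u[OF d] Suc by simp_all
    have "proper_spiral (fst (w (t + d)))" using e pr by (auto simp: spiral_edges_def)
    then show ?case using spiral_succ_unique[OF _ e] Suc by auto
  qed
  from this[of "i - t"] show ?thesis using False i by simp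
qed

context coded_cantor
begin

lemma funpow_surj:
  assumes "g \<in> surjs" "y \<in> M"
  obtains x where "x \<in> M" "(g ^^ n) x = y"
proof -
  have "(g ^^ n) ` M = M"
  proof (induction n)
    case (Suc n)
    have "(g ^^ Suc n) ` M = g ` ((g ^^ n) ` M)" by (simp add: image_comp)
    then show ?case using surjs_image[OF assms(1)] Suc by simp
  qed simp
  then obtain x where "x \<in> M" "y = (g ^^ n) x" using assms(2) by (metis imageE)
  then show thesis by (intro that[of x]) simp_all
qed

text \<open>Any point in the cell of the pivot vertex, pulled back by surjectivity, has an orbit segment whose
cells form a walk through the pivot; such a walk is unique.\<close>

lemma spiral_finite_walk_realised:
  assumes pr: "\<And>k. k \<in> \<C> \<Longrightarrow> proper_spiral k"
    and g: "g \<in> surjs" and over: "\<And>x. x \<in> M \<Longrightarrow> (b x, b (g x)) \<in> spiral_edges \<C>"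
    and onto: "b ` M = spiral_verts \<C>"
    and w: "\<And>i. i < L \<Longrightarrow> (w i, w (Suc i)) \<in> spiral_edges \<C>" "\<And>i. i \<le> L \<Longrightarrow> w i \<in> spiral_verts \<C>"
  obtains x where "x \<in> M" "\<And>i. i \<le> L \<Longrightarrow> b ((g ^^ i) x) = w i"
proof -
  obtain t where t: "t \<le> L" "t = 0 \<or> snd (w t) \<le> Suc (exit_vertex (fst (w t)))" "t = L \<or> exit_vertex (fst (w t)) < snd (w t)"
    by (rule spiral_walk_pivot[where w = w and L = L, OF pr w(1)])
  obtain y where y: "y \<in> M" "b y = w t" using w(2)[OF t(1)] onto by (metis imageE)
  obtain x where x: "x \<in> M" "(g ^^ t) x = y" using funpow_surj[OF g y(1)] .
  have "b ((g ^^ i) x) = w i" if "i \<le> L" for i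
  proof (rule spiral_walk_unique[where w = w and L = L, OF pr w(1) _ t _ that])
    show "(b ((g ^^ i) x), b ((g ^^ Suc i) x)) \<in> spiral_edges \<C>" for i
      using over[OF funpow_in[OF surjs_cmaps[OF g] x(1)]] by simp
  qed (use x y in simp_all)
  then show thesis using that x by blast
qed

text \<open>Compactness: the conditions on the window from \<open>-N\<close> to \<open>N\<close> define closed sets in the space of
bi-infinite sequences, and a finite orbit segment, continued arbitrarily to the left,
satisfies them.\<close>

lemma biinfinite_orbit:
  assumes g: "g \<in> cmaps" and b: "locally_constant T b"
    and fin: "\<And>N. \<exists>x\<in>M. \<forall>i\<le>2 * N. b ((g ^^ i) x) = w (int i - int N)"
  obtains y :: "int \<Rightarrow> 'a" where "\<And>n. y n \<in> M" "\<And>n. g (y n) = y (n + 1)" "\<And>n. b (y n) = w n"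
proof -
  let ?P = "product_topology (\<lambda>_::int. T) UNIV"
  define A where "A = (\<lambda>n. {y \<in> topspace ?P. g (y n) = y (n + 1)})"
  define B where "B = (\<lambda>n. {y \<in> topspace ?P. b (y n) = w n})"
  define F where "F = (\<lambda>N. topspace ?P \<inter> (\<Inter>n\<in>{- int N..<int N}. A n) \<inter> (\<Inter>n\<in>{- int N..int N}. B n))"
  have proj: "continuous_map ?P T (\<lambda>y. y n)" for n
    by (rule continuous_map_product_projection) simp
  have gc: "continuous_map ?P T (\<lambda>y. g (y n))" for n
    using continuous_map_compose[OF proj, of T g n] g by (simp add: cmaps_def o_def)
  have bc: "locally_constant ?P (\<lambda>y. b (y n))" for n
    using continuous_map_compose[OF proj b, of n] by (simp add: o_def)
  have A: "closedin ?P (A n)" for n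
    unfolding A_def by (rule closedin_continuous_maps_eq) (use Hausdorff_T gc proj in auto)
  have B: "closedin ?P (B n)" for n
    unfolding B_def by (rule locally_constant_clopen(2)[OF bc])
  have "closedin ?P (F N)" for N
  proof -
    have "F N = \<Inter>({topspace ?P} \<union> A ` {- int N..<int N} \<union> B ` {- int N..int N})"
      by (auto simp: F_def)
    also have "closedin ?P \<dots>" using A B by (intro closedin_Inter) (auto simp del: topspace_product_topology)
    finally show ?thesis .
  qed
  moreover have "F N \<noteq> {}" for N
  proof -
    obtain x where x: "x \<in> M" "\<And>i. i \<le> 2 * N \<Longrightarrow> b ((g ^^ i) x) = w (int i - int N)"
      using fin by blast
    define y where "y = (\<lambda>n. (g ^^ nat (n + int N)) x)"
    have "y \<in> topspace ?P" by (auto simp: PiE_iff y_def funpow_in[OF g x(1)])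
    moreover have "y \<in> A n" if "n \<in> {- int N..<int N}" for n
    proof -
      have "nat (n + 1 + int N) = Suc (nat (n + int N))" using that by auto
      then show ?thesis using \<open>y \<in> topspace ?P\<close> by (simp add: A_def y_def)
    qed
    moreover have "y \<in> B n" if "n \<in> {- int N..int N}" for n
    proof -
      have "nat (n + int N) \<le> 2 * N" using that by auto
      then show ?thesis
        using x(2)[of "nat (n + int N)"] that \<open>y \<in> topspace ?P\<close> by (simp add: B_def y_def)
    qed
    ultimately show ?thesis unfolding F_def by blast
  qed
  moreover have "decseq F" by (intro decseq_SucI) (auto simp: F_def)
  moreover have "compact_space ?P" using compact_T by (simp add: compact_space_product_topology)
  ultimately have "(\<Inter>N. F N) \<noteq> {}" by (intro compact_space_imp_nest)
  then obtain y where y: "\<And>N. y \<in> F N" by blast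
  show thesis
  proof (rule that[of y])
    show "y n \<in> M" for n using y[of 0] by (auto simp: F_def PiE_iff)
    show "g (y n) = y (n + 1)" for n
    proof -
      have "n \<in> {- int (nat (\<bar>n\<bar> + 1))..<int (nat (\<bar>n\<bar> + 1))}" by auto
      then have "y \<in> A n" using y[of "nat (\<bar>n\<bar> + 1)"] unfolding F_def by blast
      then show ?thesis by (simp add: A_def)
    qed
    show "b (y n) = w n" for n
    proof -
      have "n \<in> {- int (nat \<bar>n\<bar>)..int (nat \<bar>n\<bar>)}" by auto
      then have "y \<in> B n" using y[of "nat \<bar>n\<bar>"] unfolding F_def by blast
      then show ?thesis by (simp add: B_def)
    qed
  qed
qed

lemma spiral_walk_realised:
  assumes pr: "\<And>k. k \<in> \<C> \<Longrightarrow> proper_spiral k" and b: "locally_constant T b"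
    and g: "g \<in> surjs" and over: "\<And>x. x \<in> M \<Longrightarrow> (b x, b (g x)) \<in> spiral_edges \<C>"
    and onto: "b ` M = spiral_verts \<C>"
    and w: "\<And>n::int. (w n, w (n + 1)) \<in> spiral_edges \<C>" "\<And>n. w n \<in> spiral_verts \<C>"
  obtains y :: "int \<Rightarrow> 'a" where "\<And>n. y n \<in> M" "\<And>n. g (y n) = y (n + 1)" "\<And>n. b (y n) = w n"
proof (rule biinfinite_orbit[OF surjs_cmaps[OF g] b])
  fix N :: nat
  show "\<exists>x\<in>M. \<forall>i\<le>2 * N. b ((g ^^ i) x) = w (int i - int N)"
  proof (rule spiral_finite_walk_realised[OF pr g over onto, of "2 * N" "\<lambda>i. w (int i - int N)"])
    show "(w (int i - int N), w (int (Suc i) - int N)) \<in> spiral_edges \<C>" for i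
      using w(1)[of "int i - int N"] by (simp add: algebra_simps)
  qed (use w(2) in blast)+
qed (use that in blast)

lemma orbit_through:
  assumes "g \<in> surjs" "x \<in> M"
  obtains y :: "int \<Rightarrow> 'a" where "y 0 = x" "\<And>n. y n \<in> M" "\<And>n. g (y n) = y (n + 1)"
proof (rule walk_through[of M "{(u, v). g u = v}" x])
  show "\<exists>u\<in>M. (u, v) \<in> {(u, v). g u = v}" if "v \<in> M" for v
  proof -
    have "v \<in> g ` M" using that surjs_image[OF assms(1)] by simp
    then show ?thesis by blast
  qed
qed (use assms surjs_in that in auto)

definition shadowed :: "nat \<Rightarrow> ('a \<Rightarrow> 'a) \<Rightarrow> ('a \<Rightarrow> 'a) \<Rightarrow> bool" where
  "shadowed n g g' \<longleftrightarrow> (\<forall>x::int \<Rightarrow> 'a. (\<forall>i. x i \<in> M \<and> g (x i) = x (i + 1)) \<longrightarrow>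
      (\<exists>y. \<forall>i. y i \<in> M \<and> g' (y i) = y (i + 1) \<and> code n (x i) = code n (y i)))"

text \<open>The common extension is the space of pairs of bi-infinite orbits of \<open>g1\<close> and \<open>g2\<close> that have equal
\<open>n\<close>-codes at all times, with the shift.  Shadowing makes both coordinate maps onto \<open>X\<close> surjective,
and the pair \<open>(p1, p2)\<close> gives a fixed point.  Transporting along the two coordinates produces two
conjugate maps near \<open>g1\<close> and \<open>g2\<close>; the conjugating homeomorphism preserves \<open>n\<close>-codes because the two
coordinates have the same ones.\<close>

lemma shadowed_amalgam:
  assumes g1: "g1 \<in> surjs" and g2: "g2 \<in> surjs"
    and sh: "shadowed n g1 g2" "shadowed n g2 g1"
    and fp: "p1 \<in> M" "g1 p1 = p1" "p2 \<in> M" "g2 p2 = p2" "code n p1 = code n p2"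
  shows "\<exists>g\<in>surjs_per {1}. \<exists>v\<in>stab n. close l g g1 \<and> close l (conjugate v g) g2"
proof -
  let ?S = "prod_topology T T"
  define E where "E = {q \<in> topspace (prod_topology ?S ?S). 
       (g1 (fst (fst q)), g2 (snd (fst q))) = snd q \<and> code n (fst (fst q)) = code n (snd (fst q))}"
  let ?Z = "walks ?S E"
  have E_iff: "((x, y), (x', y')) \<in> E \<longleftrightarrow> x \<in> M \<and> y \<in> M \<and> x' = g1 x \<and> y' = g2 y \<and> code n x = code n y" for x y x' y'
    using surjs_in[OF g1] surjs_in[OF g2] by (auto simp: E_def)
  have "closedin (prod_topology ?S ?S) E"
  proof -
    let ?SS = "prod_topology ?S ?S"
    have c: "continuous_map ?SS T (\<lambda>q. fst (fst q))" "continuous_map ?SS T (\<lambda>q. snd (fst q))"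
      using continuous_map_compose[OF continuous_map_fst[of ?S ?S] continuous_map_fst[of T T]]
        continuous_map_compose[OF continuous_map_fst[of ?S ?S] continuous_map_snd[of T T]] by (simp_all add: o_def)
    have lc: "locally_constant ?SS (\<lambda>q. (code n (fst (fst q)), code n (snd (fst q))))"
      using continuous_map_compose[OF c(1) locally_constant_code] continuous_map_compose[OF c(2) locally_constant_code]
      by (intro locally_constant_Pair) (simp_all add: o_def)
    have gc: "continuous_map ?SS ?S (\<lambda>q. (g1 (fst (fst q)), g2 (snd (fst q))))"
      using continuous_map_compose[OF c(1) surjs_cont[OF g1]] continuous_map_compose[OF c(2) surjs_cont[OF g2]]
      by (intro continuous_map_pairedI) (simp_all add: o_def)
    have "closedin ?SS {q \<in> topspace ?SS. (g1 (fst (fst q)), g2 (snd (fst q))) = snd q}"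
      by (rule closedin_continuous_maps_eq[OF _ gc continuous_map_snd])
         (simp add: Hausdorff_space_prod_topology Hausdorff_T)
    moreover have "closedin ?SS {q \<in> topspace ?SS. code n (fst (fst q)) = code n (snd (fst q))}"
      using locally_constant_clopen(2)[OF lc, of "\<lambda>(u, v). u = v"] by simp
    ultimately have "closedin ?SS ({q \<in> topspace ?SS. (g1 (fst (fst q)), g2 (snd (fst q))) = snd q} \<inter>
        {q \<in> topspace ?SS. code n (fst (fst q)) = code n (snd (fst q))})"
      by (rule closedin_Int)
    also have "\<dots> = E" by (auto simp: E_def)
    finally show ?thesis .
  qed
  then have Z: "zero_dim_compact ?Z"
    by (intro zero_dim_compact_walks zero_dim_compact_prod zero_dim_compact_T)
  have pair_in: "(\<lambda>i. (x i, y i)) \<in> topspace ?Z" 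
    if "\<And>i. x i \<in> M" "\<And>i. g1 (x i) = x (i + 1)" "\<And>i. y i \<in> M" "\<And>i. g2 (y i) = y (i + 1)"
       "\<And>i. code n (x i) = code n (y i)" for x y :: "int \<Rightarrow> 'a"
    using that by (simp add: topspace_walks E_iff)
  define \<pi>1 where "\<pi>1 = (\<lambda>z::int \<Rightarrow> 'a \<times> 'a. fst (z 0))"
  define \<pi>2 where "\<pi>2 = (\<lambda>z::int \<Rightarrow> 'a \<times> 'a. snd (z 0))"
  have cont: "continuous_map ?Z T \<pi>1" "continuous_map ?Z T \<pi>2"
    unfolding \<pi>1_def \<pi>2_def
    using continuous_map_compose[OF continuous_map_walks_coordinate[of ?S E 0] continuous_map_fst]
      continuous_map_compose[OF continuous_map_walks_coordinate[of ?S E 0] continuous_map_snd]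
    by (simp_all add: o_def)
  have ZM: "fst (z i) \<in> M" "snd (z i) \<in> M" "g1 (fst (z i)) = fst (z (i + 1))" "g2 (snd (z i)) = snd (z (i + 1))"
      "code n (fst (z i)) = code n (snd (z i))"
    if "z \<in> topspace ?Z" for z i
  proof -
    have "(z i, z (i + 1)) \<in> E" using that by (simp add: topspace_walks)
    then have "((fst (z i), snd (z i)), (fst (z (i + 1)), snd (z (i + 1)))) \<in> E" by simp
    then show "fst (z i) \<in> M" "snd (z i) \<in> M" "g1 (fst (z i)) = fst (z (i + 1))" "g2 (snd (z i)) = snd (z (i + 1))"
      "code n (fst (z i)) = code n (snd (z i))" unfolding E_iff by auto
  qed
  have onto1: "\<pi>1 ` topspace ?Z = M"
  proof
    show "M \<subseteq> \<pi>1 ` topspace ?Z"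
    proof
      fix x assume "x \<in> M"
      then obtain u :: "int \<Rightarrow> 'a" where u: "u 0 = x" "\<And>i. u i \<in> M" "\<And>i. g1 (u i) = u (i + 1)"
        using orbit_through[OF g1] by blast
      then obtain y where "\<And>i. y i \<in> M" "\<And>i. g2 (y i) = y (i + 1)" "\<And>i. code n (u i) = code n (y i)"
        using sh(1) unfolding shadowed_def by metis
      then have "(\<lambda>i. (u i, y i)) \<in> topspace ?Z" using pair_in u by blast
      then show "x \<in> \<pi>1 ` topspace ?Z" using u(1) by (force simp: \<pi>1_def)
    qed
  qed (use ZM in \<open>auto simp: \<pi>1_def\<close>)
  have onto2: "\<pi>2 ` topspace ?Z = M"
  proof
    show "M \<subseteq> \<pi>2 ` topspace ?Z"
    proof
      fix x assume "x \<in> M"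
      then obtain u :: "int \<Rightarrow> 'a" where u: "u 0 = x" "\<And>i. u i \<in> M" "\<And>i. g2 (u i) = u (i + 1)"
        using orbit_through[OF g2] by blast
      then obtain y where y: "\<And>i. y i \<in> M" "\<And>i. g1 (y i) = y (i + 1)" "\<And>i. code n (u i) = code n (y i)"
        using sh(2) unfolding shadowed_def by metis
      then have "(\<lambda>i. (y i, u i)) \<in> topspace ?Z" using pair_in[of y u] u by metis
      then show "x \<in> \<pi>2 ` topspace ?Z" using u(1) by (force simp: \<pi>2_def)
    qed
  qed (use ZM in \<open>auto simp: \<pi>2_def\<close>)
  have "\<pi>1 (shift z) = g1 (\<pi>1 z)" "\<pi>2 (shift z) = g2 (\<pi>2 z)" if "z \<in> topspace ?Z" for z
    using ZM(3,4)[OF that, of 0] by (simp_all add: \<pi>1_def \<pi>2_def shift_def)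
  note eq = this
  obtain h where h: "homeomorphic_map (prod_topology ?Z T) T h" "close (max l n) (transport ?Z h shift) g1"
    "\<And>z t. \<lbrakk>z \<in> topspace ?Z; t \<in> M\<rbrakk> \<Longrightarrow> code (max l n) (h (z, t)) = code (max l n) (\<pi>1 z)"
    by (rule factor_transport_close[where n = "max l n", OF Z continuous_map_shift cont(1) onto1 g1])
       (use eq(1) in blast)+
  obtain k where k: "homeomorphic_map (prod_topology ?Z T) T k" "close (max l n) (transport ?Z k shift) g2"
    "\<And>z t. \<lbrakk>z \<in> topspace ?Z; t \<in> M\<rbrakk> \<Longrightarrow> code (max l n) (k (z, t)) = code (max l n) (\<pi>2 z)"
    by (rule factor_transport_close[where n = "max l n", OF Z continuous_map_shift cont(2) onto2 g2])
       (use eq(2) in blast)+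
  define g where "g = transport ?Z h shift"
  define v where "v = k \<circ> inv_into (topspace ?Z \<times> M) h"
  have v: "v \<in> homeos" "conjugate v g = transport ?Z k shift"
    "\<And>z t. \<lbrakk>z \<in> topspace ?Z; t \<in> M\<rbrakk> \<Longrightarrow> v (h (z, t)) = k (z, t)"
    unfolding v_def g_def by (rule transport_conj[OF h(1) k(1) continuous_map_shift]; assumption)+
  have "v \<in> stab n"
    unfolding stab_def
  proof (intro CollectI conjI v(1) ballI)
    fix x assume "x \<in> M"
    then obtain z t where zt: "z \<in> topspace ?Z" "t \<in> M" "x = h (z, t)" by (rule transport_cases[OF h(1)])
    have "code n (k (z, t)) = code n (\<pi>2 z)" "code n (h (z, t)) = code n (\<pi>1 z)"
      using h(3)[OF zt(1,2)] k(3)[OF zt(1,2)] code_mono max.cobounded2 by blast+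
    then show "code n (v x) = code n x"
      using zt v(3) ZM(5)[OF zt(1), of 0] by (simp add: \<pi>1_def \<pi>2_def)
  qed
  moreover have "g \<in> surjs_per {1}"
  proof -
    have "g \<in> surjs" unfolding g_def by (rule transport_surjs[OF h(1) continuous_map_shift shift_image_walks])
    moreover have "1 \<in> per g"
    proof -
      obtain t where t: "t \<in> M" using M_nonempty by blast
      have z: "(\<lambda>_. (p1, p2)) \<in> topspace ?Z" by (rule pair_in) (use fp in auto)
      have "g (h (\<lambda>_. (p1, p2), t)) = h (\<lambda>_. (p1, p2), t)"
        unfolding g_def transport_apply[OF h(1) z t] by (simp add: shift_def)
      then show ?thesis using transport_in[OF h(1) z t] by (auto simp: per_def)
    qed
    ultimately show ?thesis by (simp add: surjs_per_def)
  qed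
  moreover have "close l g g1" "close l (conjugate v g) g2"
    using h(2) k(2) v(2) close_mono max.cobounded1 g_def by metis+
  ultimately show ?thesis by blast
qed

end

section \<open>Neighbourhoods in which any two maps amalgamate\<close>

lemma finite_range_repeat:
  fixes f :: "nat \<Rightarrow> 'b"
  assumes "finite (range f)"
  obtains i j where "i < j" "f i = f j"
proof -
  have "\<not> inj f" using assms finite_imageD[of f UNIV] by auto
  then obtain i j where "i \<noteq> j" "f i = f j" by (auto simp: inj_def)
  then show thesis using that by (metis linorder_neqE_nat)
qed

text \<open>The place of a vertex on the orbit that its spiral follows.\<close>

definition spiral_point :: "('a \<Rightarrow> 'a) \<Rightarrow> 'a spiral \<times> nat \<Rightarrow> 'a" where
  "spiral_point f = (\<lambda>((z, r, s, m), i). (f ^^ i) z)"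

context coded_cantor
begin

text \<open>The edges of the spiral, mapped into the orbit of \<open>z\<close>, are moves that \<open>f\<close> makes between cells.  For
the edges back this requires that the orbit revisits a cell.\<close>

definition traces :: "nat \<Rightarrow> ('a \<Rightarrow> 'a) \<Rightarrow> 'a spiral \<Rightarrow> bool" where
  "traces N f = (\<lambda>(z, r, s, m). z \<in> M \<and> r + 1 < s \<and> s \<le> m \<and>
      (\<exists>y\<in>M. code N y = code N ((f ^^ r) z) \<and> f y = z) \<and> code N ((f ^^ Suc m) z) = code N ((f ^^ s) z))"

text \<open>A bi-infinite orbit through \<open>x\<close> visits finitely many cells, so it repeats a cell in the future and
in the past.  Only odd times are compared: this keeps the times away from \<open>0\<close>, which
separates the two cycles, and makes the period of each repetition at least two, so that neither
cycle is a loop.\<close>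

lemma spiral_through:
  assumes f: "f \<in> surjs" and x: "x \<in> M"
  obtains z r s m t where "traces N f (z, r, s, m)" "0 < r" "s < m" "t \<le> m" "(f ^^ t) z = x"
proof -
  have fin: "finite (code N ` M)"
    by (rule locally_constant_finite_image[OF compact_T locally_constant_code])
  obtain y :: "int \<Rightarrow> 'a" where y: "y 0 = x" "\<And>n. y n \<in> M" "\<And>n. f (y n) = y (n + 1)"
    using orbit_through[OF f x] by blast
  have fin': "finite (range (\<lambda>k::nat. code N (y (e k))))" for e
    by (rule finite_subset[OF _ fin]) (use y(2) in auto)
  obtain a1 a2 where a: "a1 < a2" "code N (y (- int (2 * a1 + 1))) = code N (y (- int (2 * a2 + 1)))"
    using finite_range_repeat[OF fin'[of "\<lambda>k. - int (2 * k + 1)"]] by blast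
  obtain b1 b2 where b: "b1 < b2" "code N (y (int (2 * b1 + 1))) = code N (y (int (2 * b2 + 1)))"
    using finite_range_repeat[OF fin'[of "\<lambda>k. int (2 * k + 1)"]] by blast
  define z where "z = y (- int (2 * a2))"
  have fz: "(f ^^ i) z = y (int i - int (2 * a2))" for i
  proof (induction i)
    case (Suc i)
    then show ?case using y(3)[of "int i - int (2 * a2)"] by (simp add: algebra_simps)
  qed (simp add: z_def)
  define r where "r = 2 * a2 - 2 * a1 - 1"
  define s where "s = 2 * a2 + 2 * b1 + 1"
  define m where "m = 2 * a2 + 2 * b2"
  have r: "int r - int (2 * a2) = - int (2 * a1 + 1)" "0 < r" using a(1) by (auto simp: r_def)
  have s: "int s - int (2 * a2) = int (2 * b1 + 1)" "r + 1 < s" "s < m" using a(1) b(1)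
    by (auto simp: r_def s_def m_def)
  have m: "int (Suc m) - int (2 * a2) = int (2 * b2 + 1)" by (simp add: m_def)
  have "traces N f (z, r, s, m)"
    unfolding traces_def prod.case
  proof (intro conjI)
    show "\<exists>y\<in>M. code N y = code N ((f ^^ r) z) \<and> f y = z"
      using y(2,3)[of "- int (2 * a2 + 1)"] a(2) unfolding fz r by (intro bexI[of _ "y (- int (2 * a2 + 1))"]) (simp_all add: z_def)
    show "code N ((f ^^ Suc m) z) = code N ((f ^^ s) z)"
      using b(2) unfolding fz s m by simp
  qed (use s y(2) z_def in auto)
  moreover have "2 * a2 \<le> m" by (simp add: m_def)
  moreover have "(f ^^ (2 * a2)) z = x" using y(1) unfolding fz by simp
  ultimately show thesis using that r(2) s(3) by blast
qed

text \<open>Equivalently, every open part of the \<open>m\<close>-neighbourhood of \<open>f\<close> has a dense \<open>stab n\<close>-saturation in it: no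
open condition invariant under \<open>stab n\<close> tells the maps of this neighbourhood apart.\<close>

definition amalgamating :: "nat \<Rightarrow> nat \<Rightarrow> ('a \<Rightarrow> 'a) \<Rightarrow> bool" where
  "amalgamating n m f \<longleftrightarrow> (\<forall>g1\<in>surjs_per {1}. \<forall>g2\<in>surjs_per {1}. close m f g1 \<longrightarrow> close m f g2 \<longrightarrow>
     (\<forall>l. \<exists>g\<in>surjs_per {1}. \<exists>v\<in>stab n. close l g g1 \<and> close l (conjugate v g) g2))"

text \<open>The finite graph has one spiral through each cell, following an orbit of \<open>f\<close>, and one more spiral
at the fixed point.  Its space of walks with the shift makes only moves that \<open>f\<close> makes, so it can
be transported to a map \<open>f'\<close> near \<open>f\<close>.  The vertex of a point under this transport is a locally
constant function \<open>b\<close>, so every map sufficiently close to \<open>f'\<close> respects the graph too; such maps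
shadow each other because every walk is realised by all of them.\<close>

lemma amalgamating_dense:
  assumes f: "f \<in> surjs_per {1}"
  obtains f' m where "f' \<in> surjs_per {1}" "close j f f'" "j \<le> m" "amalgamating n m f'"
proof -
  have fS: "f \<in> surjs" using f by (simp add: surjs_per_def)
  obtain p where p: "p \<in> M" "f p = p" using f by (auto simp: surjs_per_def per_def)
  have pk: "(f ^^ i) p = p" for i by (induction i) (use p in auto)
  \<comment> \<open>Moves between cells of level \<open>N\<close> determine a map up to level \<open>j\<close>, and the cells also determine
    \<open>n\<close>-codes, which companion orbits have to share.\<close>
  obtain N where N: "N \<ge> max j n"
    "\<And>x y. \<lbrakk>x \<in> M; y \<in> M; code N x = code N y\<rbrakk> \<Longrightarrow> code (max j n) (f x) = code (max j n) (f y)"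
    using uniformly_continuous_code[OF surjs_cont[OF fS]] by blast
  have finN: "finite (code N ` M)"
    by (rule locally_constant_finite_image[OF compact_T locally_constant_code])
  have "\<exists>k t. traces N f k \<and> 0 < exit_vertex k \<and> fst (snd (snd k)) < snd (snd (snd k)) \<and> t \<le> snd (snd (snd k)) \<and> code N (spiral_point f (k, t)) = l"
    if l: "l \<in> code N ` M" for l
  proof -
    obtain x where x: "x \<in> M" "l = code N x" using l by blast
    obtain z r s m t where "traces N f (z, r, s, m)" "0 < r" "s < m" "t \<le> m" "(f ^^ t) z = x"
      using spiral_through[OF fS x(1)] by blast
    then show ?thesis using x(2) by (intro exI[of _ "(z, r, s, m)"] exI[of _ t]) (simp add: exit_vertex_def spiral_point_def)
  qed
  then obtain K t where K: "\<And>l. l \<in> code N ` M \<Longrightarrow> traces N f (K l) \<and> 0 < exit_vertex (K l) \<and>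
      fst (snd (snd (K l))) < snd (snd (snd (K l))) \<and> t l \<le> snd (snd (snd (K l))) \<and> code N (spiral_point f (K l, t l)) = l"
    by metis
  \<comment> \<open>The spiral with the cycles \<open>0\<close> and \<open>2\<close>, both of length one, all of whose vertices lie over \<open>p\<close>.
    Every fixed point of a map respecting the graph must lie in one of these two loops.\<close>
  define star where "star = (p, 0::nat, 2::nat, 2::nat)"
  have star: "traces N f star"
    using p pk by (auto simp: traces_def star_def)
  define \<C> where "\<C> = insert star (K ` code N ` M)"
  have finC: "finite \<C>" using finN by (simp add: \<C>_def)
  have tr: "traces N f k" if "k \<in> \<C>" for k using that star K by (auto simp: \<C>_def)
  have pr: "proper_spiral k" if "k \<in> \<C>" for k using tr[OF that] by (auto simp: traces_def proper_spiral_def)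
  have V: "((z, r, s, m), i) \<in> spiral_verts \<C> \<longleftrightarrow> (z, r, s, m) \<in> \<C> \<and> i \<le> m" for z r s m i
    by (simp add: spiral_verts_def)
  have E: "(((z, r, s, m), i), (k', i')) \<in> spiral_edges \<C> \<longleftrightarrow> (z, r, s, m) \<in> \<C> \<and> k' = (z, r, s, m) \<and>
      i \<le> m \<and> (i' = Suc i \<and> i' \<le> m \<or> i = r \<and> i' = 0 \<or> i = m \<and> i' = s)" for z r s m i k' i'
    by (auto simp: spiral_edges_def spiral_edge_def)
  have posM: "spiral_point f v \<in> M" if v: "v \<in> spiral_verts \<C>" for v
  proof -
    obtain z r s m i where vz: "v = ((z, r, s, m), i)" using prod_cases5 by (metis surj_pair)
    then show ?thesis using v tr V funpow_in[OF surjs_cmaps[OF fS]] by (auto simp: spiral_point_def traces_def)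
  qed
  have edge: "\<exists>x\<in>M. code N x = code N (spiral_point f v) \<and> code N (f x) = code N (spiral_point f u)" 
    if vu: "(v, u) \<in> spiral_edges \<C>" for u v
  proof -
    obtain z r s m i where v: "v = ((z, r, s, m), i)" by (metis surj_pair)
    obtain k' i' where u: "u = (k', i')" by (metis surj_pair)
    have k: "(z, r, s, m) \<in> \<C>" "k' = (z, r, s, m)" "i \<le> m"
      and c: "i' = Suc i \<and> i' \<le> m \<or> i = r \<and> i' = 0 \<or> i = m \<and> i' = s"
      using vu unfolding u v E by auto
    have zM: "z \<in> M" "(f ^^ a) z \<in> M" for a
      using tr[OF k(1)] funpow_in[OF surjs_cmaps[OF fS]] by (auto simp: traces_def)
    from c show ?thesis
    proof (elim disjE conjE)
      assume "i' = Suc i"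
      then show ?thesis using zM by (intro bexI[of _ "(f ^^ i) z"]) (auto simp: u v k spiral_point_def)
    next
      assume "i = r" "i' = 0"
      then show ?thesis using tr[OF k(1)] by (auto simp: u v k spiral_point_def traces_def)
    next
      assume "i = m" "i' = s"
      then show ?thesis using tr[OF k(1)] zM by (intro bexI[of _ "(f ^^ m) z"]) (auto simp: u v k spiral_point_def traces_def)
    qed
  qed
  let ?S = "discrete_topology (spiral_verts \<C>)"
  let ?Z = "walks ?S (spiral_edges \<C>)"
  have Z: "zero_dim_compact ?Z"
  proof (rule zero_dim_compact_walks)
    show "zero_dim_compact ?S" by (intro zero_dim_compact_finite_discrete finite_spiral_verts finC)
    have "spiral_edges \<C> \<subseteq> spiral_verts \<C> \<times> spiral_verts \<C>"
      using tr by (auto simp: spiral_edges_def spiral_verts_def spiral_edge_def traces_def)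
    then show "closedin (prod_topology ?S ?S) (spiral_edges \<C>)"
      by (simp flip: prod_topology_discrete_topology)
  qed
  have wV: "w n \<in> spiral_verts \<C>" "(w n, w (n + 1)) \<in> spiral_edges \<C>" if "w \<in> topspace ?Z" for w n
    using that by (auto simp: topspace_walks)
  have through: "\<exists>w\<in>topspace ?Z. w 0 = v" if v: "v \<in> spiral_verts \<C>" for v
  proof (rule walk_through[of "spiral_verts \<C>" "spiral_edges \<C>" v])
    fix v assume "v \<in> spiral_verts \<C>"
    moreover obtain z r s m i where v: "v = ((z, r, s, m), i)" by (metis surj_pair)
    ultimately have k: "(z, r, s, m) \<in> \<C>" "i \<le> m" using V by auto
    then have rsm: "r + 1 < s" "s \<le> m" using pr by (auto simp: proper_spiral_def)
    show "\<exists>u\<in>spiral_verts \<C>. (v, u) \<in> spiral_edges \<C>"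
      using k rsm by (intro bexI[of _ "((z, r, s, m), if i < m then Suc i else s)"]) (auto simp: v E V)
    show "\<exists>u\<in>spiral_verts \<C>. (u, v) \<in> spiral_edges \<C>"
      using k rsm by (intro bexI[of _ "((z, r, s, m), if i = 0 then r else i - 1)"]) (auto simp: v E V)
  next
    fix w :: "int \<Rightarrow> 'a spiral \<times> nat"
    assume "w 0 = v" "\<And>n. w n \<in> spiral_verts \<C>" "\<And>n. (w n, w (n + 1)) \<in> spiral_edges \<C>"
    then show ?thesis by (intro bexI[of _ w]) (auto simp: topspace_walks)
  qed (rule v)
  have coord: "continuous_map ?Z ?S (\<lambda>w. w 0)" by (rule continuous_map_walks_coordinate)
  have lcZ: "locally_constant ?Z (\<lambda>w. q (w 0))" for q :: "'a spiral \<times> nat \<Rightarrow> 'q"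
    using continuous_map_compose[OF coord, of "discrete_topology UNIV" q] by (simp add: o_def)
  have img: "(\<lambda>w. code N (spiral_point f (w 0))) ` topspace ?Z = code N ` M"
  proof
    show "(\<lambda>w. code N (spiral_point f (w 0))) ` topspace ?Z \<subseteq> code N ` M" using wV(1) posM by blast
    show "code N ` M \<subseteq> (\<lambda>w. code N (spiral_point f (w 0))) ` topspace ?Z"
    proof
      fix l assume l: "l \<in> code N ` M"
      have "(K l, t l) \<in> spiral_verts \<C>"
        using K[OF l] l V by (cases "K l") (auto simp: \<C>_def intro: rev_image_eqI)
      then obtain w where "w \<in> topspace ?Z" "w 0 = (K l, t l)" using through by blast
      then show "l \<in> (\<lambda>w. code N (spiral_point f (w 0))) ` topspace ?Z"
        using K[OF l] by (intro image_eqI[of _ _ w]) auto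
    qed
  qed
  obtain h where h: "homeomorphic_map (prod_topology ?Z T) T h"
    and lab: "\<And>w t. \<lbrakk>w \<in> topspace ?Z; t \<in> M\<rbrakk> \<Longrightarrow> code N (h (w, t)) = code N (spiral_point f (w 0))"
    using labelled_product_homeomorphism[OF Z cantor lcZ locally_constant_code img] by blast
  define f' where "f' = transport ?Z h shift"
  have shZ: "shift w \<in> topspace ?Z" if "w \<in> topspace ?Z" for w
    using that shift_image_walks by blast
  have f'S: "f' \<in> surjs" unfolding f'_def by (rule transport_surjs[OF h continuous_map_shift shift_image_walks])
  have "close (max j n) f' f"
    unfolding f'_def
    by (rule transport_close[where \<pi> = "\<lambda>w. spiral_point f (w 0)", OF h fS _ shZ _ N lab])
       (use posM wV(1) edge wV(2)[of _ 0] in \<open>auto simp: shift_def\<close>)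
  then have cl: "close j f f'" by (meson close_mono close_sym max.cobounded1)
  have "star \<in> \<C>" by (simp add: \<C>_def)
  then have sE: "((star, 0), (star, 0)) \<in> spiral_edges \<C>" "(star, 0) \<in> spiral_verts \<C>"
    by (auto simp: star_def E V)
  obtain t0 where t0: "t0 \<in> M" using M_nonempty by blast
  have f'fix: "f' \<in> surjs_per {1}"
  proof -
    have w: "(\<lambda>_. (star, 0)) \<in> topspace ?Z" using sE by (simp add: topspace_walks)
    have "f' (h (\<lambda>_. (star, 0), t0)) = h (\<lambda>_. (star, 0), t0)"
      unfolding f'_def transport_apply[OF h w t0] by (simp add: shift_def)
    then show ?thesis using f'S transport_in[OF h w t0] by (auto simp: surjs_per_def per_def)
  qed
  \<comment> \<open>the vertex at time \<open>0\<close> of the walk to which \<open>x\<close> corresponds\<close>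
  define b where "b = (\<lambda>x. fst (inv_into (topspace ?Z \<times> M) h x) 0)"
  have bh: "b (h (w, t)) = w 0" if "w \<in> topspace ?Z" "t \<in> M" for w t
    by (simp add: b_def transport_inv[OF h that])
  have b_lc: "locally_constant T b"
    unfolding b_def
    using continuous_map_compose[OF continuous_map_compose[OF
        homeomorphic_imp_continuous_map[OF inverse_homeomorphic_map[OF h]] continuous_map_fst] lcZ[of "\<lambda>v. v"]]
    by (simp add: o_def)
  have b_edge: "(b x, b (f' x)) \<in> spiral_edges \<C>" and b_code: "code N x = code N (spiral_point f (b x))"
    and b_V: "b x \<in> spiral_verts \<C>" if x: "x \<in> M" for x
  proof -
    obtain w t where wt: "w \<in> topspace ?Z" "t \<in> M" "x = h (w, t)" using x by (rule transport_cases[OF h])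
    show "(b x, b (f' x)) \<in> spiral_edges \<C>"
      using wt wV(2)[OF wt(1), of 0] shZ by (simp add: f'_def transport_apply[OF h] bh shift_def)
    show "code N x = code N (spiral_point f (b x))" using wt lab by (simp add: bh)
    show "b x \<in> spiral_verts \<C>" using wt wV by (simp add: bh)
  qed
  have b_onto: "b ` M = spiral_verts \<C>"
  proof
    show "spiral_verts \<C> \<subseteq> b ` M"
    proof
      fix v assume "v \<in> spiral_verts \<C>"
      then obtain w where "w \<in> topspace ?Z" "w 0 = v" using through by blast
      then show "v \<in> b ` M" using bh[of w t0] transport_in[OF h] t0 by (intro image_eqI[of _ _ "h (w, t0)"]) auto
    qed
  qed (use b_V in blast)
  obtain m0 where m0: "\<And>x y. \<lbrakk>x \<in> M; y \<in> M; code m0 x = code m0 y\<rbrakk> \<Longrightarrow> b x = b y"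
    using code_refines[OF b_lc] by blast
  define m where "m = max m0 j"
  have over: "(b x, b (g x)) \<in> spiral_edges \<C>" if g: "g \<in> surjs" "close m f' g" and x: "x \<in> M" for g x
  proof -
    have "close m0 f' g" using g(2) by (rule close_mono) (simp add: m_def)
    then have "b (f' x) = b (g x)"
      using x by (intro m0 surjs_in[OF f'S] surjs_in[OF g(1)]) (simp_all add: close_def)
    then show ?thesis using b_edge[OF x] by simp
  qed
  have shad: "shadowed n g1 g2"
    if g: "g1 \<in> surjs" "close m f' g1" "g2 \<in> surjs" "close m f' g2" for g1 g2
    unfolding shadowed_def
  proof (intro allI impI)
    fix x :: "int \<Rightarrow> 'a" assume x: "\<forall>i. x i \<in> M \<and> g1 (x i) = x (i + 1)"
    have "(b (x i), b (x (i + 1))) \<in> spiral_edges \<C>" for i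
      using over[OF g(1,2), of "x i"] x by simp
    moreover have "b (x i) \<in> spiral_verts \<C>" for i using b_V x by blast
    ultimately obtain y :: "int \<Rightarrow> 'a" where y: "\<And>i. y i \<in> M" "\<And>i. g2 (y i) = y (i + 1)" "\<And>i. b (y i) = b (x i)"
      using spiral_walk_realised[where w = "\<lambda>i. b (x i)", OF pr b_lc g(3) over[OF g(3,4)] b_onto] by blast
    have "code n (x i) = code n (y i)" for i
    proof -
      have "code N (x i) = code N (y i)" using b_code y x by metis
      then show ?thesis by (rule code_mono) (use N in simp)
    qed
    then show "\<exists>y. \<forall>i. y i \<in> M \<and> g2 (y i) = y (i + 1) \<and> code n (x i) = code n (y i)"
      using y by blast
  qed
  have fixp: "\<exists>q\<in>M. g q = q \<and> code n q = code n p" if g: "g \<in> surjs_per {1}" "close m f' g" for g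
  proof -
    have gS: "g \<in> surjs" using g by (simp add: surjs_per_def)
    obtain q where q: "q \<in> M" "g q = q" using g by (auto simp: surjs_per_def per_def)
    have e: "(b q, b q) \<in> spiral_edges \<C>" using over[OF gS g(2) q(1)] q by simp
    obtain z r s m' i where bq: "b q = ((z, r, s, m'), i)" by (metis surj_pair)
    have k: "(z, r, s, m') \<in> \<C>" "i = r \<and> i = 0 \<or> i = m' \<and> i = s"
      using e unfolding bq E by auto
    have "(z, r, s, m') = star"
    proof (rule ccontr)
      assume "(z, r, s, m') \<noteq> star"
      then obtain l where "l \<in> code N ` M" "(z, r, s, m') = K l" using k(1) by (auto simp: \<C>_def)
      then have "0 < r" "s < m'" using K[of l] by (auto simp: exit_vertex_def simp flip: \<open>(z, r, s, m') = K l\<close>)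
      then show False using k(2) by auto
    qed
    then have "spiral_point f (b q) = p" by (simp add: bq spiral_point_def star_def pk)
    then have "code N q = code N p" using b_code[OF q(1)] by simp
    then have "code n q = code n p" by (rule code_mono) (use N in simp)
    then show ?thesis using q by blast
  qed
  have "amalgamating n m f'"
    unfolding amalgamating_def
  proof (intro ballI impI allI)
    fix g1 g2 l
    assume g: "g1 \<in> surjs_per {1}" "g2 \<in> surjs_per {1}" "close m f' g1" "close m f' g2"
    obtain p1 where p1: "p1 \<in> M" "g1 p1 = p1" "code n p1 = code n p" using fixp[OF g(1,3)] by blast
    obtain p2 where p2: "p2 \<in> M" "g2 p2 = p2" "code n p2 = code n p" using fixp[OF g(2,4)] by blast
    have gS: "g1 \<in> surjs" "g2 \<in> surjs" using g by (simp_all add: surjs_per_def)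
    show "\<exists>g\<in>surjs_per {1}. \<exists>v\<in>stab n. close l g g1 \<and> close l (conjugate v g) g2"
      by (rule shadowed_amalgam[OF gS shad[OF gS(1) g(3) gS(2) g(4)] shad[OF gS(2) g(4) gS(1) g(3)]
            p1(1,2) p2(1,2)]) (use p1 p2 in simp)
  qed
  then show thesis by (intro that[OF f'fix cl, of m]) (simp_all add: m_def)
qed

end

section \<open>Generic maps are conjugate and form a countable intersection of dense open sets\<close>

context coded_cantor
begin

text \<open>Since \<open>H (Suc k)\<close> agrees with \<open>H k\<close> up to \<open>I k\<close>-codes, the sequence converges uniformly to a surjection.
Injectivity of the limit comes from \<open>fine\<close>: the level \<open>I k\<close> is chosen, after \<open>H k\<close> is known, so
fine that it still separates the images of points with different \<open>k\<close>-codes.\<close>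

lemma limit_homeomorphism:
  assumes H: "\<And>k. H k \<in> homeos" and I: "\<And>k. k \<le> I k" "\<And>k. I k \<le> I (Suc k)"
    and step: "\<And>k x. x \<in> M \<Longrightarrow> code (I k) (H (Suc k) x) = code (I k) (H k x)"
    and fine: "\<And>k x y. \<lbrakk>x \<in> M; y \<in> M; code (I k) (H k x) = code (I k) (H k y)\<rbrakk> \<Longrightarrow> code k x = code k y"
  obtains h where "h \<in> homeos"
    "\<And>f l. f \<in> cmaps \<Longrightarrow> \<exists>k0. \<forall>k\<ge>k0. close l (conjugate (H k) f) (conjugate h f)"
proof -
  have "\<exists>y\<in>M. \<forall>k. code (I k) y = code (I k) (H k x)" if x: "x \<in> M" for x
  proof -
    define F where "F = (\<lambda>k. {y \<in> M. code (I k) y = code (I k) (H k x)})"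
    have "closedin T (F k)" for k
      using locally_constant_clopen(2)[OF locally_constant_code, of "\<lambda>u. u = code (I k) (H k x)" "I k"]
      by (simp add: F_def)
    moreover have "F k \<noteq> {}" for k using homeos_in[OF H x] by (auto simp: F_def)
    moreover have "F (Suc k) \<subseteq> F k" for k
    proof
      fix y assume "y \<in> F (Suc k)"
      then have "y \<in> M" "code (I k) y = code (I k) (H (Suc k) x)"
        using I(2) by (auto simp: F_def intro: code_mono)
      then show "y \<in> F k" using step[OF x] by (simp add: F_def)
    qed
    ultimately obtain y where "\<And>k. y \<in> F k" by (rule nested_nonempty) blast+
    then show ?thesis by (auto simp: F_def)
  qed
  then obtain h where h: "\<And>x. x \<in> M \<Longrightarrow> h x \<in> M" "\<And>x k. x \<in> M \<Longrightarrow> code (I k) (h x) = code (I k) (H k x)"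
    by metis
  have hl: "code l (h x) = code l (H k x)" if "x \<in> M" "l \<le> k" for x k l
    using code_mono[OF h(2)[OF that(1), of k]] I(1)[of k] that(2) by simp
  have cont: "continuous_map T T h"
  proof (rule continuous_map_codeI)
    fix n
    obtain m where m: "\<And>x y. \<lbrakk>x \<in> M; y \<in> M; code m x = code m y\<rbrakk> \<Longrightarrow> code n (H n x) = code n (H n y)"
      using uniformly_continuous_code[OF homeos_cont[OF H[of n]]] by blast
    show "\<exists>m. \<forall>x\<in>M. \<forall>y\<in>M. code m x = code m y \<longrightarrow> code n (h x) = code n (h y)"
    proof (intro exI ballI impI)
      fix x y assume xy: "x \<in> M" "y \<in> M" "code m x = code m y"
      show "code n (h x) = code n (h y)"
        unfolding hl[OF xy(1) order_refl] hl[OF xy(2) order_refl] by (rule m[OF xy])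
    qed
  qed (use h in auto)
  have onto: "h ` M = M"
  proof
    show "M \<subseteq> h ` M"
    proof
      fix y assume y: "y \<in> M"
      define F where "F = (\<lambda>k. {x \<in> M. code (I k) (h x) = code (I k) y})"
      have "closedin T (F k)" for k
        using locally_constant_clopen(2)[OF continuous_map_compose[OF cont locally_constant_code],
            of "\<lambda>u. u = code (I k) y" "I k"]
        by (simp add: F_def)
      moreover have "F k \<noteq> {}" for k
      proof -
        have "inv_into M (H k) y \<in> F k" using h(2)[of "inv_into M (H k) y" k] y H[of k] by (simp add: F_def)
        then show ?thesis by blast
      qed
      moreover have "F (Suc k) \<subseteq> F k" for k using I(2) by (auto simp: F_def intro: code_mono)
      ultimately obtain x where x: "\<And>k. x \<in> F k" by (rule nested_nonempty) blast+
      then have xM: "x \<in> M" "\<And>k. code (I k) (h x) = code (I k) y" by (auto simp: F_def)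
      then have "h x = y" using I(1) by (intro code_separates h(1) y) (auto intro: code_mono)
      then show "y \<in> h ` M" using xM by blast
    qed
  qed (use h in auto)
  have "inj_on h M"
  proof (rule inj_onI)
    fix x y assume xy: "x \<in> M" "y \<in> M" "h x = h y"
    show "x = y"
    proof (rule code_separates[OF xy(1,2)])
      fix k
      have "code (I k) (H k x) = code (I k) (H k y)" using h(2) xy by metis
      then show "code k x = code k y" using fine xy by blast
    qed
  qed
  with cont onto have hH: "h \<in> homeos" by (intro homeosI)
  have "\<exists>k0. \<forall>k\<ge>k0. close l (conjugate (H k) f) (conjugate h f)" if f: "f \<in> cmaps" for f l
  proof -
    have "continuous_map T T (h \<circ> f)" using f cont by (auto simp: cmaps_def intro: continuous_map_compose)
    then obtain N where N: "\<And>x y. \<lbrakk>x \<in> M; y \<in> M; code N x = code N y\<rbrakk> \<Longrightarrow> code l ((h \<circ> f) x) = code l ((h \<circ> f) y)"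
      by (rule uniformly_continuous_code[of "h \<circ> f" l]) (rule that)
    note N = N[unfolded o_apply]
    have "close l (conjugate (H k) f) (conjugate h f)" if k: "k \<ge> max l N" for k
      unfolding close_def
    proof
      fix x assume x: "x \<in> M"
      let ?y = "inv_into M h x" and ?y' = "inv_into M (H k) x"
      have y: "?y \<in> M" "?y' \<in> M" using hH H x by simp_all
      have "code (I k) (H k ?y) = code (I k) x" using h(2)[OF y(1), of k] hH x by simp
      also have "\<dots> = code (I k) (H k ?y')" using H x by simp
      finally have "code k ?y = code k ?y'" using fine y by blast
      then have "code N ?y = code N ?y'" by (rule code_mono) (use k in simp)
      then have "code l (h (f ?y)) = code l (h (f ?y'))" using N y by blast
      also have "\<dots> = code l (H k (f ?y'))" by (rule hl) (use cmaps_in[OF f y(2)] k in auto)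
      finally show "code l (conjugate (H k) f x) = code l (conjugate h f x)"
        using conj_apply'[OF H x] conj_apply'[OF hH x] by simp
    qed
    then show ?thesis by blast
  qed
  with hH show thesis using that by blast
qed

text \<open>For \<open>n = m = 0\<close> this is density of the conjugacy class of \<open>f\<close> in the set of maps with a fixed point,
because codes of length \<open>0\<close> impose nothing.\<close>

definition dense_at :: "nat \<Rightarrow> nat \<Rightarrow> ('a \<Rightarrow> 'a) \<Rightarrow> bool" where
  "dense_at n m f \<longleftrightarrow> (\<forall>g\<in>surjs_per {1}. close m f g \<longrightarrow> (\<forall>l. \<exists>v\<in>stab n. close l (conjugate v f) g))"

definition generic :: "('a \<Rightarrow> 'a) \<Rightarrow> bool" where
  "generic f \<longleftrightarrow> f \<in> surjs_per {1} \<and> dense_at 0 0 f \<and> (\<forall>n. \<exists>m. dense_at n m f)"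

lemma dense_at_mono: "\<lbrakk>dense_at n m f; m \<le> m'\<rbrakk> \<Longrightarrow> dense_at n m' f"
  unfolding dense_at_def using close_mono by blast

lemma surjs_per_cmaps: "f \<in> surjs_per Q \<Longrightarrow> f \<in> cmaps"
  by (simp add: surjs_per_def surjs_def)

text \<open>Conjugation by \<open>h\<close> turns \<open>stab N\<close> into a subset of \<open>stab n\<close>, for \<open>N\<close> large by uniform continuity
of \<open>h\<close>.\<close>

lemma generic_conj:
  assumes f: "generic f" and h: "h \<in> homeos"
  shows "generic (conjugate h f)"
  unfolding generic_def
proof (intro conjI allI)
  have fK: "f \<in> surjs_per {1}" and fc: "f \<in> cmaps" using f surjs_per_cmaps by (auto simp: generic_def)
  show "conjugate h f \<in> surjs_per {1}" using fK h conj_surjs_per by blast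
  let ?i = "inv_into M h"
  have i: "?i \<in> homeos" using h by (rule homeos_inv_into)
  have if': "conjugate ?i (conjugate h f) = f" using h fc by (rule conj_inv)
  show "dense_at 0 0 (conjugate h f)"
    unfolding dense_at_def stab_0
  proof (intro ballI impI allI)
    fix g l assume "g \<in> surjs_per {1}"
    then have "\<forall>l. \<exists>v\<in>homeos. close l (conjugate v f) g"
      using f unfolding generic_def dense_at_def stab_0 by simp
    then obtain v where v: "v \<in> homeos" "close l (conjugate v f) g" by blast
    have "conjugate (v \<circ> ?i) (conjugate h f) = conjugate v f"
      using conj_comp[OF v(1) i conj_cmaps[OF h fc]] if' by simp
    then show "\<exists>v\<in>homeos. close l (conjugate v (conjugate h f)) g"
      using v homeos_comp[OF v(1) i] by metis
  qed
  fix n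
  obtain N where N: "\<And>x y. \<lbrakk>x \<in> M; y \<in> M; code N x = code N y\<rbrakk> \<Longrightarrow> code n (h x) = code n (h y)"
    using uniformly_continuous_code[OF homeos_cont[OF h]] by blast
  obtain m where m: "dense_at N m f" using f unfolding generic_def by blast
  obtain m' where m': "\<And>f g. \<lbrakk>f \<in> cmaps; g \<in> cmaps; close m' f g\<rbrakk> \<Longrightarrow> close m (conjugate ?i f) (conjugate ?i g)"
    using conj_uniform[OF i] by blast
  have "dense_at n m' (conjugate h f)"
    unfolding dense_at_def
  proof (intro ballI impI allI)
    fix g l assume g: "g \<in> surjs_per {1}" "close m' (conjugate h f) g"
    have gc: "g \<in> cmaps" using g surjs_per_cmaps by blast
    have "close m f (conjugate ?i g)" using m'[OF conj_cmaps[OF h fc] gc g(2)] if' by simp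
    moreover obtain q where q: "\<And>f g. \<lbrakk>f \<in> cmaps; g \<in> cmaps; close q f g\<rbrakk> \<Longrightarrow> close l (conjugate h f) (conjugate h g)"
      using conj_uniform[OF h] by blast
    ultimately obtain v where v: "v \<in> stab N" "close q (conjugate v f) (conjugate ?i g)"
      using m conj_surjs_per[OF i g(1)] unfolding dense_at_def by blast
    have vH: "v \<in> homeos" using v stab_homeos by blast
    have "close l (conjugate h (conjugate v f)) (conjugate h (conjugate ?i g))"
      by (rule q) (use v vH i fc gc conj_cmaps in auto)
    moreover have "conjugate h (conjugate ?i g) = g"
    proof (rule conj_eqI[OF h])
      fix x assume x: "x \<in> M"
      have "conjugate ?i g (?i (h x)) = ?i (g (h x))" by (rule conj_apply[OF i homeos_in[OF h x]])
      then show "g (h x) = h (conjugate ?i g x)" using h x homeos_in[OF h x] cmaps_in[OF gc] by simp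
    qed (use gc in \<open>simp add: cmaps_def\<close>)
    moreover have "conjugate (h \<circ> v \<circ> ?i) (conjugate h f) = conjugate h (conjugate v f)"
      using conj_comp[OF homeos_comp[OF h vH] i conj_cmaps[OF h fc]] conj_comp[OF h vH fc] if' by simp
    moreover have "h \<circ> v \<circ> ?i \<in> stab n"
      unfolding stab_def
    proof (intro CollectI conjI ballI)
      show "h \<circ> v \<circ> ?i \<in> homeos" using homeos_comp h vH i by blast
      fix x assume x: "x \<in> M"
      have "code N (v (?i x)) = code N (?i x)" using v(1) x h by (simp add: stab_def)
      then have "code n (h (v (?i x))) = code n (h (?i x))"
        by (rule N[rotated 2]) (use x h homeos_in[OF vH] in simp_all)
      then show "code n ((h \<circ> v \<circ> ?i) x) = code n x" using x h by simp
    qed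
    ultimately show "\<exists>v\<in>stab n. close l (conjugate v (conjugate h f)) g" by metis
  qed
  then show "\<exists>m. dense_at n m (conjugate h f)" by blast
qed

text \<open>A stage of the back-and-forth construction.  In \<open>(f, p, g, q, i, m)\<close> the two maps have been moved
to \<open>conjugate p f\<close> and \<open>conjugate q g\<close>, which are \<open>m\<close>-close; the second map is the next to be moved,
by an element of \<open>stab i\<close>, into a smaller neighbourhood of the first.\<close>

type_synonym 'b bf_state = "('b \<Rightarrow> 'b) \<times> ('b \<Rightarrow> 'b) \<times> ('b \<Rightarrow> 'b) \<times> ('b \<Rightarrow> 'b) \<times> nat \<times> nat"

definition bf_inv :: "'a bf_state \<Rightarrow> bool" where
  "bf_inv = (\<lambda>(f, p, g, q, i, m). generic f \<and> generic g \<and> p \<in> homeos \<and> q \<in> homeos \<and>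
      close m (conjugate p f) (conjugate q g) \<and> dense_at i m (conjugate q g))"

text \<open>After a step the maps exchange their roles.  The new level \<open>i'\<close> governs the next move of \<open>f\<close> and is
therefore chosen fine with respect to its current mover \<open>p\<close>.  Moving both maps in turn is essential
here: with one map fixed, the level would have to be chosen before the mover is known.\<close>

definition bf_step :: "nat \<Rightarrow> 'a bf_state \<Rightarrow> 'a bf_state \<Rightarrow> bool" where
  "bf_step k = (\<lambda>(f, p, g, q, i, m) (f', p', g', q', i', m').
      f' = g \<and> g' = f \<and> q' = p \<and> (\<exists>v\<in>stab i. p' = v \<circ> q) \<and> i \<le> i' \<and> k \<le> i' \<and> k \<le> m' \<and>
      (\<forall>x\<in>M. \<forall>y\<in>M. code i' (p x) = code i' (p y) \<longrightarrow> code k x = code k y))"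

lemma bf_step_exists:
  assumes "bf_inv s"
  shows "\<exists>s'. bf_inv s' \<and> bf_step k s s'"
proof -
  obtain f p g q i m where s: "s = (f, p, g, q, i, m)" by (metis surj_pair)
  have f: "generic f" "generic g" "p \<in> homeos" "q \<in> homeos" "close m (conjugate p f) (conjugate q g)" "dense_at i m (conjugate q g)"
    using assms unfolding s bf_inv_def by auto
  have c: "f \<in> cmaps" "g \<in> cmaps" using f surjs_per_cmaps unfolding generic_def by auto
  obtain i0 where i0: "i0 \<ge> k" "\<And>x y. \<lbrakk>x \<in> M; y \<in> M; code i0 x = code i0 y\<rbrakk> \<Longrightarrow> code k (inv_into M p x) = code k (inv_into M p y)"
    using uniformly_continuous_code[OF homeos_cont[OF homeos_inv_into[OF f(3)]]] by blast
  define i' where "i' = max i i0"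
  have pf: "generic (conjugate p f)" using generic_conj f by blast
  then obtain m0 where "dense_at i' m0 (conjugate p f)" unfolding generic_def by blast
  then have m': "dense_at i' (max (max m m0) k) (conjugate p f)" by (rule dense_at_mono) simp
  obtain v where v: "v \<in> stab i" "close (max (max m m0) k) (conjugate v (conjugate q g)) (conjugate p f)"
    using f(6) pf close_sym[OF f(5)] unfolding dense_at_def generic_def by blast
  have vH: "v \<in> homeos" using v stab_homeos by blast
  have "conjugate (v \<circ> q) g = conjugate v (conjugate q g)" using conj_comp[OF vH f(4) c(2)] .
  then have "bf_inv (g, v \<circ> q, f, p, i', max (max m m0) k)"
    using f v m' vH by (simp add: bf_inv_def homeos_comp)
  moreover have "bf_step k s (g, v \<circ> q, f, p, i', max (max m m0) k)"
    unfolding s bf_step_def prod.case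
  proof (intro conjI ballI impI)
    show "code k x = code k y" if "x \<in> M" "y \<in> M" "code i' (p x) = code i' (p y)" for x y
    proof -
      have "code i0 (p x) = code i0 (p y)" using that(3) by (rule code_mono) (simp add: i'_def)
      then show ?thesis using i0(2)[of "p x" "p y"] that f(3) by (simp add: homeos_in)
    qed
  qed (use v i0 in \<open>auto simp: i'_def\<close>)
  ultimately show ?thesis by blast
qed

text \<open>The movers of each of the two maps converge to homeomorphisms, and the moved maps get arbitrarily
close to each other, so the two limit conjugates coincide.\<close>

lemma generic_conjugate:
  assumes f: "generic f" and g: "generic g"
  obtains h where "h \<in> homeos" "conjugate h f = g"
proof -
  have c: "f \<in> cmaps" "g \<in> cmaps" using f g surjs_per_cmaps unfolding generic_def by auto
  define s0 where "s0 = (f, (\<lambda>x::'a. x), g, (\<lambda>x::'a. x), 0::nat, 0::nat)"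
  have s0: "bf_inv s0" using f g c by (simp add: s0_def bf_inv_def homeos_id conj_id generic_def)
  have "\<exists>S. \<forall>n. (bf_inv (S n) \<and> (n = 0 \<longrightarrow> S n = s0)) \<and> bf_step n (S n) (S (Suc n))"
  proof (rule dependent_nat_choice)
    show "\<exists>s. bf_inv s \<and> (0 = (0::nat) \<longrightarrow> s = s0)" using s0 by blast
    show "\<exists>s'. (bf_inv s' \<and> (Suc n = 0 \<longrightarrow> s' = s0)) \<and> bf_step n s s'"
      if "bf_inv s \<and> (n = 0 \<longrightarrow> s = s0)" for s n
      using bf_step_exists[of s n] that by blast
  qed
  then obtain S where S: "\<And>n. bf_inv (S n)" "S 0 = s0" "\<And>n. bf_step n (S n) (S (Suc n))" by blast
  define F where "F = (\<lambda>n. fst (S n))"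
  define P where "P = (\<lambda>n. fst (snd (S n)))"
  define G where "G = (\<lambda>n. fst (snd (snd (S n))))"
  define Q where "Q = (\<lambda>n. fst (snd (snd (snd (S n)))))"
  define I where "I = (\<lambda>n. fst (snd (snd (snd (snd (S n))))))"
  define m where "m = (\<lambda>n. snd (snd (snd (snd (snd (S n))))))"
  have Sn: "S n = (F n, P n, G n, Q n, I n, m n)" for n
    by (simp add: F_def P_def G_def Q_def I_def m_def)
  have step: "F (Suc n) = G n" "G (Suc n) = F n" "Q (Suc n) = P n" "\<exists>v\<in>stab (I n). P (Suc n) = v \<circ> Q n"
    "I n \<le> I (Suc n)" "n \<le> I (Suc n)" "n \<le> m (Suc n)"
    "\<And>x y. \<lbrakk>x \<in> M; y \<in> M; code (I (Suc n)) (P n x) = code (I (Suc n)) (P n y)\<rbrakk> \<Longrightarrow> code n x = code n y" for n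
    by (use S(3)[of n, unfolded Sn bf_step_def prod.case] in blast)+
  have inv: "P n \<in> homeos" "close (m n) (conjugate (P n) (F n)) (conjugate (Q n) (G n))" for n
    by (use S(1)[of n, unfolded Sn bf_inv_def prod.case] in blast)+
  have FG: "F (2 * k) = f \<and> G (2 * k) = g" for k
  proof (induction k)
    case 0
    show ?case using S(2) by (simp add: F_def G_def s0_def)
  next
    case (Suc k)
    have "F (2 * Suc k) = F (2 * k)" "G (2 * Suc k) = G (2 * k)"
      using step(1,2)[of "2 * k"] step(1,2)[of "Suc (2 * k)"] by simp_all
    then show ?case using Suc by simp
  qed
  have PP: "code (I (Suc n)) (P (Suc (Suc n)) x) = code (I (Suc n)) (P n x)" if "x \<in> M" for n x
  proof -
    obtain v where "v \<in> stab (I (Suc n))" "P (Suc (Suc n)) = v \<circ> Q (Suc n)" using step(4) by blast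
    then show ?thesis using homeos_in[OF inv(1)[of n] that] by (simp add: step(3) stab_def)
  qed
  have II: "I n \<le> I (n + d)" for n d
  proof (induction d)
    case (Suc d)
    then show ?case using step(5)[of "n + d"] by simp
  qed simp
  \<comment> \<open>The stages of even number \<open>(c = 0)\<close> list the movers of \<open>f\<close>, those of odd number \<open>(c = 1)\<close> the movers
    of \<open>g\<close>.\<close>
  have limits: "\<exists>h. h \<in> homeos \<and> (\<forall>f l. f \<in> cmaps \<longrightarrow> (\<exists>k0. \<forall>k\<ge>k0. close l (conjugate (P (2 * k + c)) f) (conjugate h f)))"
    for c
  proof -
    have *: "code k x = code k y" if "x \<in> M" "y \<in> M"
      "code (I (Suc (2 * k + c))) (P (2 * k + c) x) = code (I (Suc (2 * k + c))) (P (2 * k + c) y)" for k x y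
      using code_mono[OF step(8)[OF that], of k] by simp
    obtain h where "h \<in> homeos" "\<And>f l. f \<in> cmaps \<Longrightarrow> \<exists>k0. \<forall>k\<ge>k0. close l (conjugate (P (2 * k + c)) f) (conjugate h f)"
    proof (rule limit_homeomorphism[of "\<lambda>k. P (2 * k + c)" "\<lambda>k. I (Suc (2 * k + c))"])
      show "k \<le> I (Suc (2 * k + c))" for k using step(6)[of "2 * k + c"] by simp
      show "I (Suc (2 * k + c)) \<le> I (Suc (2 * Suc k + c))" for k
        using II[of "Suc (2 * k + c)" 2] by simp
      show "code (I (Suc (2 * k + c))) (P (2 * Suc k + c) x) = code (I (Suc (2 * k + c))) (P (2 * k + c) x)"
        if "x \<in> M" for k x
        using PP[OF that, of "2 * k + c"] by simp
    qed (use inv * in blast)+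
    then show ?thesis by blast
  qed
  obtain h where h: "h \<in> homeos" "\<And>f l. f \<in> cmaps \<Longrightarrow> \<exists>k0. \<forall>k\<ge>k0. close l (conjugate (P (2 * k)) f) (conjugate h f)"
    using limits[of 0] by auto
  obtain h' where h': "h' \<in> homeos" "\<And>f l. f \<in> cmaps \<Longrightarrow> \<exists>k0. \<forall>k\<ge>k0. close l (conjugate (P (2 * k + 1)) f) (conjugate h' f)"
    using limits[of 1] by blast
  have "conjugate h f = conjugate h' g"
  proof (rule close_all_imp_eq)
    fix l
    obtain k0 where k0: "\<And>k. k \<ge> k0 \<Longrightarrow> close l (conjugate (P (2 * k)) f) (conjugate h f)" using h(2)[OF c(1)] by blast
    obtain k1 where k1: "\<And>k. k \<ge> k1 \<Longrightarrow> close l (conjugate (P (2 * k + 1)) g) (conjugate h' g)" using h'(2)[OF c(2)] by blast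
    define k where "k = max l (max k0 k1)"
    have "close (m (Suc (2 * k))) (conjugate (P (2 * k + 1)) g) (conjugate (P (2 * k)) f)"
      using inv(2)[of "Suc (2 * k)"] step(1,2,3)[of "2 * k"] FG[of k] by simp
    moreover have "l \<le> m (Suc (2 * k))" using step(7)[of "2 * k"] by (simp add: k_def)
    ultimately have "close l (conjugate (P (2 * k + 1)) g) (conjugate (P (2 * k)) f)" by (rule close_mono)
    moreover have "close l (conjugate (P (2 * k)) f) (conjugate h f)" using k0 by (simp add: k_def)
    moreover have "close l (conjugate (P (2 * k + 1)) g) (conjugate h' g)" using k1 by (simp add: k_def)
    ultimately show "close l (conjugate h f) (conjugate h' g)" by (meson close_sym close_trans)
  qed (use c h(1) h'(1) conj_cmaps in auto)
  then have "conjugate (inv_into M h' \<circ> h) f = g"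
    using conj_comp[OF homeos_inv_into[OF h'(1)] h(1) c(1)] conj_inv[OF h'(1) c(2)] by simp
  then show thesis using that homeos_comp[OF homeos_inv_into[OF h'(1)] h(1)] by blast
qed

text \<open>Any two maps in \<open>K\<close> are approximated by members of one dense conjugacy class.\<close>

lemma amalgamating_0: "amalgamating 0 0 f"
  unfolding amalgamating_def stab_0
proof (intro ballI impI allI)
  fix g1 g2 l assume g: "g1 \<in> surjs_per {1}" "g2 \<in> surjs_per {1}"
  obtain e where e: "e \<in> surjs_per {1}" "\<And>f n. f \<in> surjs_per {1} \<Longrightarrow> \<exists>h\<in>homeos. close n (conjugate h e) f"
    using surjs_per_dense_class[of "{1}"] by blast
  obtain h where h: "h \<in> homeos" "close l (conjugate h e) g1" using e g by blast
  obtain k where k: "k \<in> homeos" "close l (conjugate k e) g2" using e g by blast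
  have ec: "e \<in> cmaps" using e surjs_per_cmaps by blast
  have "conjugate (k \<circ> inv_into M h) (conjugate h e) = conjugate k e"
    using conj_comp[OF k(1) homeos_inv_into[OF h(1)] conj_cmaps[OF h(1) ec]] conj_inv[OF h(1) ec] by simp
  then show "\<exists>g\<in>surjs_per {1}. \<exists>v\<in>homeos. close l g g1 \<and> close l (conjugate v g) g2"
    using conj_surjs_per[OF h(1) e(1)] homeos_comp[OF k(1) homeos_inv_into[OF h(1)]] h(2) k(2) by metis
qed

lemma amalgamating_close: "\<lbrakk>amalgamating n m f; close m f f'\<rbrakk> \<Longrightarrow> amalgamating n m f'"
  unfolding amalgamating_def using close_trans by blast

text \<open>Openness and density relative to \<open>K\<close>, expressed through codes; on sets of continuous maps they agree
with the notions for the sup metric.\<close>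

definition code_open :: "('a \<Rightarrow> 'a) set \<Rightarrow> ('a \<Rightarrow> 'a) set \<Rightarrow> bool" where
  "code_open K U \<longleftrightarrow> U \<subseteq> K \<and> (\<forall>f\<in>U. \<exists>n. \<forall>g\<in>K. close n f g \<longrightarrow> g \<in> U)"

definition code_dense :: "('a \<Rightarrow> 'a) set \<Rightarrow> ('a \<Rightarrow> 'a) set \<Rightarrow> bool" where
  "code_dense K U \<longleftrightarrow> (\<forall>f\<in>K. \<forall>n. \<exists>g\<in>U. close n f g)"

text \<open>Density of the orbit of \<open>e\<close> under \<open>stab n\<close> near \<open>e\<close> is a union of \<open>G\<^sub>\<delta>\<close> conditions when the neighbourhood
is left free.  Restricting to neighbourhoods of amalgamating maps removes the union: near such a
map one may ask, for each target \<open>g\<close>, that either \<open>e\<close> lies outside the neighbourhood or its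
orbit comes close to \<open>g\<close>.  Each of these conditions is open and, by the amalgamating property, dense;
a generic map satisfies all of them because the closure of its orbit under the group \<open>stab n\<close> is
invariant.  Neighbourhoods and targets range over a countable dense set of maps.\<close>

lemma generic_countable_intersection:
  obtains \<D> where "countable \<D>" "\<D> \<noteq> {}" "\<And>D. D \<in> \<D> \<Longrightarrow> code_open (surjs_per {1}) D"
    "\<And>D. D \<in> \<D> \<Longrightarrow> code_dense (surjs_per {1}) D" "\<Inter>\<D> = {f. generic f}"
proof -
  let ?K = "surjs_per {1}"
  have Kc: "?K \<subseteq> cmaps" using surjs_per_cmaps by blast
  obtain F where F: "countable F" "F \<subseteq> ?K" "\<And>f n. f \<in> ?K \<Longrightarrow> \<exists>g\<in>F. close n f g"
    using countable_dense[OF Kc] by blast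
  define D1 where "D1 = (\<lambda>n. {f \<in> ?K. \<exists>m. amalgamating n m f})"
  define D2 where "D2 = (\<lambda>(n, m, l, f, g). {e \<in> ?K. close m f e \<longrightarrow> (\<exists>v\<in>stab n. close l (conjugate v e) g)})"
  define J where "J = {(n::nat, m::nat, l::nat, f, g). f \<in> F \<and> g \<in> F \<and> amalgamating n m f \<and> close m f g}"
  define \<D> where "\<D> = range D1 \<union> D2 ` J"
  have "J \<subseteq> UNIV \<times> UNIV \<times> UNIV \<times> F \<times> F" by (auto simp: J_def)
  then have "countable J" by (rule countable_subset) (intro countable_SIGMA F(1), auto)
  then have "countable \<D>" by (simp add: \<D>_def)
  moreover have "\<D> \<noteq> {}" by (simp add: \<D>_def)
  moreover have "code_open ?K D" if "D \<in> \<D>" for D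
  proof -
    consider n where "D = D1 n" | n m l f g where "D = D2 (n, m, l, f, g)"
      using \<open>D \<in> \<D>\<close> by (auto simp: \<D>_def)
    then show ?thesis
    proof cases
      case 1
      then show ?thesis unfolding code_open_def D1_def using amalgamating_close by blast
    next
      case 2
      have "\<exists>n. \<forall>e'\<in>?K. close n e e' \<longrightarrow> e' \<in> D" if e: "e \<in> D" for e
      proof (cases "close m f e")
        case False
        then have "e' \<in> D" if "e' \<in> ?K" "close m e e'" for e'
          using that close_trans close_sym unfolding 2 D2_def by blast
        then show ?thesis by blast
      next
        case True
        then obtain v where v: "v \<in> stab n" "close l (conjugate v e) g" using e by (auto simp: 2 D2_def)
        obtain q where q: "\<And>f g. \<lbrakk>f \<in> cmaps; g \<in> cmaps; close q f g\<rbrakk> \<Longrightarrow> close l (conjugate v f) (conjugate v g)"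
          using conj_uniform[OF stab_homeos[OF v(1)]] by blast
        have "e' \<in> D" if e': "e' \<in> ?K" "close q e e'" for e'
        proof -
          have "close l (conjugate v e) (conjugate v e')" using q[of e e'] e e' Kc by (auto simp: 2 D2_def)
          then have "close l (conjugate v e') g" using v close_trans close_sym by blast
          then show ?thesis using e' v by (auto simp: 2 D2_def)
        qed
        then show ?thesis by blast
      qed
      then show ?thesis by (auto simp: code_open_def 2 D2_def)
    qed
  qed
  moreover have "code_dense ?K D" if "D \<in> \<D>" for D
  proof -
    consider n where "D = D1 n" | n m l f g where "(n, m, l, f, g) \<in> J" "D = D2 (n, m, l, f, g)"
      using \<open>D \<in> \<D>\<close> by (auto simp: \<D>_def)
    then show ?thesis
    proof cases
      case 1
      show ?thesis unfolding code_dense_def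
      proof (intro ballI allI)
        fix f j assume "f \<in> ?K"
        then obtain f' m where "f' \<in> ?K" "close j f f'" "amalgamating n m f'" by (rule amalgamating_dense)
        then show "\<exists>g\<in>D. close j f g" unfolding 1 D1_def by blast
      qed
    next
      case 2
      have J: "f \<in> ?K" "g \<in> ?K" "amalgamating n m f" "close m f g" using 2(1) F(2) by (auto simp: J_def)
      show ?thesis unfolding code_dense_def
      proof (intro ballI allI)
        fix e j assume e: "e \<in> ?K"
        show "\<exists>e'\<in>D. close j e e'"
        proof (cases "close m f e")
          case False
          then show ?thesis using e by (intro bexI[of _ e]) (auto simp: 2 D2_def)
        next
          case True
          then obtain e' v where e': "e' \<in> ?K" "v \<in> stab n" "close (max j l) e' e" "close (max j l) (conjugate v e') g"
            using J e unfolding amalgamating_def by meson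
          have "close j e e'" "close l (conjugate v e') g"
            using close_mono[OF e'(3), of j] close_mono[OF e'(4), of l] close_sym by auto
          then show ?thesis using e' by (intro bexI[of _ e']) (auto simp: 2 D2_def)
        qed
      qed
    qed
  qed
  moreover have "\<Inter>\<D> = {f. generic f}"
  proof (intro equalityI subsetI)
    fix e assume e: "e \<in> \<Inter>\<D>"
    then have "e \<in> D1 0" by (simp add: \<D>_def)
    then have eK: "e \<in> ?K" by (simp add: D1_def)
    have da: "dense_at n m e" if gd: "amalgamating n m e" for n m
      unfolding dense_at_def
    proof (intro ballI impI allI)
      fix g l assume g: "g \<in> ?K" "close m e g"
      obtain f' where f': "f' \<in> F" "close m e f'" using F(3)[OF eK] by blast
      obtain g' where g': "g' \<in> F" "close (max l m) g g'" using F(3)[OF g(1)] by blast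
      have "close m g g'" "close l g g'" using close_mono[OF g'(2)] by auto
      then have "(n, m, max l m, f', g') \<in> J"
        using f' g' amalgamating_close[OF gd f'(2)] close_trans[OF close_trans[OF close_sym[OF f'(2)] g(2)]]
        unfolding J_def by blast
      then have "e \<in> D2 (n, m, max l m, f', g')" using e by (auto simp: \<D>_def)
      then obtain v where "v \<in> stab n" "close (max l m) (conjugate v e) g'"
        using f' close_sym unfolding D2_def by auto
      then show "\<exists>v\<in>stab n. close l (conjugate v e) g"
        using \<open>close l g g'\<close> close_sym close_trans close_mono max.cobounded1 by meson
    qed
    have "e \<in> D1 n" for n using e by (auto simp: \<D>_def)
    then have "\<exists>m. dense_at n m e" for n unfolding D1_def using da by blast
    then show "e \<in> {f. generic f}" using eK da amalgamating_0 by (simp add: generic_def)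
  next
    fix e assume "e \<in> {f. generic f}"
    then have e: "e \<in> ?K" "\<And>n. \<exists>m. dense_at n m e" by (auto simp: generic_def)
    have ec: "e \<in> cmaps" using e Kc by blast
    have "e \<in> D1 n" for n
    proof -
      obtain m where m: "dense_at n m e" using e by blast
      have "amalgamating n m e" unfolding amalgamating_def
      proof (intro ballI impI allI)
        fix g1 g2 l assume g: "g1 \<in> ?K" "g2 \<in> ?K" "close m e g1" "close m e g2"
        obtain u where u: "u \<in> stab n" "close l (conjugate u e) g1" using m g unfolding dense_at_def by blast
        obtain w where w: "w \<in> stab n" "close l (conjugate w e) g2" using m g unfolding dense_at_def by blast
        have uw: "u \<in> homeos" "w \<in> homeos" using u w stab_homeos by auto
        have "conjugate (w \<circ> inv_into M u) (conjugate u e) = conjugate w e"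
          using conj_comp[OF uw(2) homeos_inv_into[OF uw(1)] conj_cmaps[OF uw(1) ec]] conj_inv[OF uw(1) ec] by simp
        then show "\<exists>g\<in>?K. \<exists>v\<in>stab n. close l g g1 \<and> close l (conjugate v g) g2"
          using conj_surjs_per[OF uw(1) e(1)] stab_comp[OF w(1) stab_inv[OF u(1)]] u(2) w(2) by metis
      qed
      then show ?thesis using e by (auto simp: D1_def)
    qed
    moreover have "e \<in> D2 (n, m, l, f, g)" if J: "(n, m, l, f, g) \<in> J" for n m l f g
    proof -
      have fg: "f \<in> ?K" "g \<in> ?K" "amalgamating n m f" "close m f g" using J F(2) by (auto simp: J_def)
      have "\<exists>v\<in>stab n. close l (conjugate v e) g" if cl: "close m f e"
      proof -
        obtain m0 where m0: "dense_at n m0 e" using e by blast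
        obtain e' v where e': "e' \<in> ?K" "v \<in> stab n" "close (max l m0) e' e" "close (max l m0) (conjugate v e') g"
          using fg e(1) cl unfolding amalgamating_def by meson
        have vH: "v \<in> homeos" using e' stab_homeos by blast
        obtain q where q: "\<And>f g. \<lbrakk>f \<in> cmaps; g \<in> cmaps; close q f g\<rbrakk> \<Longrightarrow> close l (conjugate v f) (conjugate v g)"
          using conj_uniform[OF vH] by blast
        have "close m0 e e'" using close_mono[OF e'(3), of m0] close_sym by simp
        then obtain u where u: "u \<in> stab n" "close q (conjugate u e) e'"
          using m0 e'(1) unfolding dense_at_def by blast
        have uH: "u \<in> homeos" using u stab_homeos by blast
        have "close l (conjugate v (conjugate u e)) (conjugate v e')"
          by (rule q[OF conj_cmaps[OF uH ec] _ u(2)]) (use e' Kc in blast)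
        moreover have "close l (conjugate v e') g" using close_mono[OF e'(4)] by simp
        moreover have "conjugate (v \<circ> u) e = conjugate v (conjugate u e)" by (rule conj_comp[OF vH uH ec])
        ultimately show ?thesis using stab_comp[OF e'(2) u(1)] close_trans by metis
      qed
      then show ?thesis using e by (simp add: D2_def)
    qed
    ultimately show "e \<in> \<Inter>\<D>" by (auto simp: \<D>_def)
  qed
  ultimately show thesis using that by blast
qed

end

section \<open>The sup metric and the main theorem\<close>

text \<open>For every \<open>n\<close>, finitely many clopen sets of diameter at most \<open>2 / (n + 1)\<close> cover the space;
together they separate points.\<close>

lemma cantor_space_imp_cantor_like:
  assumes X: "cantor_space X"
  shows "cantor_like (mtopology_of X)"
proof -
  let ?T = "mtopology_of X"
  interpret Metric_space "mspace X" "mdist X" by (rule Metric_space_mspace_mdist)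
  have T: "?T = mtopology" by (simp add: mtopology_of_def)
  have comp: "compact_space ?T" and base: "neighbourhood_base_of (\<lambda>U. closedin ?T U \<and> openin ?T U) ?T"
    using X by (auto simp: cantor_space_def dimension_le_0_neighbourhood_base_of_clopen)
  have "\<exists>\<F>. finite \<F> \<and> (\<forall>U\<in>\<F>. openin ?T U \<and> closedin ?T U \<and> (\<exists>z. U \<subseteq> mball z r)) \<and> mspace X \<subseteq> \<Union>\<F>"
    if r: "r > 0" for r
  proof -
    let ?\<U> = "{U. openin ?T U \<and> closedin ?T U \<and> (\<exists>z. U \<subseteq> mball z r)}"
    have "\<exists>U\<in>?\<U>. x \<in> U" if x: "x \<in> mspace X" for x
    proof -
      have "openin ?T (mball x r)" "x \<in> mball x r" using x r by (auto simp: T)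
      then obtain V where "openin ?T V \<and> closedin ?T V" "x \<in> V" "V \<subseteq> mball x r"
        using base unfolding neighbourhood_base_of by (metis subsetD)
      then show ?thesis by blast
    qed
    then have "topspace ?T \<subseteq> \<Union>?\<U>" by auto
    then obtain \<F> where "finite \<F>" "\<F> \<subseteq> ?\<U>" "topspace ?T \<subseteq> \<Union>\<F>"
      using comp unfolding compact_space_alt by (metis (no_types, lifting) mem_Collect_eq)
    then show ?thesis by (intro exI[of _ \<F>]) auto
  qed
  then have "\<exists>\<F>. finite \<F> \<and> (\<forall>U\<in>\<F>. openin ?T U \<and> closedin ?T U \<and> (\<exists>z. U \<subseteq> mball z (inverse (Suc n)))) \<and> mspace X \<subseteq> \<Union>\<F>"
    for n by simp
  then obtain \<F> where \<F>: "\<And>n. finite (\<F> n)" 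
    "\<And>n U. U \<in> \<F> n \<Longrightarrow> openin ?T U \<and> closedin ?T U \<and> (\<exists>z. U \<subseteq> mball z (inverse (Suc n)))"
    "\<And>n. mspace X \<subseteq> \<Union>(\<F> n)" by metis
  have "zero_dim_compact ?T"
  proof (rule zero_dim_compactI[OF comp, of "\<Union>n. \<F> n"])
    show "countable (\<Union>n. \<F> n)" using \<F>(1) by (intro countable_UN) (auto intro: countable_finite)
    fix x y assume xy: "x \<in> topspace ?T" "y \<in> topspace ?T" "x \<noteq> y"
    then have "mdist X x y / 2 > 0" using mdist_pos_less[of x y] by simp
    then obtain n where n: "inverse (real (Suc n)) < mdist X x y / 2" using reals_Archimedean by blast
    obtain U where U: "U \<in> \<F> n" "x \<in> U" using \<F>(3)[of n] xy by auto
    obtain z where z: "U \<subseteq> mball z (inverse (Suc n))" using \<F>(2)[OF U(1)] by blast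
    have "y \<notin> U"
    proof
      assume "y \<in> U"
      then have "mdist X z x < inverse (Suc n)" "mdist X z y < inverse (Suc n)" "z \<in> mspace X"
        using z U(2) by auto
      then show False using n triangle[of x z y] xy commute[of x z] by auto
    qed
    then show "\<exists>C\<in>\<Union>n. \<F> n. (x \<in> C) \<noteq> (y \<in> C)" using U by blast
  qed (use \<F>(2) in auto)
  moreover have "\<not> openin ?T {x}" for x
  proof
    assume op: "openin ?T {x}"
    then have "x \<in> ?T derived_set_of mspace X" using X openin_subset[OF op] by (simp add: cantor_space_def)
    then show False using op unfolding in_derived_set_of by blast
  qed
  ultimately show ?thesis using X by (simp add: cantor_like_def cantor_space_def)
qed

locale coded_metric_cantor = coded_cantor "mtopology_of X" C for X :: "'a metric" and C
begin

text \<open>The cells of the \<open>n\<close>-codes on which some two points are at distance at least \<open>r\<close> form a decreasing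
sequence of closed sets.  A common point would have, in each of its cells, points outside a fixed
ball around it, against compactness.\<close>

lemma code_fine:
  assumes r: "r > 0"
  obtains n where "\<And>x y. \<lbrakk>x \<in> mspace X; y \<in> mspace X; code n x = code n y\<rbrakk> \<Longrightarrow> mdist X x y < r"
proof -
  interpret Metric_space "mspace X" "mdist X" by (rule Metric_space_mspace_mdist)
  define A where "A = (\<lambda>n. {x \<in> M. \<exists>y\<in>M. \<exists>z\<in>M. code n y = code n x \<and> code n z = code n x \<and> mdist X y z \<ge> r})"
  have "\<exists>n. A n = {}"
  proof (rule ccontr)
    assume ne: "\<nexists>n. A n = {}"
    have "closedin (mtopology_of X) (A n)" for n
      using locally_constant_clopen(2)[OF locally_constant_code,
          of "\<lambda>u. \<exists>y\<in>M. \<exists>z\<in>M. code n y = u \<and> code n z = u \<and> mdist X y z \<ge> r" n] by (simp add: A_def)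
    moreover have "A (Suc n) \<subseteq> A n" for n
    proof
      fix x assume "x \<in> A (Suc n)"
      then obtain y z where yz: "x \<in> M" "y \<in> M" "z \<in> M" "code (Suc n) y = code (Suc n) x"
        "code (Suc n) z = code (Suc n) x" "mdist X y z \<ge> r" unfolding A_def by blast
      have "code n y = code n x" "code n z = code n x"
        using code_mono[OF yz(4), of n] code_mono[OF yz(5), of n] by simp_all
      then show "x \<in> A n" using yz unfolding A_def by blast
    qed
    ultimately obtain x where x: "\<And>n. x \<in> A n" using nested_nonempty[of A] ne by blast
    then have xM: "x \<in> M" by (auto simp: A_def)
    define F where "F = (\<lambda>n. {y \<in> M - mball x (r / 2). code n y = code n x})"
    have "closedin (mtopology_of X) (F n)" for n
    proof -
      have "closedin (mtopology_of X) (M - mball x (r / 2))"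
        by (intro closedin_diff) (auto simp: mtopology_of_def)
      then have "closedin (mtopology_of X) ((M - mball x (r / 2)) \<inter> {y \<in> M. code n y = code n x})"
        by (rule closedin_Int) (rule locally_constant_clopen(2)[OF locally_constant_code])
      also have "(M - mball x (r / 2)) \<inter> {y \<in> M. code n y = code n x} = F n" by (auto simp: F_def)
      finally show ?thesis .
    qed
    moreover have "F n \<noteq> {}" for n
    proof
      assume "F n = {}"
      then have b: "y \<in> mball x (r / 2)" if "y \<in> M" "code n y = code n x" for y
        using that by (auto simp: F_def)
      obtain y z where yz: "y \<in> M" "z \<in> M" "code n y = code n x" "code n z = code n x" "mdist X y z \<ge> r"
        using x[of n] by (auto simp: A_def)
      have "mdist X x y < r / 2" "mdist X x z < r / 2" using b[OF yz(1,3)] b[OF yz(2,4)] by auto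
      then show False using triangle[of y x z] yz xM commute[of x y] by auto
    qed
    moreover have "F (Suc n) \<subseteq> F n" for n by (auto simp: F_def intro: code_mono)
    ultimately obtain y where y: "\<And>n. y \<in> F n" by (rule nested_nonempty) blast+
    have "y = x" by (rule code_separates) (use y xM in \<open>auto simp: F_def\<close>)
    then show False using y[of 0] xM r by (auto simp: F_def)
  qed
  then obtain n where n: "A n = {}" ..
  show thesis
  proof (rule that[of n], rule ccontr)
    fix x y assume xy: "x \<in> mspace X" "y \<in> mspace X" "code n x = code n y" "\<not> mdist X x y < r"
    have "x \<in> A n"
      unfolding A_def
      by (intro CollectI conjI bexI[of _ x] bexI[of _ y]) (use xy in auto)
    then show False using n by simp
  qed
qed

text \<open>The cells of the \<open>n\<close>-codes are an open cover; \<open>r\<close> is a Lebesgue number.\<close>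

lemma code_coarse:
  obtains r where "r > 0" "\<And>x y. \<lbrakk>x \<in> mspace X; y \<in> mspace X; mdist X x y < r\<rbrakk> \<Longrightarrow> code n x = code n y"
proof -
  interpret Metric_space "mspace X" "mdist X" by (rule Metric_space_mspace_mdist)
  let ?\<C> = "(\<lambda>u. {x \<in> M. code n x = u}) ` UNIV"
  have "\<exists>r>0. \<forall>x\<in>mspace X. \<exists>U\<in>?\<C>. mball x r \<subseteq> U"
  proof (rule lebesgue_number)
    show "compactin mtopology (mspace X)"
      using compact_T by (simp add: compact_space_def mtopology_of_def)
    show "openin mtopology U" if "U \<in> ?\<C>" for U
      using that locally_constant_clopen(1)[OF locally_constant_code] by (auto simp: mtopology_of_def)
  qed auto
  then obtain r where r: "r > 0" "\<forall>x\<in>mspace X. \<exists>U\<in>?\<C>. mball x r \<subseteq> U" by blast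
  show thesis
  proof (rule that[OF r(1)])
    fix x y assume xy: "x \<in> mspace X" "y \<in> mspace X" "mdist X x y < r"
    obtain u where u: "mball x r \<subseteq> {x \<in> M. code n x = u}" using r(2) xy(1) by blast
    have "x \<in> mball x r" "y \<in> mball x r" using xy r(1) by auto
    then show "code n x = code n y" using u by blast
  qed
qed

lemma mspace_cfunspace_eq: "mspace (cfunspace (mtopology_of X) X) = cmaps"
  using compactin_mspace_cfunspace[of "mtopology_of X" X] compact_T
  by (auto simp: compact_space_def cmaps_def Pi_iff dest: continuous_map_funspace)

lemma close_imp_mdist:
  assumes r: "r > 0"
  obtains n where "\<And>f g. \<lbrakk>f \<in> cmaps; g \<in> cmaps; close n f g\<rbrakk> \<Longrightarrow> mdist (cfunspace (mtopology_of X) X) f g < r"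
proof -
  obtain n where n: "\<And>x y. \<lbrakk>x \<in> mspace X; y \<in> mspace X; code n x = code n y\<rbrakk> \<Longrightarrow> mdist X x y < r / 2"
    using code_fine[of "r / 2"] r by auto
  show thesis
  proof (rule that[of n])
    fix f g assume fg: "f \<in> cmaps" "g \<in> cmaps" "close n f g"
    have "mdist X (f x) (g x) \<le> r / 2" if "x \<in> topspace (mtopology_of X)" for x
      using n[of "f x" "g x"] cmaps_in[OF fg(1) that] cmaps_in[OF fg(2) that] fg(3) that
      by (simp add: close_def)
    then have "mdist (cfunspace (mtopology_of X) X) f g \<le> r / 2"
      using r by (intro mdist_cfunspace_le) auto
    then show "mdist (cfunspace (mtopology_of X) X) f g < r" using r by simp
  qed
qed

lemma mdist_imp_close:
  obtains r where "r > 0"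
    "\<And>f g. \<lbrakk>f \<in> cmaps; g \<in> cmaps; mdist (cfunspace (mtopology_of X) X) f g < r\<rbrakk> \<Longrightarrow> close n f g"
proof -
  obtain r where r: "r > 0" "\<And>x y. \<lbrakk>x \<in> mspace X; y \<in> mspace X; mdist X x y < r\<rbrakk> \<Longrightarrow> code n x = code n y"
    using code_coarse by blast
  show thesis
  proof (rule that[OF r(1)])
    fix f g assume fg: "f \<in> cmaps" "g \<in> cmaps" "mdist (cfunspace (mtopology_of X) X) f g < r"
    have "mdist X (f x) (g x) < r" if "x \<in> M" for x
      using mdist_cfunspace_imp_mdist_le[of f "mtopology_of X" X g _ x] fg that
      unfolding mspace_cfunspace_eq by (meson le_less_trans order_refl)
    then show "close n f g" using r(2) cmaps_in[OF fg(1)] cmaps_in[OF fg(2)] by (simp add: close_def)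
  qed
qed

definition map_topology :: "('a \<Rightarrow> 'a) set \<Rightarrow> ('a \<Rightarrow> 'a) topology" where
  "map_topology A = mtopology_of (submetric (cfunspace (mtopology_of X) X) A)"

lemma map_topology_subtopology: "subtopology (map_topology A) B = map_topology (A \<inter> B)"
  by (simp add: map_topology_def mtopology_of_submetric subtopology_subtopology)

lemma topspace_map_topology: "A \<subseteq> cmaps \<Longrightarrow> topspace (map_topology A) = A"
  by (auto simp: map_topology_def mspace_cfunspace_eq simp del: mspace_cfunspace)

lemma map_metric_space:
  assumes A: "A \<subseteq> cmaps"
  shows "Metric_space A (mdist (cfunspace (mtopology_of X) X))"
    and "Metric_space.mtopology A (mdist (cfunspace (mtopology_of X) X)) = map_topology A"
proof -
  let ?m = "submetric (cfunspace (mtopology_of X) X) A"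
  have ms: "mspace ?m = A" using A mspace_cfunspace_eq by auto
  have md: "mdist ?m = mdist (cfunspace (mtopology_of X) X)" by simp
  show "Metric_space A (mdist (cfunspace (mtopology_of X) X))"
    using Metric_space_mspace_mdist[of ?m] unfolding ms md .
  have mt: "mtopology_of m = Metric_space.mtopology (mspace m) (mdist m)" for m :: "('a \<Rightarrow> 'a) metric"
    by (simp add: mtopology_of_def)
  show "Metric_space.mtopology A (mdist (cfunspace (mtopology_of X) X)) = map_topology A"
    by (simp only: map_topology_def mt[of ?m] ms md)
qed

lemma openin_map_topology:
  assumes A: "A \<subseteq> cmaps"
  shows "openin (map_topology A) U \<longleftrightarrow> code_open A U"
proof -
  interpret F: Metric_space A "mdist (cfunspace (mtopology_of X) X)" by (rule map_metric_space[OF A])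
  have op: "openin (map_topology A) U \<longleftrightarrow> U \<subseteq> A \<and> (\<forall>f. f \<in> U \<longrightarrow> (\<exists>r>0. F.mball f r \<subseteq> U))"
    unfolding map_metric_space(2)[OF A, symmetric] by (rule F.openin_mtopology)
  show ?thesis
    unfolding op code_open_def
  proof (intro conj_cong refl iffI ballI allI impI)
    fix f assume U: "U \<subseteq> A" and f: "f \<in> U" and h: "\<forall>f. f \<in> U \<longrightarrow> (\<exists>r>0. F.mball f r \<subseteq> U)"
    then obtain r where r: "r > 0" "F.mball f r \<subseteq> U" by blast
    obtain n where "\<And>f g. \<lbrakk>f \<in> cmaps; g \<in> cmaps; close n f g\<rbrakk> \<Longrightarrow> mdist (cfunspace (mtopology_of X) X) f g < r"
      using close_imp_mdist[OF r(1)] by blast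
    then have "g \<in> F.mball f r" if "g \<in> A" "close n f g" for g
      using that U f A by (simp add: subset_iff)
    then have "\<forall>g\<in>A. close n f g \<longrightarrow> g \<in> U" using r(2) by blast
    then show "\<exists>n. \<forall>g\<in>A. close n f g \<longrightarrow> g \<in> U" ..
  next
    fix f assume U: "U \<subseteq> A" and h: "\<forall>f\<in>U. \<exists>n. \<forall>g\<in>A. close n f g \<longrightarrow> g \<in> U" and f: "f \<in> U"
    then obtain n where n: "\<forall>g\<in>A. close n f g \<longrightarrow> g \<in> U" by blast
    obtain r where "r > 0"
      "\<And>f g. \<lbrakk>f \<in> cmaps; g \<in> cmaps; mdist (cfunspace (mtopology_of X) X) f g < r\<rbrakk> \<Longrightarrow> close n f g"
      using mdist_imp_close[of n] by blast
    moreover have "f \<in> cmaps" using U f A by blast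
    ultimately have "g \<in> U" if "g \<in> F.mball f r" for g
      using n that A by (auto simp only: F.in_mball)
    then show "\<exists>r>0. F.mball f r \<subseteq> U" using \<open>r > 0\<close> by blast
  qed
qed

lemma closure_of_map_topology:
  assumes A: "A \<subseteq> cmaps" and B: "B \<subseteq> A"
  shows "map_topology A closure_of B = {f \<in> A. \<forall>n. \<exists>g\<in>B. close n f g}"
proof (intro equalityI subsetI)
  fix f assume f: "f \<in> map_topology A closure_of B"
  then have fA: "f \<in> A" using topspace_map_topology[OF A] in_closure_of by metis
  have "\<exists>g\<in>B. close n f g" for n
  proof -
    have "openin (map_topology A) {g \<in> A. close n f g}"
      unfolding openin_map_topology[OF A] code_open_def
    proof (intro conjI ballI)
      fix g assume g: "g \<in> {g \<in> A. close n f g}"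
      show "\<exists>m. \<forall>e\<in>A. close m g e \<longrightarrow> e \<in> {g \<in> A. close n f g}"
        using g close_trans by (intro exI[of _ n]) blast
    qed blast
    moreover have "f \<in> {g \<in> A. close n f g}" using fA by simp
    ultimately obtain g where "g \<in> B" "g \<in> {g \<in> A. close n f g}"
      using f unfolding in_closure_of by metis
    then show ?thesis by blast
  qed
  then show "f \<in> {f \<in> A. \<forall>n. \<exists>g\<in>B. close n f g}" using fA by blast
next
  fix f assume f: "f \<in> {f \<in> A. \<forall>n. \<exists>g\<in>B. close n f g}"
  have "\<exists>g. g \<in> B \<and> g \<in> U" if U: "f \<in> U" "openin (map_topology A) U" for U
  proof -
    obtain n where n: "\<forall>g\<in>A. close n f g \<longrightarrow> g \<in> U"
      using U unfolding openin_map_topology[OF A] code_open_def by blast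
    then show ?thesis using f B by blast
  qed
  then show "f \<in> map_topology A closure_of B"
    unfolding in_closure_of topspace_map_topology[OF A] using f by blast
qed

lemma closedin_map_topology:
  assumes A: "A \<subseteq> cmaps" and B: "B \<subseteq> A" 
    and lim: "\<And>f. \<lbrakk>f \<in> A; \<And>n. \<exists>g\<in>B. close n f g\<rbrakk> \<Longrightarrow> f \<in> B"
  shows "closedin (map_topology A) B"
proof -
  have "map_topology A closure_of B \<subseteq> B"
    unfolding closure_of_map_topology[OF A B] using lim by blast
  then show ?thesis
    using B topspace_map_topology[OF A] closure_of_subset_eq by metis
qed

lemma mtopology_cont_surj_space: "mtopology_of (cont_surj_space X) = map_topology surjs"
  and mspace_cont_surj_space: "mspace (cont_surj_space X) = surjs"
proof -
  have "{f. f ` mspace X = mspace X} \<inter> cmaps = surjs" by (auto simp: surjs_def)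
  then show ms: "mspace (cont_surj_space X) = surjs"
    unfolding cont_surj_space_def mspace_submetric mspace_cfunspace_eq .
  show "mtopology_of (cont_surj_space X) = map_topology surjs"
    unfolding map_topology_def cont_surj_space_def
    by (metis (no_types) cont_surj_space_def inf_commute ms mspace_submetric submetric_restrict)
qed

text \<open>The preimages of the \<open>n\<close>-cells of \<open>y\<close> under the limit map are nonempty and closed, and they decrease
to the fibre of \<open>y\<close>.\<close>

lemma surjs_closed:
  assumes f: "f \<in> cmaps" and lim: "\<And>n. \<exists>g\<in>surjs. close n f g"
  shows "f \<in> surjs"
proof -
  have "y \<in> f ` M" if y: "y \<in> M" for y
  proof -
    define F where "F = (\<lambda>n. {x \<in> M. code n (f x) = code n y})"
    have "closedin (mtopology_of X) (F n)" for n
      using locally_constant_clopen(2)[OF continuous_map_compose[OF _ locally_constant_code],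
          of "mtopology_of X" f "\<lambda>u. u = code n y" n] f
      by (simp add: F_def cmaps_def)
    moreover have "F n \<noteq> {}" for n
    proof -
      obtain g where g: "g \<in> surjs" "close n f g" using lim by blast
      obtain x where "x \<in> M" "g x = y" using y surjs_image[OF g(1)] by (metis imageE)
      then have "x \<in> F n" using g(2) by (auto simp: F_def close_def)
      then show ?thesis by blast
    qed
    moreover have "F (Suc n) \<subseteq> F n" for n by (auto simp: F_def intro: code_mono)
    ultimately obtain x where x: "\<And>n. x \<in> F n" by (rule nested_nonempty) blast+
    then have "f x = y" by (intro code_separates cmaps_in[OF f] y) (auto simp: F_def)
    then show ?thesis using x[of 0] by (auto simp: F_def)
  qed
  then show ?thesis using f cmaps_in[OF f] by (auto simp: surjs_def)
qed

text \<open>\<open>X\<close> is compact, hence complete, and completeness passes to spaces of continuous maps and to closed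
subspaces.\<close>

lemma mcomplete_map_space:
  assumes A: "A \<subseteq> cmaps" and clo: "closedin (map_topology cmaps) A"
  shows "mcomplete_of (submetric (cfunspace (mtopology_of X) X) A)"
proof -
  let ?c = "cfunspace (mtopology_of X) X"
  interpret Metric_space "mspace X" "mdist X" by (rule Metric_space_mspace_mdist)
  have "mcomplete" using compact_T by (intro compact_space_imp_mcomplete) (simp add: mtopology_of_def)
  moreover have "Self = X" unfolding Self_def by (simp add: dest_metric_inverse mdist_def mspace_def)
  ultimately have comp: "mcomplete_of ?c" using mcomplete_cfunspace[of "mtopology_of X"] by simp
  interpret F: Metric_space "mspace ?c" "mdist ?c" by (rule Metric_space_mspace_mdist)
  interpret S: Submetric "mspace ?c" "mdist ?c" A
    by unfold_locales (use A mspace_cfunspace_eq in simp)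
  have "map_topology cmaps = F.mtopology"
    unfolding mspace_cfunspace_eq by (rule map_metric_space(2)[OF order_refl, symmetric])
  then have "S.sub.mcomplete"
    using S.closedin_mcomplete_imp_mcomplete comp clo by (simp add: mcomplete_of_def)
  moreover have "mspace (submetric ?c A) = A" using A mspace_cfunspace_eq by auto
  ultimately show ?thesis by (simp add: mcomplete_of_def)
qed

lemma Baire_map_topology:
  assumes A: "A \<subseteq> cmaps" and clo: "closedin (map_topology cmaps) A" and ne: "A \<noteq> {}"
    and \<D>: "countable \<D>" "\<And>D. D \<in> \<D> \<Longrightarrow> code_open A D" "\<And>D. D \<in> \<D> \<Longrightarrow> code_dense A D"
  shows "\<Inter>\<D> \<inter> A \<noteq> {}"
proof -
  interpret F: Metric_space A "mdist (cfunspace (mtopology_of X) X)" by (rule map_metric_space[OF A])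
  have top: "F.mtopology = map_topology A" by (rule map_metric_space[OF A])
  have "map_topology A closure_of \<Inter>\<D> = A"
    unfolding top[symmetric]
  proof (rule F.metric_Baire_category[OF _ \<D>(1)])
    have "mspace (submetric (cfunspace (mtopology_of X) X) A) = A" using A mspace_cfunspace_eq by auto
    then show "F.mcomplete" using mcomplete_map_space[OF A clo] by (simp add: mcomplete_of_def)
    fix D assume D: "D \<in> \<D>"
    have sub: "D \<subseteq> A" using \<D>(2)[OF D] by (simp add: code_open_def)
    have "map_topology A closure_of D = A"
      using \<D>(3)[OF D] unfolding closure_of_map_topology[OF A sub] code_dense_def by blast
    then show "openin F.mtopology D \<and> F.mtopology closure_of D = A"
      using \<D>(2)[OF D] openin_map_topology[OF A] unfolding top by blast
  qed
  then have "map_topology A closure_of (A \<inter> \<Inter>\<D>) = A"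
    using closure_of_restrict[of "map_topology A" "\<Inter>\<D>"] topspace_map_topology[OF A] by simp
  then show ?thesis using ne closure_of_empty[of "map_topology A"] by (metis Int_commute)
qed

lemma conj_map_eq: "conj_map X h f = conjugate h f"
  by (simp add: conj_map_def conjugate_def)

lemma conj_class_eq: "conj_class X f = (\<lambda>h. conjugate h f) ` homeos"
  by (auto simp: conj_class_def conj_map_eq homeos_def)

lemma cont_surj_Per_eq: "Q \<subseteq> {1..} \<Longrightarrow> cont_surj_Per X Q = surjs_per Q"
  unfolding cont_surj_Per_def mspace_cont_surj_space surjs_per_def Per_def per_def
  by (auto simp: subset_iff)

lemma cont_surj_fix_eq: "cont_surj_fix X = surjs_per {1}"
  unfolding cont_surj_fix_def mspace_cont_surj_space surjs_per_def per_def by auto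

lemma surjs_subset: "surjs \<subseteq> cmaps" "surjs_per Q \<subseteq> surjs"
  by (auto simp: surjs_def surjs_per_def)

lemma surjs_per_closed_conj_invariant: "closed_conj_invariant X (surjs_per Q)"
  unfolding closed_conj_invariant_def mtopology_cont_surj_space
proof
  show "closedin (map_topology surjs) (surjs_per Q)"
    by (rule closedin_map_topology[OF surjs_subset]) (rule surjs_per_closed)
  show "\<forall>f\<in>surjs_per Q. conj_class X f \<subseteq> surjs_per Q"
    by (auto simp: conj_class_eq conj_surjs_per)
qed

lemma conj_transitive_elementI:
  assumes g: "g \<in> surjs_per Q" "\<And>f n. f \<in> surjs_per Q \<Longrightarrow> \<exists>h\<in>homeos. close n (conjugate h g) f"
  shows "conj_transitive_element X (surjs_per Q) g"
  unfolding conj_transitive_element_def mtopology_cont_surj_space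
proof (intro conjI surjs_per_closed_conj_invariant g(1))
  have sub: "conj_class X g \<subseteq> surjs_per Q" using g(1) conj_surjs_per by (auto simp: conj_class_eq)
  then have "conj_class X g \<subseteq> surjs" using surjs_subset by blast
  note closure_of_map_topology[OF surjs_subset(1) this]
  moreover have "{f \<in> surjs. \<forall>n. \<exists>g\<in>conj_class X g. close n f g} = surjs_per Q"
  proof (intro equalityI subsetI)
    fix f assume "f \<in> {f \<in> surjs. \<forall>n. \<exists>g\<in>conj_class X g. close n f g}"
    then show "f \<in> surjs_per Q" using sub by (intro surjs_per_closed) blast+
  next
    fix f assume f: "f \<in> surjs_per Q"
    have "\<exists>e\<in>conj_class X g. close n f e" for n
      using g(2)[OF f, of n] close_sym unfolding conj_class_eq by blast
    then show "f \<in> {f \<in> surjs. \<forall>n. \<exists>g\<in>conj_class X g. close n f g}" using f surjs_subset by blast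
  qed
  ultimately show "map_topology surjs closure_of conj_class X g = surjs_per Q" by simp
qed

lemma conj_transitive_surjs_per: "conj_transitive X (surjs_per Q)"
proof -
  obtain g where "g \<in> surjs_per Q" "\<And>f n. f \<in> surjs_per Q \<Longrightarrow> \<exists>h\<in>homeos. close n (conjugate h g) f"
    using surjs_per_dense_class[of Q] by blast
  then show ?thesis unfolding conj_transitive_def using conj_transitive_elementI by blast
qed

text \<open>The Baire category theorem in \<open>K\<close> provides a generic map, and its conjugacy class is the set of all
generic maps.  This is a \<open>G\<^sub>\<delta>\<close> set in \<open>K\<close>, and \<open>K\<close> is closed.\<close>

lemma residual_type_element_exists: "\<exists>f. residual_type_element X (surjs_per {1}) f"
proof -
  let ?K = "surjs_per {1}"
  obtain \<D> where \<D>: "countable \<D>" "\<D> \<noteq> {}" "\<And>D. D \<in> \<D> \<Longrightarrow> code_open ?K D"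
    "\<And>D. D \<in> \<D> \<Longrightarrow> code_dense ?K D" "\<Inter>\<D> = {f. generic f}"
    using generic_countable_intersection by blast
  have K: "?K \<subseteq> cmaps" using surjs_subset by blast
  have "closedin (map_topology cmaps) ?K"
  proof (rule closedin_map_topology[OF order_refl K])
    fix f assume f: "f \<in> cmaps" "\<And>n. \<exists>g\<in>?K. close n f g"
    then have "f \<in> surjs" using surjs_subset by (intro surjs_closed) blast+
    then show "f \<in> ?K" using f(2) by (rule surjs_per_closed)
  qed
  then have "\<Inter>\<D> \<inter> ?K \<noteq> {}"
    using surjs_per_nonempty \<D> by (intro Baire_map_topology K) auto
  then obtain f where f: "generic f" using \<D>(5) by blast
  have "conj_class X f = {f. generic f}"
  proof (intro equalityI subsetI)
    fix g assume "g \<in> {f. generic f}"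
    then obtain h where "h \<in> homeos" "conjugate h f = g" using generic_conjugate[OF f] by blast
    then show "g \<in> conj_class X f" by (auto simp: conj_class_eq)
  qed (use f generic_conj in \<open>auto simp: conj_class_eq\<close>)
  then have cls: "conj_class X f = \<Inter>\<D>" using \<D>(5) by simp
  have "gdelta_in (map_topology ?K) (\<Inter>\<D>)"
    using \<D> openin_map_topology[OF K] by (intro gdelta_in_Inter open_imp_gdelta_in) auto
  moreover have "map_topology ?K = subtopology (map_topology surjs) ?K"
    using surjs_subset(2) by (simp add: map_topology_subtopology Int_absorb1)
  moreover have "gdelta_in (map_topology surjs) ?K"
  proof (rule closed_imp_gdelta_in)
    show "metrizable_space (map_topology surjs)"
      unfolding map_topology_def mtopology_of_def
      by (intro Metric_space.metrizable_space_mtopology Metric_space_mspace_mdist)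
    show "closedin (map_topology surjs) ?K"
      by (rule closedin_map_topology[OF surjs_subset]) (rule surjs_per_closed)
  qed
  ultimately have "gdelta_in (map_topology surjs) (conj_class X f)"
    using cls gdelta_in_gdelta_subtopology by metis
  moreover have "conj_transitive_element X ?K f"
  proof (rule conj_transitive_elementI)
    show "f \<in> ?K" using f by (simp add: generic_def)
    show "\<exists>h\<in>homeos. close n (conjugate h f) g" if "g \<in> ?K" for g n
      using f that unfolding generic_def dense_at_def stab_0 by simp
  qed
  ultimately show ?thesis
    unfolding residual_type_element_def mtopology_cont_surj_space by blast
qed

end

theorem theorem4p8:
  fixes X :: "'a metric"
  assumes "cantor_space X"
  shows "(\<forall>Q :: nat set. Q \<subseteq> {1..} \<longrightarrow> conj_transitive X (cont_surj_Per X Q)) \<and>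
         (\<forall>Q :: nat set. Q \<subseteq> {1..} \<and> 1 \<in> Q \<longrightarrow> cont_surj_fix X = cont_surj_Per X Q) \<and>
         (\<exists>f. residual_type_element X (cont_surj_fix X) f)"
proof -
  have T: "cantor_like (mtopology_of X)" using assms by (rule cantor_space_imp_cantor_like)
  then have "zero_dim_compact (mtopology_of X)" by (simp add: cantor_like_def)
  then obtain C :: "nat \<Rightarrow> 'a set" where C: "\<And>n. openin (mtopology_of X) (C n)" "\<And>n. closedin (mtopology_of X) (C n)"
    "\<And>x y. \<lbrakk>x \<in> topspace (mtopology_of X); y \<in> topspace (mtopology_of X); x \<noteq> y\<rbrakk> \<Longrightarrow> \<exists>n. (x \<in> C n) \<noteq> (y \<in> C n)"
    using zero_dim_compact_enum by blast
  interpret coded_metric_cantor X C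
    by unfold_locales (use T C in blast)+
  have "cont_surj_fix X = cont_surj_Per X Q" if Q: "Q \<subseteq> {1..}" "1 \<in> Q" for Q
  proof -
    have "surjs_per Q = surjs_per {1}"
    proof
      show "surjs_per {1} \<subseteq> surjs_per Q"
      proof
        fix f assume f: "f \<in> surjs_per {1}"
        then obtain x where x: "x \<in> M" "f x = x" by (auto simp: surjs_per_def per_def)
        have "(f ^^ n) x = x" for n by (induction n) (use x in auto)
        then have "per f = UNIV" using x by (auto simp: per_def)
        then show "f \<in> surjs_per Q" using f by (simp add: surjs_per_def)
      qed
    qed (use Q in \<open>auto simp: surjs_per_def\<close>)
    then show ?thesis using cont_surj_fix_eq cont_surj_Per_eq[OF Q(1)] by simp
  qed
  then show ?thesis
    using conj_transitive_surjs_per cont_surj_Per_eq residual_type_element_exists cont_surj_fix_eq by simp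
qed

end
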